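(* Let $C$ be a tropical variety of pure dimension $d$ in an open subset $U$ of $\mathbb R^n$, and let $f\colon C\to\mathbb R$ be a piecewise smooth function that is weakly tropically psh. If $f$ has a local maximum at $\omega\in C$, then $f$ is constant in a neighbourhood of $\omega$ in $C$.
   Context: A tropical variety $C$ of pure dimension $d$ in $U$ is (the support of) a locally finite polyhedral complex $\mathcal C$ in $U$, considered up to refinement, of pure dimension $d$, consisting of $(\mathbb Z,\mathbb R)$-polyhedra (finite intersections of half-spaces $\{m_1x_1+\dots+m_nx_n+c\ge0\}$ with $m_i\in\mathbb Z$, $c\in\mathbb R$) intersected with $U$, together with positive constant weights $m_\sigma$ on the $d$-dimensional faces $\sigma$ satisfying the balancing condition: for every $(d-1)$-dimensional face $\tau$ meeting $U$, $\sum_{\sigma\supset\tau}m_\sigma\,\nu_{\sigma,\tau}\in\mathbb L_\tau$, where $\sigma$ runs over the $d$-dimensional faces containing $\tau$, $\mathbb L_\sigma,\mathbb L_\tau$ are the linear spaces parallel to $\sigma,\tau$, and $\nu_{\sigma,\tau}\in\mathbb Z^n\cap\mathbb L_\sigma$ points from $\tau$ into $\sigma$ and generates $(\mathbb Z^n\cap\mathbb L_\sigma)/(\mathbb Z^n\cap\mathbb L_\tau)$. A function $f\colon C\to\mathbb R$ is piecewise smooth if it is continuous and, for a suitable choice of $\mathcal C$, smooth on each face of $\mathcal C$. Lagerberg forms: a $(p,q)$-form on an open subset of $\mathbb R^n$ is $\sum f_{IJ}\,d'x_I\wedge d''x_J$ with $f_{IJ}$ smooth, $|I|=p$, $|J|=q$,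 in the exterior algebra on $d'x_i,d''x_j$; $d'f=\sum_i\partial_if\,d'x_i$, $d''f=\sum_i\partial_if\,d''x_i$, extended as antiderivations killing all $d'x_i,d''x_j$. Forms on $C$ are locally restrictions of forms on open subsets of $U$, two forms being identified if their restrictions to all faces agree. A $(d-1,d-1)$-form on $C$ is positive if its restriction to each $d$-dimensional face is pointwise a nonnegative combination of forms $\alpha_1\wedge J\alpha_1\wedge\dots\wedge\alpha_{d-1}\wedge J\alpha_{d-1}$, with $\alpha_i$ of bidegree $(1,0)$ and $J(d'x_i)=d''x_i$. For a $d$-dimensional face $\sigma$, $\int_\sigma g\,d'y_1\wedge d''y_1\wedge\dots\wedge d'y_d\wedge d''y_d:=\int_\sigma g\,dy_1\cdots dy_d$ (Lebesgue) for affine coordinates $y_i$ on $\sigma$ whose linear parts form a basis of the dual of $\mathbb Z^n\cap\mathbb L_\sigma$. Weakly tropically psh: the current $[f]$ on $C$ is $\theta\mapsto\sum_\sigma m_\sigma\int_\sigma f\theta$ for compactly supported $(d,d)$-forms $\theta$ on $C$. The function $f$ is weakly tropically psh if the Lagerberg current $d'd''[f]$ is positive, i.e. $\sum_\sigma m_\sigma\int_\sigma f\,d'd''\eta\ge0$ for every compactly supported positive $(d-1,d-1)$-form $\eta$ on $C$. *)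

theory Defs
  imports "HOL-Analysis.Analysis"
begin

text \<open>This is the usual space of real vectors indexed by \<open>'n\<close>; unlike the \<open>^\<close> notation for types, the
  abbreviation does not fix the sort of \<open>'n\<close>. The order on \<open>'n\<close> is only used to write down basis
  elements of exterior algebras.\<close>
type_synonym 'n rvec = "(real, 'n) vec"

section \<open>Smooth functions\<close>

definition partial_deriv :: "'n::finite \<Rightarrow> ('n rvec \<Rightarrow> real) \<Rightarrow> 'n rvec \<Rightarrow> real" where
  "partial_deriv i f x = frechet_derivative f (at x) (axis i 1)"

primrec Ck_on :: "nat \<Rightarrow> 'n::finite rvec set \<Rightarrow> ('n rvec \<Rightarrow> real) \<Rightarrow> bool" where
  "Ck_on 0 W f \<longleftrightarrow> continuous_on W f"
| "Ck_on (Suc k) W f \<longleftrightarrow>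
     (\<forall>x\<in>W. f differentiable (at x)) \<and> (\<forall>i. Ck_on k W (partial_deriv i f))"

text \<open>Only used for open \<open>W\<close>.\<close>
definition smooth_on :: "'n::finite rvec set \<Rightarrow> ('n rvec \<Rightarrow> real) \<Rightarrow> bool" where
  "smooth_on W f \<longleftrightarrow> (\<forall>k. Ck_on k W f)"

text \<open>Smoothness on a face, which need not be open: local smooth extensions exist.\<close>
definition smooth_on_face :: "'n::finite rvec set \<Rightarrow> ('n rvec \<Rightarrow> real) \<Rightarrow> bool" where
  "smooth_on_face \<sigma> f \<longleftrightarrow>
     (\<forall>x\<in>\<sigma>. \<exists>W g. open W \<and> x \<in> W \<and> smooth_on W g \<and> (\<forall>y\<in>\<sigma> \<inter> W. f y = g y))"

section \<open>Polyhedral complexes and tropical varieties\<close>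

definition ZR_polyhedron :: "'n::finite rvec set \<Rightarrow> bool" where
  "ZR_polyhedron P \<longleftrightarrow> (\<exists>H :: ((int^'n) \<times> real) set. finite H \<and>
     P = {x. \<forall>(m, c)\<in>H. 0 \<le> (\<Sum>i\<in>UNIV. of_int (m $ i) * x $ i) + c})"

text \<open>The members of a complex in \<open>U\<close> are the traces \<open>P \<inter> U\<close>, not the polyhedra \<open>P\<close> themselves.
  For nonempty \<open>\<tau>\<close> and open \<open>U\<close> the following does not depend on the choice of \<open>P\<close>.\<close>
definition face_in :: "'n::finite rvec set \<Rightarrow> 'n rvec set \<Rightarrow> 'n rvec set \<Rightarrow> bool" where
  "face_in U \<tau> \<sigma> \<longleftrightarrow> (\<exists>P F. ZR_polyhedron P \<and> F face_of P \<and> \<sigma> = P \<inter> U \<and> \<tau> = F \<inter> U)"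

text \<open>The empty face is not counted as a member.\<close>
definition polyhedral_complex_in :: "'n::finite rvec set \<Rightarrow> 'n rvec set set \<Rightarrow> bool" where
  "polyhedral_complex_in U \<C> \<longleftrightarrow>
     (\<forall>\<sigma>\<in>\<C>. \<sigma> \<noteq> {} \<and> (\<exists>P. ZR_polyhedron P \<and> \<sigma> = P \<inter> U)) \<and>
     (\<forall>\<sigma>\<in>\<C>. \<forall>\<tau>. \<tau> \<noteq> {} \<and> face_in U \<tau> \<sigma> \<longrightarrow> \<tau> \<in> \<C>) \<and>
     (\<forall>\<sigma>\<in>\<C>. \<forall>\<tau>\<in>\<C>. \<sigma> \<inter> \<tau> \<noteq> {} \<longrightarrow> face_in U (\<sigma> \<inter> \<tau>) \<sigma> \<and> face_in U (\<sigma> \<inter> \<tau>) \<tau>) \<and>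
     (\<forall>x\<in>U. \<exists>W. open W \<and> x \<in> W \<and> finite {\<sigma>\<in>\<C>. \<sigma> \<inter> W \<noteq> {}})"

definition faces_of_dim :: "nat \<Rightarrow> 'n::finite rvec set set \<Rightarrow> 'n rvec set set" where
  "faces_of_dim d \<C> = {\<sigma>\<in>\<C>. aff_dim \<sigma> = int d}"

definition pure_dim :: "nat \<Rightarrow> 'n::finite rvec set set \<Rightarrow> bool" where
  "pure_dim d \<C> \<longleftrightarrow> (\<forall>\<tau>\<in>\<C>. \<exists>\<sigma>\<in>faces_of_dim d \<C>. \<tau> \<subseteq> \<sigma>)"

text \<open>The linear space \<open>\<LL>\<^sub>\<sigma>\<close> parallel to \<open>\<sigma>\<close>, and the lattice \<open>\<int>\<^sup>n \<inter> \<LL>\<^sub>\<sigma>\<close>.\<close>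
definition par_space :: "'n::finite rvec set \<Rightarrow> 'n rvec set" where
  "par_space \<sigma> = span {y - x | x y. x \<in> \<sigma> \<and> y \<in> \<sigma>}"

definition par_lattice :: "'n::finite rvec set \<Rightarrow> 'n rvec set" where
  "par_lattice \<sigma> = {v \<in> par_space \<sigma>. \<forall>i. v $ i \<in> \<int>}"

definition lattice_normal :: "'n::finite rvec set \<Rightarrow> 'n rvec set \<Rightarrow> 'n rvec \<Rightarrow> bool" where
  "lattice_normal \<sigma> \<tau> \<nu> \<longleftrightarrow> \<nu> \<in> par_lattice \<sigma> \<and>
     (\<exists>x\<in>\<tau>. \<exists>t>0. x + t *\<^sub>R \<nu> \<in> \<sigma>) \<and>
     par_lattice \<sigma> = {u + of_int k *\<^sub>R \<nu> | u k. u \<in> par_lattice \<tau>}"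

text \<open>\<open>aff_dim\<close> is integer-valued, so for \<open>d = 0\<close> there are no \<open>\<tau>\<close> to consider. The sum is finite
  by local finiteness, and whether it lies in \<open>\<LL>\<^sub>\<tau>\<close> does not depend on the choice of \<open>\<nu>\<close>.\<close>
definition balanced :: "nat \<Rightarrow> 'n::finite rvec set set \<Rightarrow> ('n rvec set \<Rightarrow> real) \<Rightarrow> bool" where
  "balanced d \<C> m \<longleftrightarrow> (\<forall>\<tau>\<in>\<C>. aff_dim \<tau> = int d - 1 \<longrightarrow>
     (\<exists>\<nu>. (\<forall>\<sigma>\<in>faces_of_dim d \<C>. \<tau> \<subseteq> \<sigma> \<longrightarrow> lattice_normal \<sigma> \<tau> (\<nu> \<sigma>)) \<and>
          (\<Sum>\<sigma> | \<sigma> \<in> faces_of_dim d \<C> \<and> \<tau> \<subseteq> \<sigma>. m \<sigma> *\<^sub>R \<nu> \<sigma>) \<in> par_space \<tau>))"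

text \<open>A tropical variety is presented by a weighted complex \<open>(\<C>, m)\<close>; its support is \<open>\<Union>\<C>\<close>.\<close>
definition tropical_variety ::
  "'n::finite rvec set \<Rightarrow> nat \<Rightarrow> 'n rvec set set \<Rightarrow> ('n rvec set \<Rightarrow> real) \<Rightarrow> bool" where
  "tropical_variety U d \<C> m \<longleftrightarrow> polyhedral_complex_in U \<C> \<and> pure_dim d \<C> \<and>
     (\<forall>\<sigma>\<in>faces_of_dim d \<C>. 0 < m \<sigma>) \<and> balanced d \<C> m"

definition tropical_refines ::
  "nat \<Rightarrow> 'n::finite rvec set set \<Rightarrow> ('n rvec set \<Rightarrow> real) \<Rightarrow>
     'n rvec set set \<Rightarrow> ('n rvec set \<Rightarrow> real) \<Rightarrow> bool" where
  "tropical_refines d \<C>' m' \<C> m \<longleftrightarrow> \<Union>\<C>' = \<Union>\<C> \<and> (\<forall>\<sigma>'\<in>\<C>'. \<exists>\<sigma>\<in>\<C>. \<sigma>' \<subseteq> \<sigma>) \<and>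
     (\<forall>\<sigma>'\<in>faces_of_dim d \<C>'. \<forall>\<sigma>\<in>faces_of_dim d \<C>. \<sigma>' \<subseteq> \<sigma> \<longrightarrow> m' \<sigma>' = m \<sigma>)"

definition same_tropical_variety ::
  "'n::finite rvec set \<Rightarrow> nat \<Rightarrow> 'n rvec set set \<Rightarrow> ('n rvec set \<Rightarrow> real) \<Rightarrow>
     'n rvec set set \<Rightarrow> ('n rvec set \<Rightarrow> real) \<Rightarrow> bool" where
  "same_tropical_variety U d \<C> m \<C>' m' \<longleftrightarrow> (\<exists>\<C>'' m''. tropical_variety U d \<C>'' m'' \<and>
     tropical_refines d \<C>'' m'' \<C> m \<and> tropical_refines d \<C>'' m'' \<C>' m')"

definition piecewise_smooth ::
  "'n::finite rvec set \<Rightarrow> nat \<Rightarrow> 'n rvec set set \<Rightarrow> ('n rvec set \<Rightarrow> real) \<Rightarrow>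
     ('n rvec \<Rightarrow> real) \<Rightarrow> bool" where
  "piecewise_smooth U d \<C> m f \<longleftrightarrow> continuous_on (\<Union>\<C>) f \<and>
     (\<exists>\<C>' m'. tropical_variety U d \<C>' m' \<and> same_tropical_variety U d \<C> m \<C>' m' \<and>
        (\<forall>\<sigma>\<in>\<C>'. smooth_on_face \<sigma> f))"

section \<open>The exterior algebra on generators \<open>d'x\<^sub>i\<close>, \<open>d''x\<^sub>j\<close>\<close>

text \<open>An element is given by its coefficients: \<open>a I J\<close> is the coefficient of \<open>d'x\<^sub>I \<and> d''x\<^sub>J\<close>, where
  index sets are listed in increasing order. The index type is \<open>'n\<close> for coordinates on \<open>\<real>\<^sup>n\<close> and
  \<open>nat\<close> (using the indices \<open>0, \<dots>, k - 1\<close>) for coordinates on a \<open>k\<close>-dimensional face.\<close>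
type_synonym 'i lext = "'i set \<Rightarrow> 'i set \<Rightarrow> real"

definition shuffle_sign :: "'i::linorder set \<Rightarrow> 'i set \<Rightarrow> real" where
  "shuffle_sign A B = (-1) ^ card {(a, b). a \<in> A \<and> b \<in> B \<and> b < a}"

text \<open>The first sign comes from moving \<open>d'x\<^sub>I\<^sub>-\<^sub>A\<close> past \<open>d''x\<^sub>B\<close>.\<close>
definition wedge :: "'i::linorder lext \<Rightarrow> 'i lext \<Rightarrow> 'i lext" (infixr "\<and>\<^sub>L" 70) where
  "(a \<and>\<^sub>L b) = (\<lambda>I J. \<Sum>A\<in>Pow I. \<Sum>B\<in>Pow J.
     (-1) ^ (card B * card (I - A)) * shuffle_sign A (I - A) * shuffle_sign B (J - B) *
     a A B * b (I - A) (J - B))"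

definition lext_one :: "'i lext" where
  "lext_one = (\<lambda>I J. if I = {} \<and> J = {} then 1 else 0)"

definition wedge_list :: "'i::linorder lext list \<Rightarrow> 'i lext" where
  "wedge_list as = foldr wedge as lext_one"

text \<open>\<open>lin' S c\<close> is \<open>\<Sum>\<^sub>i\<^sub>\<in>\<^sub>S c\<^sub>i d'x\<^sub>i\<close> and \<open>lin'' S c\<close> is its image \<open>\<Sum>\<^sub>i\<^sub>\<in>\<^sub>S c\<^sub>i d''x\<^sub>i\<close> under \<open>J\<close>.\<close>
definition lin' :: "'i set \<Rightarrow> ('i \<Rightarrow> real) \<Rightarrow> 'i lext" where
  "lin' S c = (\<lambda>I J. \<Sum>i\<in>S. if I = {i} \<and> J = {} then c i else 0)"

definition lin'' :: "'i set \<Rightarrow> ('i \<Rightarrow> real) \<Rightarrow> 'i lext" where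
  "lin'' S c = (\<lambda>I J. \<Sum>i\<in>S. if I = {} \<and> J = {i} then c i else 0)"

definition gen' :: "'i \<Rightarrow> 'i lext" where
  "gen' i = lin' {i} (\<lambda>_. 1)"

definition gen'' :: "'i \<Rightarrow> 'i lext" where
  "gen'' i = lin'' {i} (\<lambda>_. 1)"

text \<open>Pullback along the linear map \<open>\<real>\<^sup>k \<rightarrow> \<real>\<^sup>n\<close>, \<open>y \<mapsto> \<Sum>\<^sub>j\<^sub><\<^sub>k y\<^sub>j v\<^sub>j\<close>: the algebra homomorphism with
  \<open>d'x\<^sub>i \<mapsto> \<Sum>\<^sub>j\<^sub><\<^sub>k (v\<^sub>j)\<^sub>i d'y\<^sub>j\<close> and \<open>d''x\<^sub>i \<mapsto> \<Sum>\<^sub>j\<^sub><\<^sub>k (v\<^sub>j)\<^sub>i d''y\<^sub>j\<close>.\<close>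
definition lext_pullback ::
  "nat \<Rightarrow> (nat \<Rightarrow> 'n rvec) \<Rightarrow> 'n::{finite,linorder} lext \<Rightarrow> nat lext" where
  "lext_pullback k v a = (\<lambda>K L. \<Sum>I\<in>UNIV. \<Sum>J\<in>UNIV. a I J *
     (wedge_list (map (\<lambda>i. lin' {..<k} (\<lambda>j. v j $ i)) (sorted_list_of_set I)) \<and>\<^sub>L
      wedge_list (map (\<lambda>i. lin'' {..<k} (\<lambda>j. v j $ i)) (sorted_list_of_set J))) K L)"

section \<open>Lagerberg forms\<close>

definition lagerberg_form ::
  "nat \<Rightarrow> nat \<Rightarrow> 'n::finite rvec set \<Rightarrow> ('n rvec \<Rightarrow> 'n lext) \<Rightarrow> bool" where
  "lagerberg_form p q W \<omega> \<longleftrightarrow> (\<forall>I J. smooth_on W (\<lambda>x. \<omega> x I J)) \<and>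
     (\<forall>x\<in>W. \<forall>I J. \<omega> x I J \<noteq> 0 \<longrightarrow> card I = p \<and> card J = q)"

text \<open>\<open>d'\<omega> = \<Sum>\<^sub>i d'x\<^sub>i \<and> \<partial>\<^sub>i\<omega>\<close> and \<open>d''\<omega> = \<Sum>\<^sub>i d''x\<^sub>i \<and> \<partial>\<^sub>i\<omega>\<close>, with \<open>\<partial>\<^sub>i\<close> acting on coefficients.\<close>
definition diff' ::
  "('n rvec \<Rightarrow> 'n::{finite,linorder} lext) \<Rightarrow> 'n rvec \<Rightarrow> 'n lext" where
  "diff' \<omega> x = (\<lambda>I J. \<Sum>i\<in>UNIV. (gen' i \<and>\<^sub>L (\<lambda>A B. partial_deriv i (\<lambda>z. \<omega> z A B) x)) I J)"

definition diff'' ::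
  "('n rvec \<Rightarrow> 'n::{finite,linorder} lext) \<Rightarrow> 'n rvec \<Rightarrow> 'n lext" where
  "diff'' \<omega> x = (\<lambda>I J. \<Sum>i\<in>UNIV. (gen'' i \<and>\<^sub>L (\<lambda>A B. partial_deriv i (\<lambda>z. \<omega> z A B) x)) I J)"

definition lattice_basis :: "'n::finite rvec set \<Rightarrow> (nat \<Rightarrow> 'n rvec) \<Rightarrow> bool" where
  "lattice_basis \<sigma> v \<longleftrightarrow> inj_on v {..<dim (par_space \<sigma>)} \<and>
     independent (v ` {..<dim (par_space \<sigma>)}) \<and>
     par_lattice \<sigma> = {\<Sum>j<dim (par_space \<sigma>). of_int (c j) *\<^sub>R v j | c. True}"

text \<open>Coordinates \<open>y\<close> on a face: \<open>y \<mapsto> x\<^sub>0 + \<Sum>\<^sub>j y\<^sub>j v\<^sub>j\<close> for a fixed \<open>x\<^sub>0 \<in> \<sigma>\<close> and a fixed basis \<open>v\<close> of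
  \<open>\<int>\<^sup>n \<inter> \<LL>\<^sub>\<sigma>\<close>. Such a basis exists for every face of a complex as above. Agreement of restrictions,
  positivity and integrals do not depend on the choices.\<close>
definition face_basis :: "'n::finite rvec set \<Rightarrow> nat \<Rightarrow> 'n rvec" where
  "face_basis \<sigma> = (SOME v. lattice_basis \<sigma> v)"

definition face_chart :: "'n::finite rvec set \<Rightarrow> (nat \<Rightarrow> real) \<Rightarrow> 'n rvec" where
  "face_chart \<sigma> y = (SOME x. x \<in> \<sigma>) + (\<Sum>j<dim (par_space \<sigma>). y j *\<^sub>R face_basis \<sigma> j)"

definition restrict_to_face ::
  "'n rvec set \<Rightarrow> 'n::{finite,linorder} lext \<Rightarrow> nat lext" where
  "restrict_to_face \<sigma> = lext_pullback (dim (par_space \<sigma>)) (face_basis \<sigma>)"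

text \<open>A form \<open>\<eta>\<close> on the support of \<open>\<C>\<close> is the family of its restrictions \<open>\<eta> \<sigma>\<close> to the faces, written in
  the coordinates above. Only the values \<open>\<eta> \<sigma> y\<close> with \<open>\<sigma> \<in> \<C>\<close> and \<open>y \<in> \<sigma>\<close> are meaningful.\<close>
type_synonym 'n cform = "'n rvec set \<Rightarrow> 'n rvec \<Rightarrow> nat lext"

definition restricts_to ::
  "'n rvec set set \<Rightarrow> 'n rvec set \<Rightarrow> ('n rvec \<Rightarrow> 'n::{finite,linorder} lext) \<Rightarrow>
     'n cform \<Rightarrow> bool" where
  "restricts_to \<C> W \<omega> \<eta> \<longleftrightarrow> (\<forall>\<sigma>\<in>\<C>. \<forall>y\<in>\<sigma> \<inter> W. \<eta> \<sigma> y = restrict_to_face \<sigma> (\<omega> y))"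

definition form_on_complex ::
  "'n rvec set \<Rightarrow> 'n rvec set set \<Rightarrow> nat \<Rightarrow> nat \<Rightarrow> 'n::{finite,linorder} cform \<Rightarrow> bool" where
  "form_on_complex U \<C> p q \<eta> \<longleftrightarrow> (\<forall>x\<in>\<Union>\<C>. \<exists>W \<omega>. open W \<and> x \<in> W \<and> W \<subseteq> U \<and>
     lagerberg_form p q W \<omega> \<and> restricts_to \<C> W \<omega> \<eta>)"

text \<open>\<open>\<zeta> = d'd''\<eta>\<close> for forms on the support of \<open>\<C>\<close>. Since \<open>d'\<close> and \<open>d''\<close> commute with restriction to
  faces, \<open>\<zeta>\<close> is determined by \<open>\<eta>\<close> at the points of the faces.\<close>
definition is_ddc ::
  "'n rvec set \<Rightarrow> 'n rvec set set \<Rightarrow> nat \<Rightarrow> nat \<Rightarrow> 'n::{finite,linorder} cform \<Rightarrow>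
     'n cform \<Rightarrow> bool" where
  "is_ddc U \<C> p q \<eta> \<zeta> \<longleftrightarrow> (\<forall>x\<in>\<Union>\<C>. \<exists>W \<omega>. open W \<and> x \<in> W \<and> W \<subseteq> U \<and>
     lagerberg_form p q W \<omega> \<and> restricts_to \<C> W \<omega> \<eta> \<and> restricts_to \<C> W (diff' (diff'' \<omega>)) \<zeta>)"

definition form_support :: "'n::finite rvec set set \<Rightarrow> 'n cform \<Rightarrow> 'n rvec set" where
  "form_support \<C> \<eta> = \<Union>\<C> \<inter> closure {y. \<exists>\<sigma>\<in>\<C>. y \<in> \<sigma> \<and> \<eta> \<sigma> y \<noteq> (\<lambda>I J. 0)}"

definition positive_generators :: "nat \<Rightarrow> nat \<Rightarrow> nat lext set" where
  "positive_generators k p =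
     {wedge_list (concat (map (\<lambda>c. [lin' {..<k} c, lin'' {..<k} c]) cs)) | cs. length cs = p}"

definition positive_lext :: "nat \<Rightarrow> nat \<Rightarrow> nat lext \<Rightarrow> bool" where
  "positive_lext k p a \<longleftrightarrow> (\<exists>N (t :: nat \<Rightarrow> real) b.
     (\<forall>i<N. 0 \<le> t i \<and> b i \<in> positive_generators k p) \<and>
     a = (\<lambda>I J. \<Sum>i<N. t i * b i I J))"

definition positive_form :: "nat \<Rightarrow> 'n::finite rvec set set \<Rightarrow> nat \<Rightarrow> 'n cform \<Rightarrow> bool" where
  "positive_form d \<C> p \<eta> \<longleftrightarrow> (\<forall>\<sigma>\<in>faces_of_dim d \<C>. \<forall>y\<in>\<sigma>. positive_lext d p (\<eta> \<sigma> y))"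

section \<open>Integration and weakly tropically psh functions\<close>

text \<open>\<open>d'y\<^sub>0 \<and> d''y\<^sub>0 \<and> \<dots> \<and> d'y\<^sub>k\<^sub>-\<^sub>1 \<and> d''y\<^sub>k\<^sub>-\<^sub>1\<close>, which is \<open>\<plusminus>\<close> the basis element with index sets
  \<open>{..<k}\<close>, \<open>{..<k}\<close>; hence the division in \<open>top_coeff\<close>.\<close>
definition lext_volume :: "nat \<Rightarrow> nat lext" where
  "lext_volume k = wedge_list (concat (map (\<lambda>j. [gen' j, gen'' j]) [0..<k]))"

definition top_coeff :: "nat \<Rightarrow> nat lext \<Rightarrow> real" where
  "top_coeff k a = a {..<k} {..<k} / lext_volume k {..<k} {..<k}"

definition face_integral :: "'n::finite rvec set \<Rightarrow> ('n rvec \<Rightarrow> nat lext) \<Rightarrow> real" where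
  "face_integral \<sigma> \<theta> =
     (let k = dim (par_space \<sigma>); M = PiM {..<k} (\<lambda>_. lborel :: real measure)
      in set_lebesgue_integral M {y \<in> space M. face_chart \<sigma> y \<in> \<sigma>}
           (\<lambda>y. top_coeff k (\<theta> (face_chart \<sigma> y))))"

text \<open>The current \<open>[f]\<close>. For compactly supported \<open>\<theta>\<close> only finitely many summands are nonzero.\<close>
definition tropical_current ::
  "nat \<Rightarrow> 'n::finite rvec set set \<Rightarrow> ('n rvec set \<Rightarrow> real) \<Rightarrow> ('n rvec \<Rightarrow> real) \<Rightarrow>
     'n cform \<Rightarrow> real" where
  "tropical_current d \<C> m f \<theta> =
     (\<Sum>\<^sub>\<infinity>\<sigma>\<in>faces_of_dim d \<C>. m \<sigma> * face_integral \<sigma> (\<lambda>x I J. f x * \<theta> \<sigma> x I J))"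

text \<open>Here \<open>p = d - 1\<close>; for \<open>d = 0\<close> there are no test forms and the condition is void.\<close>
definition weakly_tropically_psh ::
  "'n rvec set \<Rightarrow> nat \<Rightarrow> 'n rvec set set \<Rightarrow> ('n rvec set \<Rightarrow> real) \<Rightarrow>
     ('n::{finite,linorder} rvec \<Rightarrow> real) \<Rightarrow> bool" where
  "weakly_tropically_psh U d \<C> m f \<longleftrightarrow> (\<forall>p \<eta> \<zeta>. d = Suc p \<longrightarrow>
     form_on_complex U \<C> p p \<eta> \<longrightarrow> compact (form_support \<C> \<eta>) \<longrightarrow> positive_form d \<C> p \<eta> \<longrightarrow>
     is_ddc U \<C> p p \<eta> \<zeta> \<longrightarrow> 0 \<le> tropical_current d \<C> m f \<zeta>)"

end

theory Submission
  imports Defs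
begin

text \<open>Only radial test forms are needed. Let \<open>\<omega>\<close> be the local maximum, \<open>g = f - f(\<omega>) \<le> 0\<close>, and test
  with \<open>\<eta> = h \<beta>\<close>, where \<open>h(x) = H(|x - \<omega>|\<^sup>2) \<ge> 0\<close> has small support and \<open>\<beta>\<close> is, up to a factor, the
  \<open>(d-1)\<close>-st power of \<open>\<Sum>\<^sub>i d'x\<^sub>i \<and> d''x\<^sub>i\<close>. On a \<open>d\<close>-dimensional face \<open>\<sigma>\<close> through \<open>\<omega>\<close> the form \<open>d'd''\<eta>\<close> is a
  positive constant times the \<open>d\<close>-dimensional Laplacian \<open>2 d H' + 4 s H''\<close> at \<open>s = |x - \<omega>|\<^sup>2\<close>, which does
  not depend on \<open>\<sigma>\<close>. For \<open>l > 1\<close> one can choose \<open>H\<close> such that it equals \<open>\<phi>(s) - l\<^sup>d \<phi>(l\<^sup>2 s)\<close> with a fixed bump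
  \<open>\<phi> \<ge> 0\<close>. Near \<open>\<omega>\<close> the faces are cones with apex \<open>\<omega>\<close>, so both terms have the same integral over \<open>\<sigma>\<close>, and the
  second one concentrates at \<open>\<omega>\<close>, where \<open>g\<close> vanishes. Letting \<open>l\<close> tend to infinity, the inequality for
  weakly tropically psh functions says that a positive combination of the integrals \<open>\<integral>\<^sub>\<sigma> g \<phi> \<le> 0\<close> is
  nonnegative, hence \<open>g = 0\<close> wherever \<open>\<phi> > 0\<close>.\<close>

section \<open>Exterior algebra and minors\<close>

text \<open>A test form has to come from forms on open subsets of \<open>U\<close>, although the
  faces through the maximum have different directions. It is therefore built from the ambient
  Euclidean metric: on each face it restricts to a power of the induced metric form, and
  \<open>d'd''\<close> becomes the Laplacian of that metric. Passing to lattice coordinates costs a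
  factor depending on the face, the Gram determinant of a lattice basis; only its positivity
  matters. The Laplacian of a compactly supported radial function has integral 0 over a cone, so a
  negative part is unavoidable. It is pushed into the apex, where \<open>g\<close> is continuous
  with value 0. The factor \<open>h\<close> is in effect a Green function with pole at the apex,
  smoothed at scale \<open>1 / l\<close> and cut off by the bump; it decreases radially, and this is
  why it is nonnegative. The bump vanishes near 0, which hides the singular power of the radius at
  the apex. Each point \<open>x0\<close> near the maximum gets its own bump, positive at the squared
  distance of \<open>x0\<close>. As \<open>x0\<close> may lie on the relative boundary of a face,
  positivity of the integral comes from relative interior points close to \<open>x0\<close>.\<close>

abbreviation sg :: "'i::linorder \<Rightarrow> 'i set \<Rightarrow> real" where
  "sg i A \<equiv> shuffle_sign {i} A"

lemma sg_alt: "sg i A = (-1) ^ card {b \<in> A. b < i}"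
proof -
  have "{(a, b). a \<in> {i} \<and> b \<in> A \<and> b < a} = Pair i ` {b \<in> A. b < i}" by auto
  then show ?thesis unfolding shuffle_sign_def by (simp add: card_image inj_on_def)
qed

lemma sg_insert:
  assumes "finite A" "a \<notin> A"
  shows "sg i (insert a A) = (if a < i then - sg i A else sg i A)"
proof -
  have "{b \<in> insert a A. b < i} = (if a < i then insert a {b \<in> A. b < i} else {b \<in> A. b < i})"
    by auto
  then show ?thesis using assms by (simp add: sg_alt)
qed

lemma sg_square [simp]: "sg i A * sg i A = 1"
  by (simp add: sg_alt flip: power_add mult_2)

lemma sg_less: "(\<And>a. a \<in> A \<Longrightarrow> i < a) \<Longrightarrow> sg i A = 1"
proof -
  assume "\<And>a. a \<in> A \<Longrightarrow> i < a"
  then have "{b \<in> A. b < i} = {}" by (auto dest: order.asym)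
  then show ?thesis unfolding sg_alt by (simp only: card.empty power_0)
qed

text \<open>Exactly one of \<open>i < j\<close> and \<open>j < i\<close> holds, so exactly one of
  the two insertions flips its sign. This makes the mixed terms in \<open>minor_contraction\<close>
  cancel.\<close>

lemma sg_exchange:
  assumes "finite A" "i \<notin> A" "j \<notin> A" "i \<noteq> j"
  shows "sg i (insert j A) * sg j (insert i A) = - (sg i A * sg j A)"
  using assms by (auto simp: sg_insert)

lemma shuffle_sign_empty [simp]: "shuffle_sign A {} = 1" "shuffle_sign {} A = 1"
  by (simp_all add: shuffle_sign_def)

lemma wedge_infinite: "infinite I \<or> infinite J \<Longrightarrow> (a \<and>\<^sub>L b) I J = 0"
  by (auto simp: wedge_def)

lemma wedge_lin':
  assumes "finite S" "finite I" "finite J"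
  shows "(lin' S c \<and>\<^sub>L a) I J = (\<Sum>i\<in>S \<inter> I. sg i (I - {i}) * c i * a (I - {i}) J)"
proof -
  let ?g = "\<lambda>i A B. (-1) ^ (card B * card (I - A)) * shuffle_sign A (I - A) *
     shuffle_sign B (J - B) * c i * a (I - A) (J - B)"
  have "(lin' S c \<and>\<^sub>L a) I J =
     (\<Sum>A\<in>Pow I. \<Sum>B\<in>Pow J. \<Sum>i\<in>S. if A = {i} \<and> B = {} then ?g i A B else 0)"
    unfolding wedge_def lin'_def sum_distrib_left sum_distrib_right
    by (intro sum.cong refl) auto
  also have "\<dots> = (\<Sum>A\<in>Pow I. \<Sum>i\<in>S. \<Sum>B\<in>Pow J. if A = {i} \<and> B = {} then ?g i A B else 0)"
    by (intro sum.cong refl sum.swap)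
  also have "\<dots> = (\<Sum>A\<in>Pow I. \<Sum>i\<in>S. if A = {i} then ?g i A {} else 0)"
  proof (intro sum.cong refl)
    fix A i
    have "(\<Sum>B\<in>Pow J. if A = {i} \<and> B = {} then ?g i A B else 0) =
       (\<Sum>B\<in>Pow J. if B = {} then (if A = {i} then ?g i A {} else 0) else 0)"
      by (intro sum.cong) auto
    also have "\<dots> = (if A = {i} then ?g i A {} else 0)"
      using assms by (subst sum.delta) auto
    finally show "(\<Sum>B\<in>Pow J. if A = {i} \<and> B = {} then ?g i A B else 0) =
       (if A = {i} then ?g i A {} else 0)" .
  qed
  also have "\<dots> = (\<Sum>i\<in>S. \<Sum>A\<in>Pow I. if A = {i} then ?g i A {} else 0)"
    by (rule sum.swap)
  also have "\<dots> = (\<Sum>i\<in>S. if i \<in> I then ?g i {i} {} else 0)"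
    using assms by (intro sum.cong refl) (simp add: sum.delta)
  also have "\<dots> = (\<Sum>i\<in>S \<inter> I. sg i (I - {i}) * c i * a (I - {i}) J)"
    using assms by (auto simp: sum.inter_restrict intro!: sum.cong)
  finally show ?thesis .
qed

text \<open>Only \<open>A = {}\<close>, \<open>B = {i}\<close> contributes, and there the exponent
  \<open>card B * card (I - A)\<close> is \<open>card I\<close>: the cost of moving one
  d''-generator past all d'-generators of \<open>I\<close>.\<close>

lemma wedge_lin'':
  assumes "finite S" "finite I" "finite J"
  shows "(lin'' S c \<and>\<^sub>L a) I J =
    (-1) ^ card I * (\<Sum>i\<in>S \<inter> J. sg i (J - {i}) * c i * a I (J - {i}))"
proof -
  let ?g = "\<lambda>i A B. (-1) ^ (card B * card (I - A)) * shuffle_sign A (I - A) *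
     shuffle_sign B (J - B) * c i * a (I - A) (J - B)"
  have "(lin'' S c \<and>\<^sub>L a) I J =
     (\<Sum>A\<in>Pow I. \<Sum>B\<in>Pow J. \<Sum>i\<in>S. if A = {} \<and> B = {i} then ?g i A B else 0)"
    unfolding wedge_def lin''_def sum_distrib_left sum_distrib_right
    by (intro sum.cong refl) auto
  also have "\<dots> = (\<Sum>A\<in>Pow I. if A = {} then \<Sum>B\<in>Pow J. \<Sum>i\<in>S. if B = {i} then ?g i {} B else 0 else 0)"
    by (intro sum.cong refl) auto
  also have "\<dots> = (\<Sum>B\<in>Pow J. \<Sum>i\<in>S. if B = {i} then ?g i {} B else 0)"
    using assms by (subst sum.delta) auto
  also have "\<dots> = (\<Sum>i\<in>S. \<Sum>B\<in>Pow J. if B = {i} then ?g i {} B else 0)"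
    by (rule sum.swap)
  also have "\<dots> = (\<Sum>i\<in>S. if i \<in> J then ?g i {} {i} else 0)"
    using assms by (intro sum.cong refl) (simp add: sum.delta)
  also have "\<dots> = (\<Sum>i\<in>S \<inter> J. (-1) ^ card I * (sg i (J - {i}) * c i * a I (J - {i})))"
    using assms by (auto simp: sum.inter_restrict mult.assoc intro!: sum.cong)
  finally show ?thesis by (simp add: sum_distrib_left)
qed

lemma wedge_gen':
  assumes "finite I" "finite J"
  shows "(gen' i \<and>\<^sub>L a) I J = (if i \<in> I then sg i (I - {i}) * a (I - {i}) J else 0)"
  unfolding gen'_def using assms by (subst wedge_lin') auto

lemma wedge_gen'':
  assumes "finite I" "finite J"
  shows "(gen'' i \<and>\<^sub>L a) I J = (if i \<in> J then (-1) ^ card I * sg i (J - {i}) * a I (J - {i}) else 0)"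
  unfolding gen''_def using assms by (subst wedge_lin'') auto

text \<open>The determinant of the matrix with rows \<open>cs\<close> and columns indexed by \<open>I \<subseteq> S\<close>,
  expanded along its first row.\<close>
primrec ext_det :: "'i::linorder set \<Rightarrow> ('i \<Rightarrow> real) list \<Rightarrow> 'i set \<Rightarrow> real" where
  "ext_det S [] I = (if I = {} then 1 else 0)"
| "ext_det S (c # cs) I = (if finite I
     then \<Sum>i\<in>S \<inter> I. sg i (I - {i}) * c i * ext_det S cs (I - {i}) else 0)"

lemma ext_det_infinite: "infinite I \<Longrightarrow> ext_det S cs I = 0"
  by (cases cs) auto

lemma ext_det_card: "ext_det S cs I \<noteq> 0 \<Longrightarrow> card I = length cs"
proof (induction cs arbitrary: I)
  case Nil
  then show ?case by (auto split: if_splits)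
next
  case (Cons c cs)
  then have fin: "finite I" by (auto split: if_splits)
  have "\<exists>i\<in>S \<inter> I. sg i (I - {i}) * c i * ext_det S cs (I - {i}) \<noteq> 0"
    using Cons.prems fin by (auto elim!: sum.not_neutral_contains_not_neutral)
  then obtain i where i: "i \<in> I" "ext_det S cs (I - {i}) \<noteq> 0" by auto
  with Cons.IH have "card (I - {i}) = length cs" by blast
  with i fin show ?case by (metis card.remove length_Cons)
qed

lemma wedge_list_lin':
  assumes "finite S"
  shows "wedge_list (map (lin' S) cs) I J = (if J = {} then ext_det S cs I else 0)"
proof (induction cs arbitrary: I J)
  case Nil
  then show ?case by (simp add: wedge_list_def lext_one_def)
next
  case (Cons c cs)
  have "wedge_list (map (lin' S) (c # cs)) = lin' S c \<and>\<^sub>L wedge_list (map (lin' S) cs)"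
    by (simp add: wedge_list_def)
  then show ?case using assms Cons
    by (cases "finite I \<and> finite J") (auto simp: wedge_lin' wedge_infinite)
qed

lemma wedge_list_lin'':
  assumes "finite S"
  shows "wedge_list (map (lin'' S) cs) I J = (if I = {} then ext_det S cs J else 0)"
proof (induction cs arbitrary: I J)
  case Nil
  then show ?case by (simp add: wedge_list_def lext_one_def)
next
  case (Cons c cs)
  have "wedge_list (map (lin'' S) (c # cs)) = lin'' S c \<and>\<^sub>L wedge_list (map (lin'' S) cs)"
    by (simp add: wedge_list_def)
  then show ?case using assms Cons
    by (cases "finite I \<and> finite J") (auto simp: wedge_lin'' wedge_infinite)
qed

lemma wedge_pure:
  assumes "\<And>I J. J \<noteq> {} \<Longrightarrow> a I J = 0" "\<And>I J. I \<noteq> {} \<Longrightarrow> b I J = 0"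
    and "finite I" "finite J"
  shows "(a \<and>\<^sub>L b) I J = a I {} * b {} J"
proof -
  have "(a \<and>\<^sub>L b) I J = (\<Sum>A\<in>Pow I. \<Sum>B\<in>Pow J.
      if B = {} then (if A = I then a I {} * b {} J else 0) else 0)"
    unfolding wedge_def using assms by (intro sum.cong refl) auto
  also have "\<dots> = a I {} * b {} J"
    using assms by (simp add: sum.delta)
  finally show ?thesis .
qed

lemma wedge_wedge_list_lin:
  assumes "finite S"
  shows "(wedge_list (map (lin' S) cs) \<and>\<^sub>L wedge_list (map (lin'' S) cs')) I J =
    ext_det S cs I * ext_det S cs' J"
proof (cases "finite I \<and> finite J")
  case True
  then show ?thesis
    using wedge_pure[of "wedge_list (map (lin' S) cs)" "wedge_list (map (lin'' S) cs')"] assms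
    by (simp add: wedge_list_lin' wedge_list_lin'')
next
  case False
  then show ?thesis by (auto simp: wedge_infinite ext_det_infinite)
qed

text \<open>\<open>d'x\<^sub>1 \<and> d''x\<^sub>1 \<and> \<dots> \<and> d'x\<^sub>p \<and> d''x\<^sub>p = pairing_sign p \<cdot> d'x\<^sub>1 \<and> \<dots> \<and> d'x\<^sub>p \<and> d''x\<^sub>1 \<and> \<dots> \<and> d''x\<^sub>p\<close>\<close>
definition pairing_sign :: "nat \<Rightarrow> real" where
  "pairing_sign p = (\<Prod>q<p. (-1) ^ q)"

lemma pairing_sign_Suc: "pairing_sign (Suc p) = (-1) ^ p * pairing_sign p"
  by (simp add: pairing_sign_def)

lemma pairing_sign_square [simp]: "pairing_sign p * pairing_sign p = 1"
proof (induction p)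
  case (Suc p)
  have "pairing_sign (Suc p) * pairing_sign (Suc p) =
      ((-1) ^ p * (-1) ^ p) * (pairing_sign p * pairing_sign p)"
    by (simp add: pairing_sign_Suc mult_ac)
  then show ?case using Suc by (simp flip: power_add mult_2)
qed (simp add: pairing_sign_def)

text \<open>Sorting moves the d''-factor of each new pair past the \<open>length cs\<close>
  d'-factors behind it; these exchanges accumulate to \<open>pairing_sign\<close>.\<close>

lemma wedge_list_pairs:
  assumes "finite S"
  shows "wedge_list (concat (map (\<lambda>c. [lin' S c, lin'' S c]) cs)) I J =
    pairing_sign (length cs) * ext_det S cs I * ext_det S cs J"
proof (induction cs arbitrary: I J)
  case Nil
  then show ?case by (simp add: wedge_list_def lext_one_def pairing_sign_def)
next
  case (Cons c cs)
  let ?R = "wedge_list (concat (map (\<lambda>c. [lin' S c, lin'' S c]) cs))"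
  have eq: "wedge_list (concat (map (\<lambda>c. [lin' S c, lin'' S c]) (c # cs))) =
      lin' S c \<and>\<^sub>L (lin'' S c \<and>\<^sub>L ?R)"
    by (simp add: wedge_list_def)
  show ?case
  proof (cases "finite I \<and> finite J")
    case True
    have "(lin'' S c \<and>\<^sub>L ?R) A J = (-1) ^ length cs * pairing_sign (length cs) *
        ext_det S cs A * ext_det S (c # cs) J" if "finite A" for A
    proof -
      \<comment> \<open>The sign depends on \<open>card A\<close>, but \<open>ext_det S cs A\<close>
        vanishes unless \<open>card A = length cs\<close>, so the sign can be taken out of the
        sum.\<close>
      have "(-1) ^ card A * ext_det S cs A = (-1) ^ length cs * ext_det S cs A"
        using ext_det_card[of S cs A] by (cases "ext_det S cs A = 0") auto
      moreover have "(lin'' S c \<and>\<^sub>L ?R) A J =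
         ((-1) ^ card A * ext_det S cs A) * pairing_sign (length cs) * ext_det S (c # cs) J"
        using that True assms by (simp add: wedge_lin'' Cons sum_distrib_left mult_ac)
      ultimately show ?thesis by (metis (no_types, lifting) mult.commute mult.left_commute)
    qed
    then show ?thesis unfolding eq using True assms
      by (simp add: wedge_lin' pairing_sign_Suc sum_distrib_left sum_distrib_right mult_ac)
  next
    case False
    then show ?thesis unfolding eq by (auto simp: wedge_infinite)
  qed
qed

lemma ext_det_unit:
  assumes "finite S" "distinct xs" "set xs \<subseteq> S"
  shows "ext_det S (map (\<lambda>x i. if i = x then 1 else 0) xs) (set xs) \<noteq> 0"
  using assms(2,3)
proof (induction xs)
  case Nil
  then show ?case by simp
next
  case (Cons x xs)
  let ?u = "\<lambda>x i. if i = x then 1 else 0 :: real"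
  have "ext_det S (map ?u (x # xs)) (set (x # xs)) =
     (\<Sum>i\<in>S \<inter> set (x # xs). if i = x then sg x (set xs) * ext_det S (map ?u xs) (set xs) else 0)"
  proof -
    have "set (x # xs) - {x} = set xs" using Cons.prems by auto
    moreover have "sg i (X - {i}) * ?u x i * ext_det S cs (X - {i}) =
        (if i = x then sg x (X - {x}) * ext_det S cs (X - {x}) else 0)" for i X cs
      by simp
    ultimately show ?thesis
      unfolding list.map ext_det.simps by (simp only: finite_set if_True)
  qed
  also have "\<dots> = sg x (set xs) * ext_det S (map ?u xs) (set xs)"
    using assms Cons.prems by (subst sum.delta) auto
  finally show ?case using Cons by (auto simp: sg_alt)
qed

text \<open>The linear forms are the unit ones, so \<open>r\<close> is the square of a nonzero
  determinant. What matters is the sign: dividing by this coefficient in \<open>top_coeff\<close>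
  cancels the \<open>pairing_sign k\<close> produced by the test form.\<close>

lemma lext_volume_top:
  obtains r where "r > 0" "lext_volume k {..<k} {..<k} = pairing_sign k * r"
proof -
  let ?u = "\<lambda>x i. if i = x then 1 else 0 :: real"
  have "[gen' j, gen'' j] = [lin' {..<k} (?u j), lin'' {..<k} (?u j)]" if "j \<in> set [0..<k]" for j
  proof -
    have "(\<Sum>i<k. if I = {i} \<and> J = {} then ?u j i else 0) =
        (\<Sum>i<k. if i = j then (if I = {j} \<and> J = {} then 1 else 0) else 0)"
      "(\<Sum>i<k. if I = {} \<and> J = {i} then ?u j i else 0) =
        (\<Sum>i<k. if i = j then (if I = {} \<and> J = {j} then 1 else 0) else 0)" for I J
      by (intro sum.cong refl; simp)+
    then have "(\<Sum>i<k. if I = {i} \<and> J = {} then ?u j i else 0) = (if I = {j} \<and> J = {} then 1 else 0)"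
      "(\<Sum>i<k. if I = {} \<and> J = {i} then ?u j i else 0) = (if I = {} \<and> J = {j} then 1 else 0)" for I J
      using that by simp_all
    then show ?thesis by (simp add: gen'_def gen''_def lin'_def lin''_def fun_eq_iff)
  qed
  then have "lext_volume k = wedge_list (concat (map (\<lambda>c. [lin' {..<k} c, lin'' {..<k} c]) (map ?u [0..<k])))"
    unfolding lext_volume_def map_map comp_def by (metis (no_types, lifting) map_cong)
  then have "lext_volume k {..<k} {..<k} =
      pairing_sign k * (ext_det {..<k} (map ?u [0..<k]) {..<k})\<^sup>2"
    by (simp add: wedge_list_pairs power2_eq_square del: map_map)
  moreover have "ext_det {..<k} (map ?u [0..<k]) {..<k} \<noteq> 0"
    using ext_det_unit[of "{..<k}" "[0..<k]"] by (simp add: atLeast_upt)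
  ultimately show ?thesis using that by (metis zero_less_power2)
qed

section \<open>Minors of a system of vectors\<close>

definition minor :: "nat \<Rightarrow> (nat \<Rightarrow> 'n rvec) \<Rightarrow> 'n::{finite,linorder} set \<Rightarrow> nat set \<Rightarrow> real" where
  "minor k v I K = ext_det {..<k} (map (\<lambda>i j. v j $ i) (sorted_list_of_set I)) K"

lemma minor_card: "minor k v I K \<noteq> 0 \<Longrightarrow> card I = card K"
  unfolding minor_def using ext_det_card by fastforce

text \<open>The d'-part and the d''-part pull back separately, and \<open>minor k v I K\<close> is
  the coefficient at \<open>K\<close> of the pullback of the generator product over
  \<open>I\<close>.\<close>

lemma lext_pullback_eq:
  "lext_pullback k v a K L = (\<Sum>I\<in>UNIV. \<Sum>J\<in>UNIV. a I J * (minor k v I K * minor k v J L))"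
proof -
  have "(wedge_list (map (\<lambda>i. lin' {..<k} (\<lambda>j. v j $ i)) (sorted_list_of_set I)) \<and>\<^sub>L
      wedge_list (map (\<lambda>i. lin'' {..<k} (\<lambda>j. v j $ i)) (sorted_list_of_set J))) K L =
      minor k v I K * minor k v J L" for I J
    using wedge_wedge_list_lin[of "{..<k}" "map (\<lambda>i j. v j $ i) (sorted_list_of_set I)"
        "map (\<lambda>i j. v j $ i) (sorted_list_of_set J)" K L]
    by (simp add: minor_def comp_def)
  then show ?thesis by (simp add: lext_pullback_def)
qed

lemma minor_empty: "minor k v {} K = (if K = {} then 1 else 0)"
  by (simp add: minor_def)

text \<open>\<open>ext_det\<close> expands along the first row of an increasing list, so the new row
  index \<open>t\<close> has to be the smallest one.\<close>

lemma minor_insert_min: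
  assumes "\<And>a. a \<in> T \<Longrightarrow> t < a" "finite K" "K \<subseteq> {..<k}"
  shows "minor k v (insert t T) K = (\<Sum>j\<in>K. sg j (K - {j}) * v j $ t * minor k v T (K - {j}))"
proof -
  have "Min (insert t T) = t"
    using assms by (intro Min_eqI) (auto intro: less_imp_le)
  moreover have "insert t T - {t} = T" using assms by auto
  ultimately have "sorted_list_of_set (insert t T) = t # sorted_list_of_set T"
    using sorted_list_of_set_nonempty[of "insert t T"] by simp
  moreover have "{..<k} \<inter> K = K" using assms by auto
  ultimately show ?thesis using assms by (simp add: minor_def)
qed

text \<open>Laplace expansion along an additional column \<open>l\<close> put in front of
  \<open>K\<close>: a repeated column gives 0, otherwise \<open>sg l K\<close> sorts the new column
  into place. Since \<open>ext_det\<close> recurses on rows, the column version needs its own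
  induction, which adds ever smaller rows. For \<open>K = {..<k}\<close> it says that
  \<open>v l\<close> wedged with \<open>v 0\<close>, ..., \<open>v (k - 1)\<close> vanishes.\<close>

lemma minor_column_expansion:
  fixes T :: "'n::{finite,linorder} set"
  assumes "K \<subseteq> {..<k}" "l < k"
  shows "(\<Sum>i\<in>T. sg i (T - {i}) * v l $ i * minor k v (T - {i}) K) =
    (if l \<in> K then 0 else sg l K * minor k v T (insert l K))"
  using finite[of T] assms(1)
proof (induction T arbitrary: K rule: finite_linorder_min_induct)
  case empty
  then show ?case by (simp add: minor_empty)
next
  case (insert t T)
  have finK: "finite K" using insert.prems finite_subset by blast
  have tT: "t \<notin> T" using insert.hyps by auto
  have T1: "insert t T - {t} = T" using tT by auto
  have Ti: "insert t T - {i} = insert t (T - {i})" if "i \<in> T" for i using that tT by auto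
  have "(\<Sum>i\<in>T. sg i (insert t T - {i}) * v l $ i * minor k v (insert t T - {i}) K) =
     (\<Sum>i\<in>T. - (sg i (T - {i}) * v l $ i *
        (\<Sum>j\<in>K. sg j (K - {j}) * v j $ t * minor k v (T - {i}) (K - {j}))))"
  proof (rule sum.cong[OF refl])
    fix i assume i: "i \<in> T"
    have "minor k v (insert t (T - {i})) K =
        (\<Sum>j\<in>K. sg j (K - {j}) * v j $ t * minor k v (T - {i}) (K - {j}))"
      using insert.hyps insert.prems finK by (intro minor_insert_min) auto
    moreover have "sg i (insert t (T - {i})) = - sg i (T - {i})"
      using insert.hyps i tT by (subst sg_insert) auto
    ultimately show "sg i (insert t T - {i}) * v l $ i * minor k v (insert t T - {i}) K =
       - (sg i (T - {i}) * v l $ i *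
        (\<Sum>j\<in>K. sg j (K - {j}) * v j $ t * minor k v (T - {i}) (K - {j})))"
      by (simp add: Ti[OF i])
  qed
  \<comment> \<open>Interchanging the expansion along row \<open>t\<close> with the one along column
    \<open>l\<close> makes the induction hypothesis applicable to \<open>K - {j}\<close>.\<close>
  also have "\<dots> = - (\<Sum>j\<in>K. sg j (K - {j}) * v j $ t *
       (\<Sum>i\<in>T. sg i (T - {i}) * v l $ i * minor k v (T - {i}) (K - {j})))"
    unfolding sum_negf sum_distrib_left by (subst sum.swap) (simp add: mult_ac)
  also have "\<dots> = - (\<Sum>j\<in>K. sg j (K - {j}) * v j $ t *
       (if l \<in> K - {j} then 0 else sg l (K - {j}) * minor k v T (insert l (K - {j}))))"
    using insert.prems by (subst insert.IH) auto
  finally have *: "(\<Sum>i\<in>insert t T. sg i (insert t T - {i}) * v l $ i * minor k v (insert t T - {i}) K) =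
     v l $ t * minor k v T K - (\<Sum>j\<in>K. sg j (K - {j}) * v j $ t *
       (if l \<in> K - {j} then 0 else sg l (K - {j}) * minor k v T (insert l (K - {j}))))"
    using tT insert.hyps by (simp add: T1 sg_less)
  show ?case
  proof (cases "l \<in> K")
    case True
    \<comment> \<open>For \<open>j \<noteq> l\<close> the column \<open>l\<close> is still repeated;
      the remaining term \<open>j = l\<close> cancels the contribution of row
      \<open>t\<close>.\<close>
    have "(\<Sum>j\<in>K. sg j (K - {j}) * v j $ t *
       (if l \<in> K - {j} then 0 else sg l (K - {j}) * minor k v T (insert l (K - {j})))) =
       (\<Sum>j\<in>K. if j = l then sg l (K - {l}) * sg l (K - {l}) * v l $ t * minor k v T K else 0)"
      using True by (intro sum.cong refl) (auto simp: insert_absorb)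
    also have "\<dots> = v l $ t * minor k v T K"
      using True finK by simp
    finally show ?thesis unfolding * using True by simp
  next
    case False
    have "minor k v (insert t T) (insert l K) =
       (\<Sum>j\<in>insert l K. sg j (insert l K - {j}) * v j $ t * minor k v T (insert l K - {j}))"
      using insert.hyps insert.prems finK assms by (intro minor_insert_min) auto
    also have "\<dots> = sg l K * v l $ t * minor k v T K +
       (\<Sum>j\<in>K. sg j (insert l K - {j}) * v j $ t * minor k v T (insert l K - {j}))"
      using False finK by simp
    finally have "sg l K * minor k v (insert t T) (insert l K) = v l $ t * minor k v T K +
       (\<Sum>j\<in>K. sg l K * (sg j (insert l K - {j}) * v j $ t * minor k v T (insert l K - {j})))"
      by (simp add: distrib_left sum_distrib_left flip: mult.assoc)
    moreover have "sg l K * (sg j (insert l K - {j}) * v j $ t * minor k v T (insert l K - {j})) =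
      - (sg j (K - {j}) * v j $ t * (sg l (K - {j}) * minor k v T (insert l (K - {j}))))"
      if j: "j \<in> K" for j
    proof -
      have e: "insert l K - {j} = insert l (K - {j})" using j False by auto
      have "sg l (insert j (K - {j})) * sg j (insert l (K - {j})) = - (sg l (K - {j}) * sg j (K - {j}))"
        using j False finK by (intro sg_exchange) auto
      then have "sg l K * sg j (insert l K - {j}) = - (sg l (K - {j}) * sg j (K - {j}))"
        using j by (simp add: e insert_absorb)
      then have "(sg l K * sg j (insert l K - {j})) * (v j $ t * minor k v T (insert l (K - {j}))) =
        - (sg l (K - {j}) * sg j (K - {j})) * (v j $ t * minor k v T (insert l (K - {j})))" by simp
      then show ?thesis by (simp add: e mult_ac)
    qed
    ultimately show ?thesis unfolding * using False by (simp add: sum_negf)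
  qed
qed

text \<open>Cramer's rule: if the columns \<open>K\<close> have a nonzero minor on the rows
  \<open>S\<close> but all minors of \<open>insert l K\<close> vanish, then every coordinate outside
  \<open>S\<close> of these columns is a fixed combination of the coordinates in \<open>S\<close>.
  So \<open>card K + 1\<close> independent vectors would lie in the span of
  \<open>card S = card K\<close> vectors.\<close>

lemma minor_nonzero:
  fixes v :: "nat \<Rightarrow> 'n::{finite,linorder} rvec"
  assumes "finite K" "K \<subseteq> {..<k}" "inj_on v K" "independent (v ` K)"
  shows "\<exists>I. minor k v I K \<noteq> 0"
  using assms
proof (induction K rule: finite_induct)
  case empty
  then show ?case by (intro exI[of _ "{}"]) (simp add: minor_empty)
next
  case (insert l K)
  then have "\<exists>I. minor k v I K \<noteq> 0"
    by (intro insert.IH) (auto dest: independent_mono[OF _ subset_insertI])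
  then obtain S where S: "minor k v S K \<noteq> 0" by blast
  show ?case
  proof (rule ccontr)
    assume "\<not> ?thesis"
    then have Z: "minor k v I (insert l K) = 0" for I by blast
    \<comment> \<open>For \<open>j\<close> in \<open>K\<close> a column is repeated; for
      \<open>j = l\<close> the enlarged minor is 0 by assumption.\<close>
    have rel: "(\<Sum>i\<in>T. sg i (T - {i}) * v j $ i * minor k v (T - {i}) K) = 0"
      if "j \<in> insert l K" for j T
      using minor_column_expansion[of K k j T v] that insert.prems Z by auto
    \<comment> \<open>The relation for the rows \<open>insert t S\<close>, solved for
      \<open>v j $ t\<close>; the coefficients do not depend on \<open>j\<close>.\<close>
    define c where "c i t = - sg t S * sg i (insert t S - {i}) * minor k v (insert t S - {i}) K / minor k v S K"
      for i t
    have vt: "v j $ t = (\<Sum>i\<in>S. v j $ i * c i t)" if "j \<in> insert l K" "t \<notin> S" for j t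
    proof -
      have S': "insert t S - {t} = S" using that by auto
      define Q where "Q = (\<Sum>i\<in>S. sg i (insert t S - {i}) * v j $ i * minor k v (insert t S - {i}) K)"
      have "sg t S * v j $ t * minor k v S K + Q = 0"
        using rel[OF that(1), of "insert t S"] that(2) S' by (simp add: Q_def)
      then have "sg t S * v j $ t * minor k v S K = - Q" by simp
      then have "sg t S * (sg t S * v j $ t * minor k v S K) = sg t S * - Q" by simp
      then have "(sg t S * sg t S) * (v j $ t * minor k v S K) = - sg t S * Q"
        by (simp only: mult.assoc mult_minus_left mult_minus_right)
      then have "v j $ t = - sg t S * Q / minor k v S K"
        using S by (subst eq_divide_eq) simp
      also have "\<dots> = (\<Sum>i\<in>S. v j $ i * c i t)"
        unfolding Q_def c_def sum_distrib_left sum_divide_distrib by (simp add: mult_ac)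
      finally show ?thesis .
    qed
    define e :: "'n \<Rightarrow> 'n rvec" where "e i = (\<chi> t. if t \<in> S then (if t = i then 1 else 0) else c i t)" for i
    have "v j \<in> span (e ` S)" if j: "j \<in> insert l K" for j
    proof -
      have "v j = (\<Sum>i\<in>S. v j $ i *\<^sub>R e i)"
      proof (rule vec_eq_iff[THEN iffD2], rule allI)
        fix t
        show "v j $ t = (\<Sum>i\<in>S. v j $ i *\<^sub>R e i) $ t"
        proof (cases "t \<in> S")
          case True
          then have "(\<Sum>i\<in>S. v j $ i * e i $ t) = (\<Sum>i\<in>S. if t = i then v j $ i else 0)"
            by (intro sum.cong) (auto simp: e_def)
          then show ?thesis using True by simp
        next
          case False
          then show ?thesis using vt[OF j] by (simp add: e_def)
        qed
      qed
      also have "\<dots> \<in> span (e ` S)"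
        by (intro span_sum span_scale span_base) auto
      finally show ?thesis .
    qed
    then have "card (v ` insert l K) \<le> card (e ` S)"
      using independent_span_bound[of "e ` S" "v ` insert l K"] insert.prems by auto
    also have "card (v ` insert l K) = Suc (card K)"
      using insert by (simp add: card_image)
    also have "card (e ` S) \<le> card S" by (simp add: card_image_le)
    finally show False using minor_card[OF S] by simp
  qed
qed

lemma sum_remove_reindex:
  fixes Q :: "'n::finite \<Rightarrow> 'n set \<Rightarrow> 'n set \<Rightarrow> 'b::comm_monoid_add"
  shows "(\<Sum>I\<in>UNIV. \<Sum>j\<in>I. Q j (I - {j}) I) = (\<Sum>S\<in>UNIV. \<Sum>j\<in>-S. Q j S (insert j S))"
  unfolding sum.Sigma[OF finite ballI[OF finite]]
  by (rule sum.reindex_bij_witness[where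
        i = "\<lambda>(S, j). (insert j S, j)" and j = "\<lambda>(I, j). (I - {j}, j)"])
     (auto simp: insert_absorb)

text \<open>Both sides are expanded using \<open>x \<and> v\<^sub>0 \<and> \<dots> \<and> v\<^sub>k\<^sub>-\<^sub>1 = 0\<close>; the mixed terms cancel.\<close>
lemma minor_contraction:
  fixes v :: "nat \<Rightarrow> 'n::{finite,linorder} rvec"
  assumes "x \<in> span (v ` {..<k})"
  defines "D \<equiv> \<lambda>I. minor k v I {..<k}"
  shows "(\<Sum>S\<in>UNIV. (\<Sum>i\<in>-S. x $ i * sg i S * D (insert i S))\<^sup>2) = (norm x)\<^sup>2 * (\<Sum>I\<in>UNIV. (D I)\<^sup>2)"
proof -
  have rel: "(\<Sum>i\<in>T. sg i (T - {i}) * x $ i * D (T - {i})) = 0" for T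
  proof -
    have "subspace {x. (\<Sum>i\<in>T. sg i (T - {i}) * x $ i * D (T - {i})) = 0}"
    proof (rule subspaceI; clarsimp)
      fix y z :: "'n rvec" and c :: real
      assume y: "(\<Sum>i\<in>T. sg i (T - {i}) * y $ i * D (T - {i})) = 0"
      have "(\<Sum>i\<in>T. sg i (T - {i}) * (c * y $ i) * D (T - {i})) =
        c * (\<Sum>i\<in>T. sg i (T - {i}) * y $ i * D (T - {i}))"
        by (simp add: sum_distrib_left mult_ac)
      then show "(\<Sum>i\<in>T. sg i (T - {i}) * (c * y $ i) * D (T - {i})) = 0"
        using y by simp
      assume z: "(\<Sum>i\<in>T. sg i (T - {i}) * z $ i * D (T - {i})) = 0"
      show "(\<Sum>i\<in>T. sg i (T - {i}) * (y $ i + z $ i) * D (T - {i})) = 0"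
        using y z by (simp add: distrib_left distrib_right sum.distrib)
    qed
    moreover have "v ` {..<k} \<subseteq> {x. (\<Sum>i\<in>T. sg i (T - {i}) * x $ i * D (T - {i})) = 0}"
      using minor_column_expansion[of "{..<k}" k _ T v] by (auto simp: D_def)
    ultimately show ?thesis
      using assms(1) span_minimal by blast
  qed
  let ?m = "\<lambda>I i j. x $ i * x $ j * sg i I * sg j (insert i I - {j}) * D I * D (insert i I - {j})"
  have r1: "(x $ i)\<^sup>2 * (D I)\<^sup>2 + (\<Sum>j\<in>I. ?m I i j) = 0" if "i \<notin> I" for I i
  proof -
    have "sg i I * x $ i * D I + (\<Sum>j\<in>I. sg j (insert i I - {j}) * x $ j * D (insert i I - {j})) = 0"
      using rel[of "insert i I"] that by simp
    \<comment> \<open>The relation for \<open>insert i I\<close> is multiplied by its own term of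
      index \<open>i\<close>, which becomes a square.\<close>
    then have "(x $ i * sg i I * D I) * (sg i I * x $ i * D I + (\<Sum>j\<in>I. sg j (insert i I - {j}) * x $ j * D (insert i I - {j}))) = 0"
      by simp
    then have "(x $ i)\<^sup>2 * (D I)\<^sup>2 * (sg i I * sg i I) + (\<Sum>j\<in>I. ?m I i j) = 0"
      by (simp add: distrib_left sum_distrib_left mult_ac power2_eq_square)
    then show ?thesis by simp
  qed
  have "(\<Sum>I\<in>UNIV. \<Sum>i\<in>-I. (x $ i)\<^sup>2 * (D I)\<^sup>2 + (\<Sum>j\<in>I. ?m I i j)) = 0"
    by (intro sum.neutral ballI) (simp add: r1)
  then have A: "(\<Sum>I\<in>UNIV. \<Sum>i\<in>-I. \<Sum>j\<in>I. ?m I i j) = - (\<Sum>I\<in>UNIV. \<Sum>i\<in>-I. (x $ i)\<^sup>2 * (D I)\<^sup>2)"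
    by (simp add: sum.distrib)
  \<comment> \<open>The left-hand side is the squared norm of the contraction of the wedge product
    of the \<open>v j\<close> with \<open>x\<close>. Its diagonal products are squares; the mixed
    ones are the negatives of \<open>?m\<close> for \<open>I = insert j S\<close>.\<close>
  let ?n = "\<lambda>S i j. (x $ i * sg i S * D (insert i S)) * (x $ j * sg j S * D (insert j S))"
  have "(\<Sum>S\<in>UNIV. (\<Sum>i\<in>-S. x $ i * sg i S * D (insert i S))\<^sup>2) = (\<Sum>S\<in>UNIV. \<Sum>j\<in>-S. \<Sum>i\<in>-S. ?n S i j)"
    unfolding power2_eq_square sum_product by (subst sum.swap) simp
  also have "\<dots> = (\<Sum>S\<in>UNIV. \<Sum>j\<in>-S. (x $ j)\<^sup>2 * (D (insert j S))\<^sup>2 + (\<Sum>i\<in>-insert j S. ?n S i j))"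
  proof (intro sum.cong refl)
    fix S :: "'n set" and j assume j: "j \<in> - S"
    then have "- S = insert j (- insert j S)" by auto
    then have "(\<Sum>i\<in>-S. ?n S i j) = ?n S j j + (\<Sum>i\<in>-insert j S. ?n S i j)"
      by (metis (no_types, lifting) ComplD finite insertI1 sum.insert)
    also have "?n S j j = (x $ j)\<^sup>2 * (D (insert j S))\<^sup>2 * (sg j S * sg j S)"
      by (simp add: power2_eq_square mult_ac)
    finally show "(\<Sum>i\<in>-S. ?n S i j) = (x $ j)\<^sup>2 * (D (insert j S))\<^sup>2 + (\<Sum>i\<in>-insert j S. ?n S i j)"
      by simp
  qed
  also have "\<dots> = (\<Sum>I\<in>UNIV. \<Sum>j\<in>I. (x $ j)\<^sup>2 * (D I)\<^sup>2 + (\<Sum>i\<in>-I. ?n (I - {j}) i j))"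
    using sum_remove_reindex[of "\<lambda>j S I. (x $ j)\<^sup>2 * (D I)\<^sup>2 + (\<Sum>i\<in>-I. ?n S i j)"] by simp
  also have "\<dots> = (\<Sum>I\<in>UNIV. \<Sum>j\<in>I. (x $ j)\<^sup>2 * (D I)\<^sup>2) + (\<Sum>I\<in>UNIV. \<Sum>j\<in>I. \<Sum>i\<in>-I. ?n (I - {j}) i j)"
    by (simp add: sum.distrib)
  also have "(\<Sum>I\<in>UNIV. \<Sum>j\<in>I. \<Sum>i\<in>-I. ?n (I - {j}) i j) = (\<Sum>I\<in>UNIV. \<Sum>i\<in>-I. \<Sum>j\<in>I. ?n (I - {j}) i j)"
    by (intro sum.cong refl sum.swap)
  also have "\<dots> = (\<Sum>I\<in>UNIV. \<Sum>i\<in>-I. \<Sum>j\<in>I. - ?m I i j)"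
  proof (intro sum.cong refl)
    fix I :: "'n set" and i j assume ij: "i \<in> - I" "j \<in> I"
    define S where "S = I - {j}"
    have S: "I = insert j S" "insert i I - {j} = insert i S" "i \<notin> S" "j \<notin> S" "i \<noteq> j"
      using ij by (auto simp: S_def)
    have "sg i (insert j S) * sg j (insert i S) = - (sg i S * sg j S)"
      using S by (intro sg_exchange) auto
    then have "(sg i I * sg j (insert i I - {j})) * (x $ i * x $ j * D I * D (insert i S)) =
       - (sg i S * sg j S) * (x $ i * x $ j * D I * D (insert i S))"
      using S by simp
    then show "?n (I - {j}) i j = - ?m I i j"
      using S by (simp add: mult_ac)
  qed
  also have "\<dots> = (\<Sum>I\<in>UNIV. \<Sum>i\<in>-I. (x $ i)\<^sup>2 * (D I)\<^sup>2)"
    by (simp only: sum_negf A minus_minus)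
  also have "(\<Sum>I\<in>UNIV. \<Sum>j\<in>I. (x $ j)\<^sup>2 * (D I)\<^sup>2) + (\<Sum>I\<in>UNIV. \<Sum>i\<in>-I. (x $ i)\<^sup>2 * (D I)\<^sup>2) =
     (\<Sum>I\<in>UNIV. (\<Sum>i\<in>UNIV. (x $ i)\<^sup>2) * (D I)\<^sup>2)"
  proof -
    have "(\<Sum>i\<in>I. (x $ i)\<^sup>2 * (D I)\<^sup>2) + (\<Sum>i\<in>-I. (x $ i)\<^sup>2 * (D I)\<^sup>2) = (\<Sum>i\<in>UNIV. (x $ i)\<^sup>2) * (D I)\<^sup>2" for I
      using sum.union_disjoint[of I "-I" "\<lambda>i. (x $ i)\<^sup>2 * (D I)\<^sup>2"] by (simp add: sum_distrib_right)
    then show ?thesis by (simp flip: sum.distrib)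
  qed
  also have "(\<Sum>i\<in>UNIV. (x $ i)\<^sup>2) = (norm x)\<^sup>2"
    by (simp add: norm_vec_def L2_set_def sum_nonneg)
  finally show ?thesis by (simp add: sum_distrib_left)
qed

section \<open>The radial test form\<close>

text \<open>This is \<open>1 / p!\<close> times the \<open>p\<close>-th power of the sum of all
  \<open>d'x_i \<and> d''x_i\<close>; the sign comes from sorting the factors.\<close>

definition base_form :: "nat \<Rightarrow> 'i lext" where
  "base_form p = (\<lambda>I J. if I = J \<and> card I = p then pairing_sign p else 0)"

lemma positive_lext_sum:
  assumes "finite X" "\<And>x. x \<in> X \<Longrightarrow> 0 \<le> t x" "\<And>x. x \<in> X \<Longrightarrow> b x \<in> positive_generators k p"
  shows "positive_lext k p (\<lambda>K L. \<Sum>x\<in>X. t x * b x K L)"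
proof -
  obtain e where e: "bij_betw e {0..<card X} X"
    using ex_bij_betw_nat_finite[OF assms(1)] by blast
  have "(\<lambda>K L. \<Sum>x\<in>X. t x * b x K L) = (\<lambda>K L. \<Sum>i<card X. t (e i) * b (e i) K L)"
    using sum.reindex_bij_betw[OF e, of "\<lambda>x. t x * b x _ _"] by (simp add: atLeast0LessThan)
  moreover have "e i \<in> X" if "i < card X" for i
    using e that by (auto simp: bij_betw_def)
  ultimately show ?thesis unfolding positive_lext_def
    using assms(2,3) by (intro exI[of _ "card X"] exI[of _ "t \<circ> e"] exI[of _ "b \<circ> e"]) auto
qed

lemma lext_pullback_base_form:
  fixes v :: "nat \<Rightarrow> 'n::{finite,linorder} rvec"
  shows "lext_pullback k v (\<lambda>I J. c * base_form p I J) K L =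
    (\<Sum>I | card I = p. c * (pairing_sign p * minor k v I K * minor k v I L))"
proof -
  have "(\<Sum>J\<in>UNIV. c * base_form p I J * (minor k v I K * minor k v J L)) =
    (if card I = p then c * (pairing_sign p * minor k v I K * minor k v I L) else 0)" for I :: "'n set"
  proof -
    have "(\<Sum>J\<in>UNIV. c * base_form p I J * (minor k v I K * minor k v J L)) =
      (\<Sum>J\<in>UNIV. if I = J then (if card I = p then c * (pairing_sign p * minor k v I K * minor k v I L) else 0) else 0)"
      by (intro sum.cong) (auto simp: base_form_def)
    then show ?thesis by simp
  qed
  then show ?thesis by (simp add: lext_pullback_eq sum.If_cases)
qed

text \<open>Each index set \<open>I\<close> of size \<open>p\<close> contributes the generator whose
  linear forms are the pullbacks of the coordinate forms with index in \<open>I\<close>.\<close>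

lemma positive_base_form:
  fixes v :: "nat \<Rightarrow> 'n::{finite,linorder} rvec"
  assumes "0 \<le> c"
  shows "positive_lext k p (lext_pullback k v (\<lambda>I J. c * base_form p I J))"
proof -
  have "(\<lambda>K L. pairing_sign p * minor k v I K * minor k v I L) \<in> positive_generators k p"
    if "card I = p" for I
    unfolding positive_generators_def
    using that by (auto intro!: exI[of _ "map (\<lambda>i j. v j $ i) (sorted_list_of_set I)"]
        simp: fun_eq_iff wedge_list_pairs minor_def simp del: map_map)
  then have "positive_lext k p (\<lambda>K L. \<Sum>I | card I = p. c * (pairing_sign p * minor k v I K * minor k v I L))"
    using assms by (intro positive_lext_sum) auto
  then show ?thesis unfolding lext_pullback_base_form[symmetric] .
qed

lemma partial_derivI:
  assumes "(f has_derivative D) (at x)"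
  shows "partial_deriv i f x = D (axis i 1)"
  unfolding partial_deriv_def using frechet_derivative_at[OF assms] by simp

lemma has_derivative_frechet:
  "f differentiable (at x) \<Longrightarrow> (f has_derivative frechet_derivative f (at x)) (at x)"
  by (simp add: frechet_derivative_works)

lemma partial_deriv_sum_cmult:
  assumes "finite S" "\<And>i. i \<in> S \<Longrightarrow> f i differentiable (at x)"
  shows "partial_deriv j (\<lambda>z. \<Sum>i\<in>S. c i * f i z) x = (\<Sum>i\<in>S. c i * partial_deriv j (f i) x)"
proof -
  have "((\<lambda>z. \<Sum>i\<in>S. c i * f i z) has_derivative
      (\<lambda>y. \<Sum>i\<in>S. c i * frechet_derivative (f i) (at x) y)) (at x)"
    using assms by (intro has_derivative_sum has_derivative_mult_right has_derivative_frechet)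
  from partial_derivI[OF this] show ?thesis by (simp add: partial_deriv_def)
qed

lemma ddc_base_form:
  fixes h :: "'n::{finite,linorder} rvec \<Rightarrow> real"
  assumes h: "\<And>x. h differentiable (at x)"
    and h': "\<And>i x. partial_deriv i h differentiable (at x)"
  shows "diff' (diff'' (\<lambda>z I J. h z * base_form p I J)) x I J =
    (\<Sum>j\<in>I. \<Sum>i\<in>J. sg j (I - {j}) * sg i (J - {i}) * (-1) ^ card (I - {j}) *
       base_form p (I - {j}) (J - {i}) * partial_deriv j (partial_deriv i h) x)"
proof -
  have pd: "partial_deriv i (\<lambda>z. h z * c) x = partial_deriv i h x * c" for i c x
    using partial_deriv_sum_cmult[of "{()}" "\<lambda>_. h" x i "\<lambda>_. c"] h by (simp add: mult.commute[of c])
  have 1: "diff'' (\<lambda>z I J. h z * base_form p I J) z A B =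
     (\<Sum>i\<in>B. (-1) ^ card A * sg i (B - {i}) * base_form p A (B - {i}) * partial_deriv i h z)" for z A B
    unfolding diff''_def wedge_gen''[OF finite finite] pd by (simp add: sum.If_cases mult_ac)
  show ?thesis
    unfolding diff'_def 1 wedge_gen'[OF finite finite] partial_deriv_sum_cmult[OF finite h']
    by (simp add: sum.If_cases sum_distrib_left mult_ac)
qed

text \<open>By Cauchy-Binet the sum is the Gram determinant of \<open>v 0\<close>, ...,
  \<open>v (k - 1)\<close>. The other factors turn it into a coefficient relative to the volume form
  in these coordinates and remove the sign.\<close>

definition face_density :: "nat \<Rightarrow> (nat \<Rightarrow> 'n::{finite,linorder} rvec) \<Rightarrow> real" where
  "face_density k v = (\<Sum>I\<in>UNIV. (minor k v I {..<k})\<^sup>2) * pairing_sign k / lext_volume k {..<k} {..<k}"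

lemma face_density_pos:
  assumes "inj_on v {..<k}" "independent (v ` {..<k})"
  shows "0 < face_density k v"
proof -
  obtain r where r: "r > 0" "lext_volume k {..<k} {..<k} = pairing_sign k * r"
    by (rule lext_volume_top)
  obtain I where "minor k v I {..<k} \<noteq> 0"
    using minor_nonzero[of "{..<k}" k v] assms by auto
  then have "0 < (\<Sum>I\<in>UNIV. (minor k v I {..<k})\<^sup>2)"
    by (intro sum_pos2[of _ I]) auto
  moreover have "pairing_sign k \<noteq> 0"
    using pairing_sign_square[of k] by (metis mult_zero_left zero_neq_one)
  ultimately show ?thesis using r by (simp add: face_density_def)
qed

text \<open>The bracket is the trace of the Hessian over the span of the \<open>v j\<close>, that
  is, the Laplacian of the restriction of \<open>h\<close>. The scalar part counts every index set
  once per element; the rank-one part is evaluated by \<open>minor_contraction\<close>, which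
  requires \<open>y\<close> to lie in the span.\<close>

lemma top_coeff_ddc_base_form:
  fixes h :: "'n::{finite,linorder} rvec \<Rightarrow> real" and v :: "nat \<Rightarrow> 'n rvec"
  assumes h: "\<And>x. h differentiable (at x)"
    and h': "\<And>i x. partial_deriv i h differentiable (at x)"
    and hess: "\<And>i j. partial_deriv j (partial_deriv i h) x =
      a * (if i = j then 1 else 0) + b * (y $ i * y $ j)"
    and y: "y \<in> span (v ` {..<Suc p})"
  shows "top_coeff (Suc p) (lext_pullback (Suc p) v (diff' (diff'' (\<lambda>z I J. h z * base_form p I J)) x)) =
    face_density (Suc p) v * (real (Suc p) * a + b * (norm y)\<^sup>2)"
proof -
  let ?k = "Suc p"
  define D where "D I = minor ?k v I {..<?k}" for I
  have Dc: "card I = Suc p" if "D I \<noteq> 0" for I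
    using minor_card[of ?k v I "{..<?k}"] that by (simp add: D_def)
  define hh where "hh j i = partial_deriv j (partial_deriv i h) x" for i j
  define G where "G = (\<Sum>I\<in>UNIV. (D I)\<^sup>2)"
  let ?s = "pairing_sign (Suc p)"
  let ?t = "\<lambda>j i S S'. sg j S * sg i S' * (-1) ^ card S * base_form p S S' * hh j i"
  have "lext_pullback ?k v (diff' (diff'' (\<lambda>z I J. h z * base_form p I J)) x) {..<?k} {..<?k} =
    (\<Sum>I\<in>UNIV. \<Sum>J\<in>UNIV. (\<Sum>j\<in>I. \<Sum>i\<in>J. ?t j i (I - {j}) (J - {i})) * (D I * D J))"
    by (simp add: lext_pullback_eq ddc_base_form[OF h h'] D_def hh_def)
  also have "\<dots> = (\<Sum>I\<in>UNIV. \<Sum>J\<in>UNIV. \<Sum>j\<in>I. \<Sum>i\<in>J. ?t j i (I - {j}) (J - {i}) * (D I * D J))"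
    by (simp add: sum_distrib_right)
  also have "\<dots> = (\<Sum>I\<in>UNIV. \<Sum>j\<in>I. \<Sum>J\<in>UNIV. \<Sum>i\<in>J. ?t j i (I - {j}) (J - {i}) * (D I * D J))"
    by (intro sum.cong refl sum.swap)
  \<comment> \<open>The sums are regrouped by the remaining sets \<open>S\<close> and
    \<open>S'\<close>, because \<open>base_form\<close> is diagonal in these.\<close>
  also have "\<dots> = (\<Sum>S\<in>UNIV. \<Sum>j\<in>-S. \<Sum>S'\<in>UNIV. \<Sum>i\<in>-S'. ?t j i S S' * (D (insert j S) * D (insert i S')))"
    by (subst sum_remove_reindex[of "\<lambda>j S I. \<Sum>J\<in>UNIV. \<Sum>i\<in>J. ?t j i S (J - {i}) * (D I * D J)"],
      rule sum.cong[OF refl], rule sum.cong[OF refl])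
      (rule sum_remove_reindex[of "\<lambda>i S' J. ?t _ i _ S' * (D _ * D J)"])
  also have "\<dots> = (\<Sum>S\<in>UNIV. \<Sum>j\<in>-S. \<Sum>i\<in>-S. ?s * (hh j i * (sg j S * D (insert j S)) * (sg i S * D (insert i S))))"
  proof (intro sum.cong refl)
    fix S :: "'n set" and j assume j: "j \<in> - S"
    have "(\<Sum>S'\<in>UNIV. \<Sum>i\<in>-S'. ?t j i S S' * (D (insert j S) * D (insert i S'))) =
       (\<Sum>S'\<in>UNIV. if S = S' then \<Sum>i\<in>-S. ?t j i S S * (D (insert j S) * D (insert i S)) else 0)"
      by (intro sum.cong) (auto simp: base_form_def)
    also have "\<dots> = (\<Sum>i\<in>-S. ?t j i S S * (D (insert j S) * D (insert i S)))"
      by simp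
    also have "\<dots> = (\<Sum>i\<in>-S. ?s * (hh j i * (sg j S * D (insert j S)) * (sg i S * D (insert i S))))"
    proof (intro sum.cong refl)
      fix i
      show "?t j i S S * (D (insert j S) * D (insert i S)) =
        ?s * (hh j i * (sg j S * D (insert j S)) * (sg i S * D (insert i S)))"
      proof (cases "D (insert j S) = 0")
        case False
        \<comment> \<open>Hence \<open>(-1) ^ card S * pairing_sign p\<close> is
          \<open>pairing_sign (Suc p)\<close>.\<close>
        then have "card S = p" using Dc[OF False] j by simp
        then show ?thesis by (simp add: base_form_def pairing_sign_Suc mult_ac)
      qed simp
    qed
    finally show "(\<Sum>S'\<in>UNIV. \<Sum>i\<in>-S'. ?t j i S S' * (D (insert j S) * D (insert i S'))) =
      (\<Sum>i\<in>-S. ?s * (hh j i * (sg j S * D (insert j S)) * (sg i S * D (insert i S))))" .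
  qed
  also have "\<dots> = ?s * (\<Sum>S\<in>UNIV. (\<Sum>j\<in>-S. a * (D (insert j S))\<^sup>2) +
      b * (\<Sum>i\<in>-S. y $ i * sg i S * D (insert i S))\<^sup>2)"
    unfolding sum_distrib_left
  proof (intro sum.cong refl)
    fix S :: "'n set"
    have "(\<Sum>i\<in>-S. hh j i * (sg j S * D (insert j S)) * (sg i S * D (insert i S))) =
       a * (D (insert j S))\<^sup>2 +
       (\<Sum>i\<in>-S. b * ((y $ j * sg j S * D (insert j S)) * (y $ i * sg i S * D (insert i S))))"
      if j: "j \<in> - S" for j
    proof -
      have "(\<Sum>i\<in>-S. hh j i * (sg j S * D (insert j S)) * (sg i S * D (insert i S))) =
        (\<Sum>i\<in>-S. (if i = j then a * (sg j S * sg j S) * (D (insert j S))\<^sup>2 else 0) +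
           b * ((y $ j * sg j S * D (insert j S)) * (y $ i * sg i S * D (insert i S))))"
        by (intro sum.cong refl) (simp add: hh_def hess distrib_left distrib_right power2_eq_square mult_ac)
      then show ?thesis using j by (simp add: sum.distrib)
    qed
    then have "(\<Sum>j\<in>-S. \<Sum>i\<in>-S. hh j i * (sg j S * D (insert j S)) * (sg i S * D (insert i S))) =
       (\<Sum>j\<in>-S. a * (D (insert j S))\<^sup>2) + b * (\<Sum>i\<in>-S. y $ i * sg i S * D (insert i S))\<^sup>2"
      unfolding power2_eq_square sum_product by (simp add: sum.distrib flip: sum_distrib_left)
    then show "(\<Sum>j\<in>-S. \<Sum>i\<in>-S. ?s * (hh j i * (sg j S * D (insert j S)) * (sg i S * D (insert i S)))) =
      ?s * ((\<Sum>j\<in>-S. a * (D (insert j S))\<^sup>2) + b * (\<Sum>i\<in>-S. y $ i * sg i S * D (insert i S))\<^sup>2)"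
      by (simp flip: sum_distrib_left)
  qed
  also have "(\<Sum>S\<in>UNIV. (\<Sum>j\<in>-S. a * (D (insert j S))\<^sup>2) +
      b * (\<Sum>i\<in>-S. y $ i * sg i S * D (insert i S))\<^sup>2) =
      (\<Sum>S\<in>UNIV. \<Sum>j\<in>-S. a * (D (insert j S))\<^sup>2) +
      b * (\<Sum>S\<in>UNIV. (\<Sum>i\<in>-S. y $ i * sg i S * D (insert i S))\<^sup>2)"
    by (simp add: sum.distrib sum_distrib_left)
  also have "(\<Sum>S\<in>UNIV. (\<Sum>i\<in>-S. y $ i * sg i S * D (insert i S))\<^sup>2) = (norm y)\<^sup>2 * G"
    unfolding D_def G_def using y by (rule minor_contraction)
  also have "(\<Sum>S\<in>UNIV. \<Sum>j\<in>-S. a * (D (insert j S))\<^sup>2) = (\<Sum>I\<in>UNIV. \<Sum>j\<in>I. a * (D I)\<^sup>2)"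
    using sum_remove_reindex[of "\<lambda>j S I. a * (D I)\<^sup>2"] by simp
  also have "\<dots> = (\<Sum>I\<in>UNIV. real (Suc p) * a * (D I)\<^sup>2)"
  proof (intro sum.cong refl)
    fix I show "(\<Sum>j\<in>I. a * (D I)\<^sup>2) = real (Suc p) * a * (D I)\<^sup>2"
      using Dc[of I] by (cases "D I = 0") simp_all
  qed
  also have "\<dots> = real (Suc p) * a * G"
    by (simp add: G_def sum_distrib_left)
  finally show ?thesis
    unfolding top_coeff_def face_density_def G_def D_def by (simp add: algebra_simps)
qed

section \<open>Smooth functions\<close>

lemma Ck_on_cong:
  assumes "open W" "\<And>x. x \<in> W \<Longrightarrow> f x = g x" "Ck_on k W f"
  shows "Ck_on k W g"
  using assms(2,3)
proof (induction k arbitrary: f g)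
  case 0
  then show ?case by (simp cong: continuous_on_cong)
next
  case (Suc k)
  have d: "(g has_derivative frechet_derivative f (at x)) (at x)" if "x \<in> W" for x
    by (rule has_derivative_transform_within_open[OF has_derivative_frechet assms(1) that])
      (use that Suc.prems in auto)
  moreover have "Ck_on k W (partial_deriv i g)" for i
  proof (rule Suc.IH)
    show "partial_deriv i f x = partial_deriv i g x" if "x \<in> W" for x
      using partial_derivI[OF d[OF that], of i] by (simp add: partial_deriv_def)
    show "Ck_on k W (partial_deriv i f)" using Suc.prems by simp
  qed
  ultimately show ?case by (auto simp: differentiable_def)
qed

lemma Ck_on_Suc_imp: "Ck_on (Suc k) W f \<Longrightarrow> Ck_on k W f"
proof (induction k arbitrary: f)
  case 0
  then show ?case
    by (auto intro!: continuous_at_imp_continuous_on differentiable_imp_continuous_within)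
next
  case (Suc k)
  then show ?case by (metis Ck_on.simps(2))
qed

lemma Ck_on_subset: "Ck_on k W f \<Longrightarrow> V \<subseteq> W \<Longrightarrow> Ck_on k V f"
  by (induction k arbitrary: f) (auto intro: continuous_on_subset)

lemma Ck_on_Un:
  "open V \<Longrightarrow> open W \<Longrightarrow> Ck_on k V f \<Longrightarrow> Ck_on k W f \<Longrightarrow> Ck_on k (V \<union> W) f"
  by (induction k arbitrary: f) (auto intro: continuous_on_open_Un)

lemma Ck_on_const: "Ck_on k W (\<lambda>_. c)"
proof (induction k arbitrary: c)
  case (Suc k)
  have "partial_deriv i (\<lambda>_. c) = (\<lambda>_. 0)" for i :: 'a
    by (rule ext, subst partial_derivI[OF has_derivative_const]) simp
  then show ?case using Suc by simp
qed simp

lemma Ck_on_nth: "Ck_on k W (\<lambda>x. x $ i)"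
proof (cases k)
  case (Suc k)
  have d: "((\<lambda>x. x $ i) has_derivative (\<lambda>x. x $ i)) (at x)" for x :: "'a rvec"
    by (rule bounded_linear_imp_has_derivative[OF bounded_linear_vec_nth])
  have "partial_deriv j (\<lambda>x. x $ i) = (\<lambda>_. axis j 1 $ i)" for j
    by (rule ext, subst partial_derivI[OF d]) simp
  then show ?thesis using d Ck_on_const by (auto simp: Suc differentiable_def)
qed (auto intro: continuous_intros)

lemma Ck_on_add:
  assumes "open W" "Ck_on k W f" "Ck_on k W g"
  shows "Ck_on k W (\<lambda>x. f x + g x)"
  using assms(2,3)
proof (induction k arbitrary: f g)
  case 0
  then show ?case by (auto intro: continuous_intros)
next
  case (Suc k)
  have d: "((\<lambda>x. f x + g x) has_derivative
      (\<lambda>y. frechet_derivative f (at x) y + frechet_derivative g (at x) y)) (at x)"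
    if "x \<in> W" for x
    using Suc.prems that by (intro has_derivative_add has_derivative_frechet) auto
  have "Ck_on k W (\<lambda>x. partial_deriv i f x + partial_deriv i g x)" for i
    using Suc by simp
  then have "Ck_on k W (partial_deriv i (\<lambda>x. f x + g x))" for i
    by (rule Ck_on_cong[OF assms(1), rotated]) (simp add: partial_derivI[OF d], simp add: partial_deriv_def)
  then show ?case using d by (auto simp: differentiable_def)
qed

lemma Ck_on_mult:
  assumes "open W" "Ck_on k W f" "Ck_on k W g"
  shows "Ck_on k W (\<lambda>x. f x * g x)"
  using assms(2,3)
proof (induction k arbitrary: f g)
  case 0
  then show ?case by (auto intro: continuous_intros)
next
  case (Suc k)
  have d: "((\<lambda>x. f x * g x) has_derivative
      (\<lambda>y. f x * frechet_derivative g (at x) y + frechet_derivative f (at x) y * g x)) (at x)"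
    if "x \<in> W" for x
    using Suc.prems that by (intro has_derivative_mult has_derivative_frechet) auto
  have "Ck_on k W f" "Ck_on k W g"
    using Suc.prems by (blast intro: Ck_on_Suc_imp)+
  then have "Ck_on k W (\<lambda>x. f x * partial_deriv i g x + partial_deriv i f x * g x)" for i
    using Suc by (intro Ck_on_add assms(1) Suc.IH) auto
  then have "Ck_on k W (partial_deriv i (\<lambda>x. f x * g x))" for i
    by (rule Ck_on_cong[OF assms(1), rotated]) (simp add: partial_derivI[OF d], simp add: partial_deriv_def)
  then show ?case using d by (auto simp: differentiable_def)
qed

lemma smooth_onD: "smooth_on W f \<Longrightarrow> x \<in> W \<Longrightarrow> f differentiable (at x)"
  unfolding smooth_on_def by (metis Ck_on.simps(2))

lemma smooth_on_partial_deriv: "smooth_on W f \<Longrightarrow> smooth_on W (partial_deriv i f)"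
  unfolding smooth_on_def by (metis Ck_on.simps(2))

lemma smooth_on_subset: "smooth_on W f \<Longrightarrow> V \<subseteq> W \<Longrightarrow> smooth_on V f"
  unfolding smooth_on_def by (blast intro: Ck_on_subset)

lemma smooth_on_const: "smooth_on W (\<lambda>_. c)"
  by (simp add: smooth_on_def Ck_on_const)

lemma smooth_on_nth: "smooth_on W (\<lambda>x. x $ i)"
  by (simp add: smooth_on_def Ck_on_nth)

lemma smooth_on_add:
  "open W \<Longrightarrow> smooth_on W f \<Longrightarrow> smooth_on W g \<Longrightarrow> smooth_on W (\<lambda>x. f x + g x)"
  by (simp add: smooth_on_def Ck_on_add)

lemma smooth_on_mult:
  "open W \<Longrightarrow> smooth_on W f \<Longrightarrow> smooth_on W g \<Longrightarrow> smooth_on W (\<lambda>x. f x * g x)"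
  by (simp add: smooth_on_def Ck_on_mult)

lemma smooth_on_diff:
  assumes "open W" "smooth_on W f" "smooth_on W g"
  shows "smooth_on W (\<lambda>x. f x - g x)"
  using smooth_on_add[OF assms(1,2) smooth_on_mult[OF assms(1) smooth_on_const[of _ "-1"] assms(3)]]
  by simp

lemma smooth_on_sum:
  assumes "open W" "\<And>i. i \<in> S \<Longrightarrow> smooth_on W (f i)"
  shows "smooth_on W (\<lambda>x. \<Sum>i\<in>S. f i x)"
proof (cases "finite S")
  case True
  then show ?thesis using assms(2)
    by (induction S) (auto intro: smooth_on_const smooth_on_add assms(1))
qed (simp add: smooth_on_const)

lemma smooth_on_cong:
  "open W \<Longrightarrow> (\<And>x. x \<in> W \<Longrightarrow> f x = g x) \<Longrightarrow> smooth_on W f \<Longrightarrow> smooth_on W g"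
  unfolding smooth_on_def by (blast intro: Ck_on_cong)

lemma smooth_on_Un:
  "open V \<Longrightarrow> open W \<Longrightarrow> smooth_on V f \<Longrightarrow> smooth_on W f \<Longrightarrow> smooth_on (V \<union> W) f"
  by (simp add: smooth_on_def Ck_on_Un)

lemma compose_has_derivative:
  assumes "(H has_real_derivative h) (at (u x))" "u differentiable (at x)"
  shows "((\<lambda>x. H (u x)) has_derivative (\<lambda>y. h * frechet_derivative u (at x) y)) (at x)"
  using has_derivative_compose[OF has_derivative_frechet[OF assms(2)], of H "(*) h"] assms(1)
  by (simp add: has_field_derivative_def)

lemma partial_deriv_compose:
  assumes "(H has_real_derivative h) (at (u x))" "u differentiable (at x)"
  shows "partial_deriv i (\<lambda>x. H (u x)) x = h * partial_deriv i u x"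
  using partial_derivI[OF compose_has_derivative[OF assms], of i] by (simp add: partial_deriv_def)

text \<open>If every derivative in a family is a linear combination of members, one induction on the
  order treats all members at once and no formula for higher derivatives of a composition is needed.
  Real powers and the functions \<open>flat j\<close> form such families.\<close>

lemma Ck_on_compose_family:
  assumes "open W" "smooth_on W u"
    and D: "\<And>j x. x \<in> W \<Longrightarrow> (P j has_real_derivative (\<Sum>l\<in>L j. c j l * P l (u x))) (at (u x))"
  shows "Ck_on k W (\<lambda>x. P j (u x))"
proof (induction k arbitrary: j)
  case 0
  have "(\<lambda>x. P j (u x)) differentiable (at x)" if "x \<in> W" for x
    using compose_has_derivative[OF D smooth_onD[OF assms(2)]] that by (auto simp: differentiable_def)
  then show ?case
    by (auto intro!: continuous_at_imp_continuous_on differentiable_imp_continuous_within)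
next
  case (Suc k)
  have sum: "Ck_on k W (\<lambda>x. \<Sum>l\<in>L j. c j l * P l (u x))"
  proof (cases "finite (L j)")
    case True
    have "Ck_on k W (\<lambda>x. \<Sum>l\<in>X. c j l * P l (u x))" if "finite X" for X
      using that by induction (auto intro!: Ck_on_const Ck_on_add Ck_on_mult assms(1) Suc)
    with True show ?thesis by blast
  qed (simp add: Ck_on_const)
  have "Ck_on k W (partial_deriv i u)" for i
    using smooth_on_partial_deriv[OF assms(2)] by (simp add: smooth_on_def)
  then have "Ck_on k W (\<lambda>x. (\<Sum>l\<in>L j. c j l * P l (u x)) * partial_deriv i u x)" for i
    using sum by (intro Ck_on_mult assms(1))
  then have "Ck_on k W (partial_deriv i (\<lambda>x. P j (u x)))" for i
  proof (rule Ck_on_cong[OF assms(1), rotated])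
    show "(\<Sum>l\<in>L j. c j l * P l (u x)) * partial_deriv i u x = partial_deriv i (\<lambda>x. P j (u x)) x"
      if "x \<in> W" for x
      using partial_deriv_compose[OF D[OF that] smooth_onD[OF assms(2) that]] by simp
  qed
  moreover have "(\<lambda>x. P j (u x)) differentiable (at x)" if "x \<in> W" for x
    using compose_has_derivative[OF D smooth_onD[OF assms(2)]] that by (auto simp: differentiable_def)
  ultimately show ?case by simp
qed

text \<open>Made for antiderivatives: once the composition with \<open>H'\<close> is smooth, the
  first partial derivatives of the composition with \<open>H\<close> are smooth as well.\<close>

lemma smooth_on_compose:
  assumes "open W" "smooth_on W u"
    and D: "\<And>x. x \<in> W \<Longrightarrow> (H has_real_derivative H' (u x)) (at (u x))"
    and H': "smooth_on W (\<lambda>x. H' (u x))"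
  shows "smooth_on W (\<lambda>x. H (u x))"
proof -
  have diff: "(\<lambda>x. H (u x)) differentiable (at x)" if "x \<in> W" for x
    using compose_has_derivative[OF D smooth_onD[OF assms(2)]] that by (auto simp: differentiable_def)
  have "Ck_on k W (\<lambda>x. H (u x))" for k
  proof (cases k)
    case 0
    then show ?thesis using diff
      by (auto intro!: continuous_at_imp_continuous_on differentiable_imp_continuous_within)
  next
    case (Suc k)
    have "Ck_on k W (partial_deriv i (\<lambda>x. H (u x)))" for i
    proof (rule Ck_on_cong[OF assms(1), of "\<lambda>x. H' (u x) * partial_deriv i u x" , rotated])
      show "Ck_on k W (\<lambda>x. H' (u x) * partial_deriv i u x)"
        using smooth_on_mult[OF assms(1) H' smooth_on_partial_deriv[OF assms(2)]]
        by (simp add: smooth_on_def)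
      show "H' (u x) * partial_deriv i u x = partial_deriv i (\<lambda>x. H (u x)) x" if "x \<in> W" for x
        using partial_deriv_compose[OF D[OF that] smooth_onD[OF assms(2) that]] by simp
    qed
    then show ?thesis using diff Suc by simp
  qed
  then show ?thesis by (simp add: smooth_on_def)
qed

lemma smooth_on_powr:
  assumes "open W" "smooth_on W u" "\<And>x. x \<in> W \<Longrightarrow> 0 < u x"
  shows "smooth_on W (\<lambda>x. u x powr r)"
proof -
  have "((\<lambda>t. t powr s) has_real_derivative (\<Sum>l\<in>{s - 1}. s * u x powr l)) (at (u x))" if "x \<in> W" for s x
    using DERIV_powr[OF DERIV_ident _ DERIV_const, of "u x" s] assms(3)[OF that]
    by (auto intro!: derivative_eq_intros simp: powr_diff)
  then show ?thesis
    using Ck_on_compose_family[OF assms(1,2), of "\<lambda>s t. t powr s" "\<lambda>s l. s" "\<lambda>s. {s - 1}"]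
    by (simp add: smooth_on_def)
qed

section \<open>Bump functions and radial profiles\<close>

definition flat :: "nat \<Rightarrow> real \<Rightarrow> real" where
  "flat j t = (if t \<le> 0 then 0 else exp (- inverse t) * inverse t ^ j)"

text \<open>The single term of index \<open>j + 2\<close> in the exponential series of
  \<open>1 / t\<close> bounds \<open>exp (1 / t)\<close> from below. The two spare powers of
  \<open>t\<close> give the derivative 0 at the origin.\<close>

lemma flat_bound: "\<bar>flat j t\<bar> \<le> fact (j + 2) * t\<^sup>2"
proof (cases "t \<le> 0")
  case False
  then have t: "t > 0" by simp
  have "inverse t ^ (j + 2) / fact (j + 2) \<le> exp (inverse t)"
  proof -
    have "(\<Sum>n\<in>{j + 2}. inverse t ^ n / fact n) \<le> (\<Sum>n. inverse t ^ n / fact n)"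
      using t summable_exp[of "inverse t"] by (intro sum_le_suminf) (auto simp: field_simps)
    then show ?thesis by (simp add: exp_def divide_inverse_commute)
  qed
  then have "inverse t ^ (j + 2) \<le> fact (j + 2) * exp (inverse t)"
    by (simp add: pos_divide_le_eq mult.commute del: fact_Suc)
  then have "exp (- inverse t) * inverse t ^ (j + 2) \<le> exp (- inverse t) * (fact (j + 2) * exp (inverse t))"
    by (rule mult_left_mono) simp
  also have "\<dots> = fact (j + 2)"
    by (simp add: exp_minus del: fact_Suc)
  finally have "exp (- inverse t) * (inverse t ^ (j + 2)) \<le> fact (j + 2)" .
  then have "exp (- inverse t) * (inverse t ^ (j + 2)) * t\<^sup>2 \<le> fact (j + 2) * t\<^sup>2"
    by (intro mult_right_mono) auto
  moreover have "exp (- inverse t) * (inverse t ^ (j + 2)) * t\<^sup>2 = flat j t"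
  proof -
    have "(inverse t)\<^sup>2 * t\<^sup>2 = 1" using t by (simp flip: power_mult_distrib)
    then show ?thesis using t by (simp only: flat_def power_add mult.assoc) simp
  qed
  moreover have "0 \<le> flat j t" using t by (simp add: flat_def)
  ultimately show ?thesis by simp
qed (simp add: flat_def)

text \<open>The negative powers of \<open>t\<close> in \<open>flat\<close> are there to close the
  family under differentiation. At 0 the difference quotient is bounded by a multiple of
  \<open>\<bar>h\<bar>\<close>.\<close>

lemma flat_has_derivative:
  "(flat j has_real_derivative (flat (j + 2) t - real j * flat (j + 1) t)) (at t)"
proof -
  consider "t > 0" | "t < 0" | "t = 0" by linarith
  then show ?thesis
  proof cases
    case 1
    have "((\<lambda>t. exp (- inverse t) * inverse t ^ j) has_real_derivative
        exp (- inverse t) * (inverse t)\<^sup>2 * inverse t ^ j -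
        exp (- inverse t) * (real j * inverse t ^ (j - 1) * (inverse t)\<^sup>2)) (at t)"
      using 1 by (auto intro!: derivative_eq_intros simp: power2_eq_square)
    moreover have "real j * inverse t ^ (j - 1) * (inverse t)\<^sup>2 = real j * inverse t ^ (j + 1)"
      by (cases j) (auto simp: power2_eq_square)
    then have "exp (- inverse t) * (inverse t)\<^sup>2 * inverse t ^ j -
        exp (- inverse t) * (real j * inverse t ^ (j - 1) * (inverse t)\<^sup>2) =
        flat (j + 2) t - real j * flat (j + 1) t"
      using 1 by (simp only: flat_def) (simp add: power2_eq_square)
    ultimately have "((\<lambda>t. exp (- inverse t) * inverse t ^ j) has_real_derivative
        flat (j + 2) t - real j * flat (j + 1) t) (at t)"
      by simp
    then show ?thesis
      by (rule has_field_derivative_transform_within_open[of _ _ _ "{0<..}"])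
        (use 1 in \<open>auto simp: flat_def\<close>)
  next
    case 2
    have "((\<lambda>t. 0) has_real_derivative flat (j + 2) t - real j * flat (j + 1) t) (at t)"
      using 2 by (simp add: flat_def)
    then show ?thesis 
      by (rule has_field_derivative_transform_within_open[of _ _ _ "{..<0}"])
        (use 2 in \<open>auto simp: flat_def\<close>)
  next
    case 3
    have "((\<lambda>h. flat j h / h) \<longlongrightarrow> 0) (at 0)"
    proof (rule Lim_null_comparison)
      show "\<forall>\<^sub>F h in at 0. norm (flat j h / h) \<le> fact (j + 2) * \<bar>h\<bar>"
      proof (rule eventually_at_filter[THEN iffD2], rule always_eventually, intro allI impI)
        fix h :: real assume "h \<noteq> 0"
        have "\<bar>flat j h\<bar> \<le> fact (j + 2) * \<bar>h\<bar> * \<bar>h\<bar>"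
          using flat_bound[of j h] by (simp only: mult.assoc abs_mult_self_eq power2_eq_square)
        with \<open>h \<noteq> 0\<close> show "norm (flat j h / h) \<le> fact (j + 2) * \<bar>h\<bar>"
          by (simp only: real_norm_def abs_divide) (subst divide_le_eq, simp)
      qed
      show "((\<lambda>h. fact (j + 2) * \<bar>h\<bar>) \<longlongrightarrow> (0::real)) (at 0)"
        by (auto intro!: tendsto_eq_intros)
    qed
    then show ?thesis using 3 by (simp add: DERIV_def flat_def)
  qed
qed

lemma smooth_on_flat:
  assumes "open W" "smooth_on W u"
  shows "smooth_on W (\<lambda>x. flat j (u x))"
proof -
  have "(flat j has_real_derivative
      (\<Sum>l\<in>{j + 1, j + 2}. (if l = j + 2 then 1 else - real j) * flat l t)) (at t)" for j t
    using flat_has_derivative[of j t] by simp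
  then show ?thesis
    using Ck_on_compose_family[OF assms, of flat "\<lambda>j l. if l = j + 2 then 1 else - real j" "\<lambda>j. {j + 1, j + 2}"]
    by (simp add: smooth_on_def)
qed

definition bump :: "real \<Rightarrow> real \<Rightarrow> real \<Rightarrow> real" where
  "bump a b t = flat 0 (t - a) * flat 0 (b - t)"

lemma bump_nonneg: "0 \<le> bump a b t"
  by (simp add: bump_def flat_def)

lemma bump_pos_iff: "0 < bump a b t \<longleftrightarrow> a < t \<and> t < b"
  by (auto simp: bump_def flat_def)

lemma bump_zero: "t \<le> a \<or> b \<le> t \<Longrightarrow> bump a b t = 0"
  by (auto simp: bump_def flat_def)

lemma continuous_on_bump: "continuous_on S (bump a b)"
proof -
  have "continuous_on UNIV (flat 0)"
    by (intro continuous_at_imp_continuous_on ballI DERIV_isCont[OF flat_has_derivative])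
  then have "continuous_on S (\<lambda>t. flat 0 (t - a))" "continuous_on S (\<lambda>t. flat 0 (b - t))"
    by (rule continuous_on_compose2; intro continuous_intros subset_UNIV)+
  then show ?thesis unfolding bump_def by (rule continuous_on_mult)
qed

lemma smooth_on_bump: "open W \<Longrightarrow> smooth_on W u \<Longrightarrow> smooth_on W (\<lambda>x. bump a b (u x))"
  unfolding bump_def
  by (intro smooth_on_mult smooth_on_flat smooth_on_diff smooth_on_const)

lemma antiderivative_bump:
  obtains K where "\<And>t. (K has_real_derivative bump a b t) (at t)" "mono K"
    "\<And>t. t \<le> a \<Longrightarrow> K t = K a" "\<And>t. b \<le> t \<Longrightarrow> K t = K b"
proof -
  obtain K where K: "\<And>t. (K has_real_derivative bump a b t) (at t)"
    using einterval_antiderivative[of "-\<infinity>" "\<infinity>" "bump a b"] continuous_on_bump[of UNIV a b]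
    by (auto simp: continuous_on_eq_continuous_at has_real_derivative_iff_has_vector_derivative)
  have "mono K"
    by (intro monoI DERIV_nonneg_imp_nondecreasing[of _ _ K]) (use K bump_nonneg in blast)+
  moreover have "K t = K a" if "t \<le> a" for t
  proof (rule antisym)
    show "K t \<le> K a" using \<open>mono K\<close> that by (simp add: mono_def)
    show "K a \<le> K t"
      using that by (rule DERIV_nonpos_imp_nonincreasing) (use K bump_zero[of _ a b] in fastforce)
  qed
  moreover have "K t = K b" if "b \<le> t" for t
  proof (rule antisym)
    show "K b \<le> K t" using \<open>mono K\<close> that by (simp add: mono_def)
    show "K t \<le> K b"
      using that by (rule DERIV_nonpos_imp_nonincreasing) (use K bump_zero[of _ a b] in fastforce)
  qed
  ultimately show ?thesis using K that by blast
qed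

text \<open>The function \<open>\<phi>\<close> of the overview. Substituting
  \<open>t powr (- d / 2) * G t\<close> for \<open>H'\<close> in \<open>2 d H' + 4 t H''\<close>
  cancels \<open>G\<close> and leaves \<open>4 * t powr (1 - d / 2)\<close> times the derivative of
  \<open>G\<close>; here that derivative is a bump.\<close>

definition radial_weight :: "real \<Rightarrow> real \<Rightarrow> real \<Rightarrow> real \<Rightarrow> real" where
  "radial_weight d a b t = 4 * t powr (1 - d / 2) * bump a b t"

lemma radial_weight_nonneg: "0 \<le> radial_weight d a b t"
  by (simp add: radial_weight_def bump_nonneg)

lemma radial_weight_pos: "0 < a \<Longrightarrow> a < t \<Longrightarrow> t < b \<Longrightarrow> 0 < radial_weight d a b t"
  using bump_pos_iff[of a b t] by (simp add: radial_weight_def)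

lemma radial_weight_zero: "b \<le> t \<Longrightarrow> radial_weight d a b t = 0"
  by (simp add: radial_weight_def bump_zero)

lemma continuous_on_radial_weight:
  assumes "0 < a"
  shows "continuous_on UNIV (radial_weight d a b)"
proof -
  have "continuous_on {..<a} (radial_weight d a b)"
    using continuous_on_const[of "{..<a}" 0]
    by (rule continuous_on_cong[THEN iffD1, rotated 2]) (auto simp: radial_weight_def bump_zero)
  moreover have "continuous_on {0<..} (radial_weight d a b)"
    unfolding radial_weight_def by (intro continuous_intros continuous_on_bump) auto
  ultimately have "continuous_on ({..<a} \<union> {0<..}) (radial_weight d a b)"
    by (intro continuous_on_open_Un) auto
  moreover have "{..<a} \<union> {0<..} = (UNIV :: real set)" using assms by auto
  ultimately show ?thesis by simp
qed

text \<open>\<open>2 d H' + 4 t H''\<close> is the Laplacian of \<open>x \<mapsto> H(|x|\<^sup>2)\<close> on \<open>\<real>\<^sup>d\<close>. Solving for \<open>H'\<close> gives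
  \<open>H'(t) = t\<^sup>-\<^sup>d\<^sup>/\<^sup>2 (K(t) - K(l\<^sup>2 t))\<close> with an antiderivative \<open>K\<close> of the bump.\<close>
lemma radial_profile:
  fixes a b l d :: real and w :: "'n::finite rvec"
  assumes ab: "0 < a" "a < b" and l: "1 < l"
  obtains H F F' where "\<And>t. (H has_real_derivative F t) (at t)"
    "\<And>t. (F has_real_derivative F' t) (at t)"
    "\<And>t. 0 \<le> H t" "\<And>t. b \<le> t \<Longrightarrow> H t = 0 \<and> F t = 0 \<and> F' t = 0"
    "\<And>t. 0 \<le> t \<Longrightarrow> 2 * d * F t + 4 * t * F' t =
       radial_weight d a b t - l powr d * radial_weight d a b (l\<^sup>2 * t)"
    "smooth_on UNIV (\<lambda>x. H ((norm (x - w))\<^sup>2))"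
proof -
  obtain K where K: "\<And>t. (K has_real_derivative bump a b t) (at t)" "mono K"
    and K0: "\<And>t. t \<le> a \<Longrightarrow> K t = K a" and K1: "\<And>t. b \<le> t \<Longrightarrow> K t = K b"
    using antiderivative_bump[of a b] by (metis (no_types, lifting))
  have l2: "1 < l\<^sup>2" "0 < l\<^sup>2" using l by (auto simp: one_less_power)
  \<comment> \<open>For \<open>t < c\<close> both \<open>t\<close> and \<open>l\<^sup>2 * t\<close>
    lie below \<open>a\<close>, where \<open>K\<close> is constant. So \<open>F\<close> vanishes
    there, and the power of \<open>t\<close> that is singular at 0 has no effect.\<close>
  define c where "c = a / l\<^sup>2"
  have c: "0 < c" "c < a" using ab l2 by (auto simp: c_def divide_less_eq)
  define F where "F t = (if t \<le> 0 then 0 else t powr (- d / 2) * (K t - K (l\<^sup>2 * t)))" for t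
  define F' where "F' t = (if t \<le> 0 then 0 else
      - d / 2 * t powr (- d / 2 - 1) * (K t - K (l\<^sup>2 * t)) +
      t powr (- d / 2) * (bump a b t - l\<^sup>2 * bump a b (l\<^sup>2 * t)))" for t
  have lt: "l\<^sup>2 * t < a" "t < a" if "t < c" for t
    using that l2 c by (simp add: c_def field_simps, linarith)
  have F0: "F t = 0" if "t < c" for t
    using K0[of t] K0[of "l\<^sup>2 * t"] lt[OF that] by (simp add: F_def)
  have F'0: "F' t = 0" if "t < c" for t
    using K0[of t] K0[of "l\<^sup>2 * t"] lt[OF that] bump_zero[of t a b] bump_zero[of "l\<^sup>2 * t" a b]
    by (simp add: F'_def)
  have dK: "((\<lambda>t. K (l\<^sup>2 * t)) has_real_derivative l\<^sup>2 * bump a b (l\<^sup>2 * t)) (at t)" for t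
    by (rule DERIV_cong[OF DERIV_chain2[OF K(1), of "\<lambda>t. l\<^sup>2 * t" "l\<^sup>2"]])
      (auto intro!: derivative_eq_intros)
  have dF: "(F has_real_derivative F' t) (at t)" for t
  proof (cases "0 < t")
    case True
    have "((\<lambda>t. t powr (- d / 2)) has_real_derivative - d / 2 * t powr (- d / 2 - 1)) (at t)"
      using has_real_derivative_powr[OF True, of "- d / 2"] by simp
    from DERIV_mult[OF this DERIV_diff[OF K(1) dK]]
    have "((\<lambda>t. t powr (- d / 2) * (K t - K (l\<^sup>2 * t))) has_real_derivative F' t) (at t)"
      using True by (simp add: F'_def mult.commute)
    then show ?thesis
      by (rule has_field_derivative_transform_within_open[of _ _ _ "{0<..}"])
        (use True in \<open>auto simp: F_def\<close>)
  next
    case False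
    have "((\<lambda>t. 0) has_real_derivative F' t) (at t)"
      using False c by (simp add: F'0)
    then show ?thesis
      by (rule has_field_derivative_transform_within_open[of _ _ _ "{..<c}"])
        (use False c F0 in auto)
  qed
  have "continuous_on UNIV F"
    by (intro continuous_at_imp_continuous_on ballI DERIV_isCont[OF dF])
  then obtain H0 where H0: "\<And>t. (H0 has_real_derivative F t) (at t)"
    using einterval_antiderivative[of "-\<infinity>" "\<infinity>" F]
    by (auto simp: continuous_on_eq_continuous_at has_real_derivative_iff_has_vector_derivative)
  define H where "H t = H0 t - H0 b" for t
  have dH: "(H has_real_derivative F t) (at t)" for t
    unfolding H_def using H0[of t] by (auto intro!: derivative_eq_intros)
  have Fb: "F t = 0" if "b \<le> t" for t
  proof -
    have "b \<le> l\<^sup>2 * t" using that l2 ab mult_mono[of 1 "l\<^sup>2" b t] by simp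
    from K1[OF this] K1[OF that] show ?thesis by (simp add: F_def)
  qed
  have F'b: "F' t = 0" if "b \<le> t" for t
  proof -
    have "b \<le> l\<^sup>2 * t" using that l2 ab mult_mono[of 1 "l\<^sup>2" b t] by simp
    then show ?thesis using K1[OF that] K1[of "l\<^sup>2 * t"] bump_zero that by (simp add: F'_def)
  qed
  \<comment> \<open>\<open>K\<close> is monotone and \<open>l > 1\<close>, so \<open>H\<close>
    decreases; as it vanishes from \<open>b\<close> on, it is nonnegative.\<close>
  have Fneg: "F t \<le> 0" for t
  proof (cases "0 < t")
    case True
    then have "K t \<le> K (l\<^sup>2 * t)" using K(2) l2 by (simp add: mono_def)
    then show ?thesis by (simp add: F_def mult_nonneg_nonpos)
  qed (simp add: F_def)
  have anti: "H t \<le> H s" if "s \<le> t" for s t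
    using that by (rule DERIV_nonpos_imp_nonincreasing) (use dH Fneg in blast)
  have Hb: "H t = 0" if "b \<le> t" for t
  proof (rule antisym)
    show "H t \<le> 0" using anti[OF that] by (simp add: H_def)
    have "H b \<le> H t"
      using that by (rule DERIV_nonneg_imp_nondecreasing) (use dH Fb in fastforce)
    then show "0 \<le> H t" by (simp add: H_def)
  qed
  have Hnn: "0 \<le> H t" for t
    using anti[of t b] Hb[of t] by (cases "t \<le> b") (auto simp: H_def)
  have eq: "2 * d * F t + 4 * t * F' t =
       radial_weight d a b t - l powr d * radial_weight d a b (l\<^sup>2 * t)" if "0 \<le> t" for t
  proof (cases "t = 0")
    case True
    then show ?thesis using ab by (simp add: F_def radial_weight_def bump_zero)
  next
    case False
    then have t: "0 < t" using that by simp
    have p1: "t * t powr (- d / 2 - 1) = t powr (- d / 2)"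
      using t by (simp add: powr_diff)
    have p2: "t * t powr (- d / 2) = t powr (1 - d / 2)"
      using t powr_add[of t 1 "- d / 2"] by simp
    have "l\<^sup>2 powr (1 - d / 2) = l powr (2 - d)"
      using l powr_powr[of l 2 "1 - d / 2"] by (simp add: powr_numeral algebra_simps)
    \<comment> \<open>This is the origin of the factor \<open>l powr d\<close>: it converts the
      \<open>l\<^sup>2\<close> from the chain rule for \<open>K (l\<^sup>2 * t)\<close> into the
      weight taken at \<open>l\<^sup>2 * t\<close>.\<close>
    then have p3: "l powr d * (l\<^sup>2 * t) powr (1 - d / 2) = l\<^sup>2 * t powr (1 - d / 2)"
      using l t by (simp add: powr_mult powr_diff powr_numeral)
    have "2 * d * F t + 4 * t * F' t = 2 * d * (t powr (- d / 2) * (K t - K (l\<^sup>2 * t)))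
       - 2 * d * (t * t powr (- d / 2 - 1)) * (K t - K (l\<^sup>2 * t)) +
       4 * (t * t powr (- d / 2)) * (bump a b t - l\<^sup>2 * bump a b (l\<^sup>2 * t))"
    proof -
      have "2 * d * (p * q) + 4 * t * (- d / 2 * r * q + p * s) =
          2 * d * (p * q) - 2 * d * (t * r) * q + 4 * (t * p) * s" for p q r s
        by (simp add: field_simps)
      moreover have "F t = t powr (- d / 2) * (K t - K (l\<^sup>2 * t))"
        "F' t = - d / 2 * t powr (- d / 2 - 1) * (K t - K (l\<^sup>2 * t)) +
          t powr (- d / 2) * (bump a b t - l\<^sup>2 * bump a b (l\<^sup>2 * t))"
        using t by (simp_all add: F_def F'_def)
      ultimately show ?thesis by presburger
    qed
    also have "\<dots> = 4 * t powr (1 - d / 2) * (bump a b t - l\<^sup>2 * bump a b (l\<^sup>2 * t))"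
      unfolding p1 p2 by simp
    also have "\<dots> = 4 * t powr (1 - d / 2) * bump a b t -
        4 * (l powr d * (l\<^sup>2 * t) powr (1 - d / 2)) * bump a b (l\<^sup>2 * t)"
      unfolding p3 by (simp add: algebra_simps)
    finally show ?thesis by (simp add: radial_weight_def)
  qed
  let ?u = "\<lambda>x. (norm (x - w))\<^sup>2"
  have u: "smooth_on UNIV ?u"
  proof -
    have "?u = (\<lambda>x. \<Sum>i\<in>UNIV. (x $ i - w $ i) * (x $ i - w $ i))"
      by (simp add: fun_eq_iff power2_norm_eq_inner inner_vec_def)
    moreover have "smooth_on UNIV (\<lambda>x::'n rvec. \<Sum>i\<in>UNIV. (x $ i - w $ i) * (x $ i - w $ i))"
      by (intro smooth_on_sum smooth_on_mult smooth_on_diff smooth_on_nth smooth_on_const open_UNIV)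
    ultimately show ?thesis by simp
  qed
  \<comment> \<open>Near \<open>w\<close> the function \<open>F (?u x)\<close> is 0, away from
    \<open>w\<close> it is a product of smooth functions, and the two regions cover the space.
    Smoothness of \<open>H (?u x)\<close> follows because \<open>F\<close> is the derivative of
    \<open>H\<close>.\<close>
  have "open {x. ?u x < c}" "open {x. 0 < ?u x}"
    by (intro open_Collect_less continuous_intros)+
  moreover have "smooth_on {x. ?u x < c} (\<lambda>x. F (?u x))"
    using F0 by (intro smooth_on_cong[OF calculation(1) _ smooth_on_const[of _ 0]]) auto
  moreover have "smooth_on {x. 0 < ?u x} (\<lambda>x. F (?u x))"
  proof -
    let ?W = "{x. 0 < ?u x}"
    have W: "open ?W" by fact
    have uW: "smooth_on ?W ?u" by (rule smooth_on_subset[OF u]) simp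
    have "smooth_on ?W (\<lambda>x. K (?u x))"
      by (rule smooth_on_compose[OF W uW, where H = K and H' = "bump a b", OF K(1) smooth_on_bump[OF W uW]])
    moreover have lW: "smooth_on ?W (\<lambda>x. l\<^sup>2 * ?u x)"
      by (intro smooth_on_mult smooth_on_const uW W)
    then have "smooth_on ?W (\<lambda>x. K (l\<^sup>2 * ?u x))"
      by (rule smooth_on_compose[OF W _, where H = K and H' = "bump a b", OF _ K(1) smooth_on_bump[OF W lW]])
    moreover have "smooth_on ?W (\<lambda>x. ?u x powr (- d / 2))"
      by (intro smooth_on_powr W uW) simp
    ultimately have "smooth_on ?W (\<lambda>x. ?u x powr (- d / 2) * (K (?u x) - K (l\<^sup>2 * ?u x)))"
      by (intro smooth_on_mult smooth_on_diff W)
    then show ?thesis by (rule smooth_on_cong[OF W, rotated]) (simp add: F_def)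
  qed
  ultimately have "smooth_on ({x. ?u x < c} \<union> {x. 0 < ?u x}) (\<lambda>x. F (?u x))"
    by (intro smooth_on_Un)
  moreover have "{x. ?u x < c} \<union> {x. 0 < ?u x} = UNIV" using c by auto
  ultimately have "smooth_on UNIV (\<lambda>x. F (?u x))" by simp
  then have "smooth_on UNIV (\<lambda>x. H (?u x))"
    by (rule smooth_on_compose[OF open_UNIV u, where H = H and H' = F, OF dH])
  then show ?thesis using that dH dF Hnn Hb Fb F'b eq by blast
qed

lemma axis_nth: "axis j (1::real) $ i = (if i = j then 1 else 0)"
  by (simp add: axis_def)

lemma has_derivative_norm_diff_square:
  "((\<lambda>x. (norm (x - w))\<^sup>2) has_derivative (\<lambda>h. 2 * ((x - w) \<bullet> h))) (at x)"
  for x w :: "'a::real_inner"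
  unfolding power2_norm_eq_inner
  by (auto intro!: derivative_eq_intros simp: inner_commute)

lemma partial_deriv_radial:
  assumes H: "\<And>t. (H has_real_derivative F t) (at t)" and F: "\<And>t. (F has_real_derivative F' t) (at t)"
  fixes w :: "'n::finite rvec"
  defines "u \<equiv> \<lambda>x. (norm (x - w))\<^sup>2"
  shows "partial_deriv i (\<lambda>x. H (u x)) = (\<lambda>x. 2 * F (u x) * (x $ i - w $ i))"
    and "partial_deriv j (partial_deriv i (\<lambda>x. H (u x))) x =
      2 * F (u x) * (if i = j then 1 else 0) + 4 * F' (u x) * ((x - w) $ i * (x - w) $ j)"
proof -
  have du: "(u has_derivative (\<lambda>h. 2 * ((x - w) \<bullet> h))) (at x)" for x
    unfolding u_def by (rule has_derivative_norm_diff_square)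
  have comp: "((\<lambda>x. P (u x)) has_derivative (\<lambda>h. p * (2 * ((x - w) \<bullet> h)))) (at x)"
    if "(P has_real_derivative p) (at (u x))" for P p x
    using has_derivative_compose[OF du, of P "(*) p"] that by (simp add: has_field_derivative_def)
  show 1: "partial_deriv i (\<lambda>x. H (u x)) = (\<lambda>x. 2 * F (u x) * (x $ i - w $ i))" for i
    by (rule ext, subst partial_derivI[OF comp[OF H]]) (simp add: inner_axis)
  have "((\<lambda>x. x $ i) has_derivative (\<lambda>h. h $ i)) (at x)"
    by (rule bounded_linear_imp_has_derivative[OF bounded_linear_vec_nth])
  then have "((\<lambda>x. 2 * F (u x) * (x $ i - w $ i)) has_derivative
     (\<lambda>h. 2 * F (u x) * h $ i + 2 * (F' (u x) * (2 * ((x - w) \<bullet> h))) * (x $ i - w $ i))) (at x)"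
    by (auto intro!: derivative_eq_intros comp[OF F])
  from partial_derivI[OF this, of j]
  show "partial_deriv j (partial_deriv i (\<lambda>x. H (u x))) x =
      2 * F (u x) * (if i = j then 1 else 0) + 4 * F' (u x) * ((x - w) $ i * (x - w) $ j)"
    unfolding 1 by (simp add: inner_axis axis_nth)
qed

section \<open>Rational polyhedra and lattice bases\<close>

definition int_vecs :: "'n::finite rvec set" where
  "int_vecs = {v. \<forall>i. v $ i \<in> \<int>}"

lemma inner_int_vecs: "m \<in> int_vecs \<Longrightarrow> b \<in> int_vecs \<Longrightarrow> m \<bullet> b \<in> \<int>"
  by (auto simp: int_vecs_def inner_vec_def intro!: Ints_sum)

text \<open>Fraction-free elimination: given a spanning vector \<open>b0\<close> with
  \<open>m \<bullet> b0 \<noteq> 0\<close>, the map \<open>T\<close> pushes the others into the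
  kernel of \<open>m\<close> without leaving the integer vectors.\<close>

lemma int_kernel_spanned:
  assumes "finite M" "M \<subseteq> int_vecs"
  obtains B where "B \<subseteq> int_vecs" "span B = {z :: 'n::finite rvec. \<forall>m\<in>M. m \<bullet> z = 0}"
proof -
  have "\<exists>B\<subseteq>int_vecs. span B = {z :: 'n rvec. \<forall>m\<in>M. m \<bullet> z = 0}"
    using assms
  proof (induction M rule: finite_induct)
    case empty
    have "(Basis :: 'n rvec set) \<subseteq> int_vecs"
      by (auto simp: int_vecs_def Basis_vec_def axis_def)
    then show ?case by (intro exI[of _ Basis]) simp
  next
    case (insert m M)
    then obtain B where B: "B \<subseteq> int_vecs" "span B = {z. \<forall>m\<in>M. m \<bullet> z = 0}" by auto
    have m: "m \<in> int_vecs" using insert.prems by simp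
    show ?case
    proof (cases "\<forall>b\<in>B. m \<bullet> b = 0")
      case True
      have "span B \<subseteq> {z. m \<bullet> z = 0}"
        using True by (intro span_minimal subspace_hyperplane) auto
      with B show ?thesis by (intro exI[of _ B]) auto
    next
      case False
      then obtain b0 where b0: "b0 \<in> B" "m \<bullet> b0 \<noteq> 0" by blast
      define T where "T b = (m \<bullet> b0) *\<^sub>R b - (m \<bullet> b) *\<^sub>R b0" for b
      have lin: "linear T"
        by (rule linearI) (auto simp: T_def inner_add_right algebra_simps)
      have "T b \<in> int_vecs" if "b \<in> B" for b
        using inner_int_vecs[OF m] b0(1) B(1) that
        by (auto simp: T_def int_vecs_def intro!: Ints_diff Ints_mult)
      moreover have "span (T ` B) = {z. \<forall>n\<in>insert m M. n \<bullet> z = 0}"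
      proof
        have "T b \<in> {z. \<forall>n\<in>insert m M. n \<bullet> z = 0}" if "b \<in> B" for b
        proof -
          have "b \<in> span B" "b0 \<in> span B" using that b0 by (auto intro: span_base)
          with B(2) show ?thesis by (auto simp: T_def inner_diff_right)
        qed
        moreover have "subspace {z. \<forall>n\<in>insert m M. n \<bullet> z = 0}"
          by (auto simp: subspace_def inner_add_right)
        ultimately show "span (T ` B) \<subseteq> {z. \<forall>n\<in>insert m M. n \<bullet> z = 0}"
          by (intro span_minimal) auto
        show "{z. \<forall>n\<in>insert m M. n \<bullet> z = 0} \<subseteq> span (T ` B)"
        proof clarify
          fix z assume z: "\<forall>n\<in>insert m M. n \<bullet> z = 0"
          then have "z \<in> span B" using B(2) by auto
          then have "T z \<in> span (T ` B)" using linear_span_image[OF lin] by blast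
          \<comment> \<open>On the kernel of \<open>m\<close> the map \<open>T\<close> is
            multiplication by the nonzero number \<open>m \<bullet> b0\<close>.\<close>
          moreover have "z = (1 / (m \<bullet> b0)) *\<^sub>R T z" using z b0 by (simp add: T_def)
          ultimately show "z \<in> span (T ` B)" by (metis span_scale)
        qed
      qed
      ultimately show ?thesis by (intro exI[of _ "T ` B"]) auto
    qed
  qed
  then show ?thesis using that by blast
qed

lemma int_multiples_in_subgroup:
  fixes G :: "'a::real_vector set"
  assumes "0 \<in> G" "\<And>x y. x \<in> G \<Longrightarrow> y \<in> G \<Longrightarrow> x - y \<in> G" "x \<in> G"
  shows "of_int k *\<^sub>R x \<in> G"
proof -
  have neg: "- y \<in> G" if "y \<in> G" for y using assms(2)[OF assms(1) that] by simp
  have add: "y + z \<in> G" if "y \<in> G" "z \<in> G" for y z using assms(2)[OF that(1) neg[OF that(2)]] by simp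
  have "real n *\<^sub>R x \<in> G" for n
    by (induction n) (auto simp: assms algebra_simps intro: add)
  then show ?thesis
    by (cases k rule: int_cases2) (auto dest: neg)
qed

text \<open>The basis is built up in echelon form, one coordinate of \<open>S\<close> at a time.\<close>
lemma int_subgroup_basis:
  fixes G :: "'n::finite rvec set"
  assumes "finite S" "G \<subseteq> int_vecs" "0 \<in> G" "\<And>x y. x \<in> G \<Longrightarrow> y \<in> G \<Longrightarrow> x - y \<in> G"
    and "\<And>x i. x \<in> G \<Longrightarrow> i \<notin> S \<Longrightarrow> x $ i = 0"
  shows "\<exists>B. finite B \<and> independent B \<and> G = {\<Sum>b\<in>B. of_int (c b) *\<^sub>R b | c. True}"
  using assms
proof (induction S arbitrary: G rule: finite_induct)
  case empty
  then have "G = {0}" by (auto simp: vec_eq_iff)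
  then show ?case by (intro exI[of _ "{}"]) (auto simp: independent_empty)
next
  case (insert i S)
  define G' where "G' = {x \<in> G. x $ i = 0}"
  have "\<exists>B. finite B \<and> independent B \<and> G' = {\<Sum>b\<in>B. of_int (c b) *\<^sub>R b | c. True}"
  proof (rule insert.IH)
    show "x $ j = 0" if "x \<in> G'" "j \<notin> S" for x j
      using insert.prems(4)[of x j] that by (cases "j = i") (auto simp: G'_def)
  qed (use insert.prems(1,2,3) in \<open>auto simp: G'_def\<close>)
  then obtain B where B: "finite B" "independent B" "G' = {\<Sum>b\<in>B. of_int (c b) *\<^sub>R b | c. True}"
    by blast
  show ?case
  proof (cases "G = G'")
    case True
    then show ?thesis using B by blast
  next
    case False
    note mult = int_multiples_in_subgroup[OF insert.prems(2,3)]
    have neg: "- y \<in> G" if "y \<in> G" for y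
      using insert.prems(3)[OF insert.prems(2) that] by simp
    obtain z where z: "z \<in> G" "z $ i \<noteq> 0" using False by (auto simp: G'_def)
    then obtain k where k: "z $ i = of_int k" "k \<noteq> 0"
      using insert.prems(1) by (auto simp: int_vecs_def elim!: Ints_cases)
    let ?Q = "\<lambda>n::nat. n > 0 \<and> (\<exists>z\<in>G. z $ i = real n)"
    have ex: "?Q (nat \<bar>k\<bar>)"
    proof (cases "k > 0")
      case True
      then show ?thesis using z k by (auto intro!: bexI[of _ z])
    next
      case False
      then show ?thesis using z k neg by (auto intro!: bexI[of _ "- z"])
    qed
    \<comment> \<open>The \<open>i\<close>-th coordinates of elements of \<open>G\<close> are the
      multiples of \<open>N\<close>: a nonzero remainder modulo \<open>N\<close> would be a smaller
      positive value. Subtracting a multiple of \<open>z0\<close> therefore always leads into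
      \<open>G'\<close>.\<close>
    define N where "N = (LEAST n. ?Q n)"
    have "?Q N" unfolding N_def by (rule LeastI[of ?Q, OF ex])
    then obtain z0 where z0: "z0 \<in> G" "z0 $ i = real N" and pos: "N > 0" by blast
    have least: "N \<le> n" if "?Q n" for n unfolding N_def by (rule Least_le[of ?Q, OF that])
    define n0 where "n0 = int N"
    have n0: "n0 > 0" "z0 $ i = of_int n0" using z0 pos by (auto simp: n0_def)
    have red: "\<exists>q. x - of_int q *\<^sub>R z0 \<in> G'" if x: "x \<in> G" for x
    proof -
      obtain k where k: "x $ i = of_int k"
        using x insert.prems(1) by (auto simp: int_vecs_def elim!: Ints_cases)
      define y where "y = x - of_int (k div n0) *\<^sub>R z0"
      have y: "y \<in> G" unfolding y_def using insert.prems(3) x mult z0 by blast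
      have "y $ i = of_int (k - (k div n0) * n0)" by (simp add: y_def k n0)
      then have yi: "y $ i = of_int (k mod n0)" by (simp add: minus_div_mult_eq_mod)
      have "k mod n0 = 0"
      proof (rule ccontr)
        assume "k mod n0 \<noteq> 0"
        then have "0 < k mod n0" "k mod n0 < n0" using n0 by (auto simp: order.not_eq_order_implies_strict)
        then have "?Q (nat (k mod n0))" using y yi by auto
        then have "N \<le> nat (k mod n0)" by (rule least)
        then show False using \<open>k mod n0 < n0\<close> \<open>0 < k mod n0\<close> by (simp add: n0_def)
      qed
      then show ?thesis using y yi unfolding G'_def y_def by (intro exI[of _ "k div n0"]) auto
    qed
    \<comment> \<open>The new vector \<open>z0\<close> is independent of \<open>B\<close>, since the
      \<open>i\<close>-th coordinate vanishes on \<open>span B\<close> but not at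
      \<open>z0\<close>.\<close>
    have "span B \<subseteq> {x. x $ i = 0}"
    proof (rule span_minimal)
      have "b \<in> G'" if "b \<in> B" for b
        unfolding B(3) using that B(1)
        by (auto intro!: exI[of _ "\<lambda>b'. if b' = b then 1 else 0"] simp: if_distrib[of "\<lambda>x. of_int x *\<^sub>R _"] cong: if_cong)
      then show "B \<subseteq> {x. x $ i = 0}" by (auto simp: G'_def)
    qed (auto simp: subspace_def)
    then have z0B: "z0 \<notin> span B" using n0 by auto
    then have z0B': "z0 \<notin> B" using span_base by blast
    have "independent (insert z0 B)"
      using z0B B(2) by (simp add: independent_insert)
    moreover have "G = {\<Sum>b\<in>insert z0 B. of_int (c b) *\<^sub>R b | c. True}"
    proof (intro equalityI subsetI)
      fix x assume "x \<in> G"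
      then obtain q where "x - of_int q *\<^sub>R z0 \<in> G'" using red by blast
      then obtain c where c: "x - of_int q *\<^sub>R z0 = (\<Sum>b\<in>B. of_int (c b) *\<^sub>R b)" using B(3) by auto
      have "(\<Sum>b\<in>B. of_int ((c(z0 := q)) b) *\<^sub>R b) = (\<Sum>b\<in>B. of_int (c b) *\<^sub>R b)"
        using z0B' by (intro sum.cong) auto
      then have "x = (\<Sum>b\<in>insert z0 B. of_int ((c(z0 := q)) b) *\<^sub>R b)"
        using c B(1) z0B' by (simp add: algebra_simps)
      then show "x \<in> {\<Sum>b\<in>insert z0 B. of_int (c b) *\<^sub>R b | c. True}" by blast
    next
      fix x assume "x \<in> {\<Sum>b\<in>insert z0 B. of_int (c b) *\<^sub>R b | c. True}"
      then obtain c where x: "x = of_int (c z0) *\<^sub>R z0 + (\<Sum>b\<in>B. of_int (c b) *\<^sub>R b)"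
        using B(1) z0B' by auto
      have "(\<Sum>b\<in>B. of_int (c b) *\<^sub>R b) \<in> G" using B(3) by (auto simp: G'_def)
      moreover have "- (of_int (c z0) *\<^sub>R z0) \<in> G" using neg mult z0 by blast
      ultimately have "(\<Sum>b\<in>B. of_int (c b) *\<^sub>R b) - - (of_int (c z0) *\<^sub>R z0) \<in> G"
        by (rule insert.prems(3))
      then show "x \<in> G" by (simp add: x add.commute)
    qed
    ultimately show ?thesis using B(1) by (intro exI[of _ "insert z0 B"]) auto
  qed
qed

text \<open>\<open>face_basis\<close> is a choice, so it carries information only once a basis is
  known to exist. Because the parallel space is cut out by integer equations, integer vectors span
  it, and a basis of the lattice has exactly \<open>dim (par_space \<sigma>)\<close>
  elements.\<close>

lemma ex_lattice_basis:
  assumes M: "finite M" "M \<subseteq> int_vecs" "par_space \<sigma> = {z :: 'n::finite rvec. \<forall>m\<in>M. m \<bullet> z = 0}"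
  shows "\<exists>v. lattice_basis \<sigma> v"
proof -
  obtain C where C: "C \<subseteq> int_vecs" "span C = par_space \<sigma>"
    using int_kernel_spanned[OF M(1,2)] M(3) by metis
  have sub: "subspace (par_space \<sigma>)" by (simp add: par_space_def)
  have G: "par_lattice \<sigma> = par_space \<sigma> \<inter> int_vecs" by (auto simp: par_lattice_def int_vecs_def)
  have "\<exists>B. finite B \<and> independent B \<and> par_lattice \<sigma> = {\<Sum>b\<in>B. of_int (c b) *\<^sub>R b | c. True}"
  proof (rule int_subgroup_basis[OF finite])
    show "par_lattice \<sigma> \<subseteq> int_vecs" by (simp add: G)
    show "0 \<in> par_lattice \<sigma>" using subspace_0[OF sub] by (simp add: G int_vecs_def)
    show "x - y \<in> par_lattice \<sigma>" if "x \<in> par_lattice \<sigma>" "y \<in> par_lattice \<sigma>" for x y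
      using that subspace_diff[OF sub] by (simp add: G int_vecs_def)
    show "x $ i = 0" if "i \<notin> UNIV" for x :: "'n rvec" and i
      using that by simp
  qed
  then obtain B where B: "finite B" "independent B"
      "par_lattice \<sigma> = {\<Sum>b\<in>B. of_int (c b) *\<^sub>R b | c. True}"
    by blast
  have "B \<subseteq> par_lattice \<sigma>"
  proof
    fix b assume b: "b \<in> B"
    have "b = (\<Sum>b'\<in>B. of_int (if b' = b then 1 else 0) *\<^sub>R b')"
      using b B(1) by (simp add: if_distrib[of "\<lambda>x. of_int x *\<^sub>R _"] cong: if_cong)
    then show "b \<in> par_lattice \<sigma>" unfolding B(3) by (intro CollectI exI conjI TrueI)
  qed
  moreover have "par_lattice \<sigma> \<subseteq> span B"
    unfolding B(3) by (clarify, intro span_sum span_scale span_base)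
  moreover have "C \<subseteq> par_lattice \<sigma>" using C span_superset by (auto simp: G)
  ultimately have "span B = par_space \<sigma>"
    using C(2) sub G by (metis Int_lower1 order.trans span_eq span_minimal span_mono subset_antisym)
  then have card: "card B = dim (par_space \<sigma>)"
    using B(2) by (metis dim_span dim_eq_card_independent)
  obtain v where v: "bij_betw v {0..<card B} B" using ex_bij_betw_nat_finite[OF B(1)] by blast
  have "par_lattice \<sigma> = {\<Sum>j<dim (par_space \<sigma>). of_int (c j) *\<^sub>R v j | c. True}"
  proof (intro equalityI subsetI)
    fix x assume "x \<in> par_lattice \<sigma>"
    then obtain c where "x = (\<Sum>b\<in>B. of_int (c b) *\<^sub>R b)" using B(3) by auto
    then have "x = (\<Sum>j<dim (par_space \<sigma>). of_int ((c \<circ> v) j) *\<^sub>R v j)"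
      using sum.reindex_bij_betw[OF v, of "\<lambda>b. of_int (c b) *\<^sub>R b"] by (simp add: card atLeast0LessThan)
    then show "x \<in> {\<Sum>j<dim (par_space \<sigma>). of_int (c j) *\<^sub>R v j | c. True}" by blast
  next
    fix x assume "x \<in> {\<Sum>j<dim (par_space \<sigma>). of_int (c j) *\<^sub>R v j | c. True}"
    then obtain c where c: "x = (\<Sum>j<dim (par_space \<sigma>). of_int (c j) *\<^sub>R v j)" by blast
    have inv: "the_inv_into {0..<card B} v (v j) = j" if "j < card B" for j
      using v that by (simp add: bij_betw_def the_inv_into_f_f)
    have "x = (\<Sum>b\<in>B. of_int ((c \<circ> the_inv_into {0..<card B} v) b) *\<^sub>R b)"
      using sum.reindex_bij_betw[OF v, of "\<lambda>b. of_int ((c \<circ> the_inv_into {0..<card B} v) b) *\<^sub>R b"] inv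
      by (simp add: c flip: card) (simp add: atLeast0LessThan)
    then show "x \<in> par_lattice \<sigma>" unfolding B(3) by blast
  qed
  then have "lattice_basis \<sigma> v"
    using v B(2) by (auto simp: lattice_basis_def card atLeast0LessThan bij_betw_def)
  then show ?thesis by blast
qed

section \<open>Local structure of rational polyhedra\<close>

lemma ZR_polyhedronE:
  assumes "ZR_polyhedron P"
  obtains H :: "('n::finite rvec \<times> real) set" where "finite H" "fst ` H \<subseteq> int_vecs"
    "P = {x. \<forall>(m, c)\<in>H. 0 \<le> m \<bullet> x + c}"
proof -
  obtain H :: "((int^'n) \<times> real) set" where H: "finite H"
    "P = {x. \<forall>(m, c)\<in>H. 0 \<le> (\<Sum>i\<in>UNIV. of_int (m $ i) * x $ i) + c}"
    using assms by (auto simp: ZR_polyhedron_def)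
  let ?r = "\<lambda>(m, c). ((\<chi> i. of_int (m $ i)) :: 'n rvec, c :: real)"
  have "P = {x. \<forall>(m, c)\<in>?r ` H. 0 \<le> m \<bullet> x + c}"
    using H(2) by (auto simp: inner_vec_def split_beta)
  moreover have "fst ` ?r ` H \<subseteq> int_vecs" by (auto simp: int_vecs_def)
  ultimately show ?thesis using that H(1) by blast
qed

lemma closed_halfspaces: "closed {x :: 'a::euclidean_space. \<forall>(m, c)\<in>H. 0 \<le> m \<bullet> x + c}"
proof -
  have "{x. \<forall>(m, c)\<in>H. 0 \<le> m \<bullet> x + c} = (\<Inter>(m, c)\<in>H. {x :: 'a. 0 \<le> m \<bullet> x + c})" by auto
  then show ?thesis by (auto intro!: closed_INT closed_Collect_le continuous_intros)
qed

lemma open_halfspaces: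
  assumes "finite H"
  shows "open {x :: 'a::euclidean_space. \<forall>(m, c)\<in>H. 0 < m \<bullet> x + c}"
proof -
  have "{x. \<forall>(m, c)\<in>H. 0 < m \<bullet> x + c} = (\<Inter>(m, c)\<in>H. {x :: 'a. 0 < m \<bullet> x + c})" by auto
  then show ?thesis using assms by (auto intro!: open_INT open_Collect_less continuous_intros)
qed

lemma closed_ZR_polyhedron: "ZR_polyhedron P \<Longrightarrow> closed P"
  by (erule ZR_polyhedronE) (simp add: closed_halfspaces)

text \<open>A constraint that is an equality at \<open>w\<close> is homogeneous around
  \<open>w\<close> and survives scaling by any \<open>t > 0\<close>; the finitely many others are
  strict at \<open>w\<close> and stay strict in a ball.\<close>

lemma ZR_polyhedron_cone:
  fixes P :: "'n::finite rvec set"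
  assumes "ZR_polyhedron P" "w \<in> P"
  shows "\<exists>r>0. \<forall>x\<in>P. \<forall>t>0. t * norm (x - w) < r \<longrightarrow> w + t *\<^sub>R (x - w) \<in> P"
proof -
  obtain H where H: "finite H" "P = {x. \<forall>(m, c)\<in>H. 0 \<le> m \<bullet> x + c}"
    using assms(1) by (rule ZR_polyhedronE)
  define N where "N = {(m, c) \<in> H. 0 < m \<bullet> w + c}"
  have "finite N" using H(1) by (rule rev_finite_subset) (auto simp: N_def)
  then have "open {x. \<forall>(m, c)\<in>N. 0 < m \<bullet> x + c}" by (rule open_halfspaces)
  moreover have "w \<in> {x. \<forall>(m, c)\<in>N. 0 < m \<bullet> x + c}" by (auto simp: N_def)
  ultimately obtain r where r: "r > 0" "ball w r \<subseteq> {x. \<forall>(m, c)\<in>N. 0 < m \<bullet> x + c}"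
    using open_contains_ball by blast
  have "w + t *\<^sub>R (x - w) \<in> P" if x: "x \<in> P" and t: "t > 0" "t * norm (x - w) < r" for x t
  proof -
    have "0 \<le> m \<bullet> (w + t *\<^sub>R (x - w)) + c" if "(m, c) \<in> H" for m c
    proof (cases "(m, c) \<in> N")
      case True
      have "w + t *\<^sub>R (x - w) \<in> ball w r" using t by (simp add: dist_norm)
      with r(2) True show ?thesis by fastforce
    next
      case False
      have "m \<bullet> w + c = 0" using False that assms(2) H(2) by (force simp: N_def)
      then have c: "c = - (m \<bullet> w)" by linarith
      have "0 \<le> m \<bullet> x + c" using x that H(2) by auto
      moreover have "m \<bullet> (w + t *\<^sub>R (x - w)) + c = t * (m \<bullet> x + c)"
        by (simp add: inner_add_right inner_diff_right c algebra_simps)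
      ultimately show ?thesis using t by simp
    qed
    then show ?thesis using H(2) by auto
  qed
  then show ?thesis using r(1) by blast
qed

text \<open>\<open>M\<close> consists of the normals of the constraints that are equalities on all
  of \<open>P\<close>. A point \<open>x0\<close> of \<open>P\<close> satisfies all other constraints
  strictly; moving slightly from \<open>x\<close> towards \<open>x0\<close> gives a point
  \<open>x1\<close> that can be displaced freely along the common kernel of \<open>M\<close>. This
  identifies the kernel with the parallel space and yields relative interior points near every
  \<open>x\<close>.\<close>

lemma ZR_polyhedron_par_space:
  fixes P U :: "'n::finite rvec set"
  assumes "ZR_polyhedron P" "open U" "P \<inter> U \<noteq> {}"
  obtains M where "finite M" "M \<subseteq> int_vecs" "par_space (P \<inter> U) = {z. \<forall>m\<in>M. m \<bullet> z = 0}"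
    "\<And>x \<rho>. x \<in> P \<inter> U \<Longrightarrow> 0 < \<rho> \<Longrightarrow> \<exists>x1. \<exists>\<epsilon>>0. \<forall>z\<in>par_space (P \<inter> U). norm z < \<epsilon> \<longrightarrow>
       x1 + z \<in> P \<inter> U \<and> dist (x1 + z) x < \<rho>"
proof -
  obtain H where H: "finite H" "fst ` H \<subseteq> int_vecs" "P = {x. \<forall>(m, c)\<in>H. 0 \<le> m \<bullet> x + c}"
    using assms(1) by (rule ZR_polyhedronE)
  define T where "T = {(m, c) \<in> H. \<forall>x\<in>P. m \<bullet> x + c = 0}"
  define N where "N = H - T"
  have fin: "finite T" "finite N" using H(1) by (auto simp: N_def T_def intro: rev_finite_subset)
  have "\<exists>x\<in>P. \<forall>(m, c)\<in>N'. 0 < m \<bullet> x + c" if "finite N'" "N' \<subseteq> N" for N'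
    using that
  proof induction
    case empty
    then show ?case using assms(3) by auto
  next
    case (insert h N')
    then obtain x where x: "x \<in> P" "\<forall>(m, c)\<in>N'. 0 < m \<bullet> x + c" by auto
    obtain m c where h: "h = (m, c)" by (cases h)
    then obtain y where "y \<in> P" "m \<bullet> y + c \<noteq> 0" "(m, c) \<in> H"
      using insert.prems by (auto simp: N_def T_def)
    then have y: "y \<in> P" "0 < m \<bullet> y + c" using H(3) by force+
    \<comment> \<open>At a midpoint a constraint is strict as soon as it is strict at one of the two
      ends.\<close>
    let ?z = "(1/2) *\<^sub>R x + (1/2) *\<^sub>R y"
    have v: "n \<bullet> ?z + e = (n \<bullet> x + e) / 2 + (n \<bullet> y + e) / 2" for n e
      by (simp add: inner_add_right field_simps)
    have nn: "0 \<le> n \<bullet> x + e" "0 \<le> n \<bullet> y + e" if "(n, e) \<in> H" for n e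
      using that x(1) y(1) H(3) by auto
    have "?z \<in> P" unfolding H(3) using nn v by fastforce
    moreover have "0 < n \<bullet> ?z + e" if "(n, e) \<in> insert h N'" for n e
    proof -
      have "(n, e) \<in> H" using that insert.prems by (auto simp: N_def)
      note nn[OF this]
      moreover have "0 < n \<bullet> x + e \<or> 0 < n \<bullet> y + e" using that x(2) y(2) h by auto
      ultimately show ?thesis unfolding v by (auto intro: add_pos_nonneg add_nonneg_pos)
    qed
    ultimately show ?case by blast
  qed
  from this[OF fin(2)] obtain x0 where x0: "x0 \<in> P" "\<forall>(m, c)\<in>N. 0 < m \<bullet> x0 + c" by auto
  define M where "M = fst ` T"
  let ?L = "{z. \<forall>m\<in>M. m \<bullet> z = 0}"
  have near: "\<exists>x1. \<exists>\<epsilon>>0. \<forall>z\<in>?L. norm z < \<epsilon> \<longrightarrow> x1 + z \<in> P \<inter> U \<and> dist (x1 + z) x < \<rho>"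
    if x: "x \<in> P \<inter> U" and \<rho>: "0 < \<rho>" for x \<rho>
  proof -
    have oW: "open (U \<inter> ball x \<rho>)" using assms(2) by auto
    moreover have "x \<in> U \<inter> ball x \<rho>" using x \<rho> by auto
    ultimately obtain e where e: "e > 0" "ball x e \<subseteq> U \<inter> ball x \<rho>"
      using open_contains_ball by blast
    \<comment> \<open>Small enough to keep \<open>x1\<close> within distance \<open>e\<close> of
      \<open>x\<close>, and at most 1 so that \<open>x1\<close> lies on the segment to
      \<open>x0\<close>.\<close>
    define s where "s = min 1 (e / (2 * (norm (x0 - x) + 1)))"
    have s: "0 < s" "s \<le> 1" using e(1) by (auto simp: s_def add_nonneg_pos)
    define x1 where "x1 = x + s *\<^sub>R (x0 - x)"
    have "s * norm (x0 - x) \<le> e / (2 * (norm (x0 - x) + 1)) * norm (x0 - x)"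
      by (intro mult_right_mono) (auto simp: s_def)
    also have "\<dots> < e"
      using e(1) by (simp add: divide_less_eq add_nonneg_pos)
    finally have "x1 \<in> ball x e" using s by (simp add: x1_def dist_norm)
    then have x1W: "x1 \<in> U \<inter> ball x \<rho>" using e by blast
    have v: "m \<bullet> x1 + c = (1 - s) * (m \<bullet> x + c) + s * (m \<bullet> x0 + c)" for m c
      by (simp add: x1_def inner_add_right inner_diff_right algebra_simps)
    have xP: "0 \<le> m \<bullet> x + c" if "(m, c) \<in> H" for m c using that x H(3) by auto
    have pos: "0 < m \<bullet> x1 + c" if "(m, c) \<in> N" for m c
    proof -
      have "0 < m \<bullet> x0 + c" "0 \<le> m \<bullet> x + c" using that x0(2) xP by (auto simp: N_def)
      then show ?thesis unfolding v using s by (intro add_nonneg_pos) auto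
    qed
    have tight: "m \<bullet> x1 + c = 0" if "(m, c) \<in> T" for m c
      unfolding v using that x x0(1) by (auto simp: T_def)
    have "open ((U \<inter> ball x \<rho>) \<inter> {y. \<forall>(m, c)\<in>N. 0 < m \<bullet> y + c})"
      by (intro open_Int oW open_halfspaces fin)
    moreover have "x1 \<in> (U \<inter> ball x \<rho>) \<inter> {y. \<forall>(m, c)\<in>N. 0 < m \<bullet> y + c}"
      using x1W pos by auto
    ultimately obtain \<epsilon> where \<epsilon>: "\<epsilon> > 0"
      "ball x1 \<epsilon> \<subseteq> (U \<inter> ball x \<rho>) \<inter> {y. \<forall>(m, c)\<in>N. 0 < m \<bullet> y + c}"
      by (rule openE)
    have "x1 + z \<in> P \<inter> U \<and> dist (x1 + z) x < \<rho>" if z: "z \<in> ?L" "norm z < \<epsilon>" for z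
    proof -
      have "x1 + z \<in> ball x1 \<epsilon>" using z by (simp add: dist_norm)
      then have in1: "x1 + z \<in> U \<inter> ball x \<rho>" "\<forall>(m, c)\<in>N. 0 < m \<bullet> (x1 + z) + c"
        using \<epsilon>(2) by auto
      have "0 \<le> m \<bullet> (x1 + z) + c" if h: "(m, c) \<in> H" for m c
      proof (cases "(m, c) \<in> T")
        case True
        then have "m \<bullet> z = 0" using z(1) by (force simp: M_def)
        then show ?thesis using tight[OF True] by (simp add: inner_add_right)
      next
        case False
        then have "(m, c) \<in> N" using h by (simp add: N_def)
        with in1(2) have "0 < m \<bullet> (x1 + z) + c" by auto
        then show ?thesis by (rule less_imp_le)
      qed
      then show ?thesis using in1(1) H(3) by (auto simp: dist_commute)
    qed
    then show ?thesis using \<epsilon>(1) by blast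
  qed
  have "par_space (P \<inter> U) = ?L"
  proof
    have "subspace ?L" by (auto simp: subspace_def inner_add_right)
    moreover have "m \<bullet> (y - x) = 0" if m: "m \<in> M" "x \<in> P" "y \<in> P" for m x y
    proof -
      obtain c where "(m, c) \<in> T" using m(1) by (force simp: M_def)
      then have "m \<bullet> x + c = 0" "m \<bullet> y + c = 0" using m by (auto simp: T_def)
      then show ?thesis by (simp add: inner_diff_right)
    qed
    ultimately show "par_space (P \<inter> U) \<subseteq> ?L"
      unfolding par_space_def by (intro span_minimal) auto
    show "?L \<subseteq> par_space (P \<inter> U)"
    proof
      fix z assume z: "z \<in> ?L"
      obtain x where "x \<in> P \<inter> U" using assms(3) by blast
      from near[OF this, of 1] obtain x1 \<epsilon> where \<epsilon>: "\<epsilon> > 0"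
        "\<And>z. z \<in> ?L \<Longrightarrow> norm z < \<epsilon> \<Longrightarrow> x1 + z \<in> P \<inter> U" by auto
      define s where "s = \<epsilon> / (2 * (norm z + 1))"
      have s: "s > 0" using \<epsilon>(1) by (auto simp: s_def add_nonneg_pos)
      have "s * norm z < \<epsilon>"
        using \<epsilon>(1) unfolding s_def by (simp add: divide_less_eq add_nonneg_pos)
      then have "x1 + s *\<^sub>R z \<in> P \<inter> U" using z s by (intro \<epsilon>(2)) auto
      moreover have "x1 + 0 \<in> P \<inter> U" using \<epsilon>(1) by (intro \<epsilon>(2)) auto
      ultimately have "(x1 + s *\<^sub>R z) - (x1 + 0) \<in> {y - x | x y. x \<in> P \<inter> U \<and> y \<in> P \<inter> U}" by blast
      then have "s *\<^sub>R z \<in> par_space (P \<inter> U)" unfolding par_space_def by (intro span_base) simp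
      then have "(1 / s) *\<^sub>R (s *\<^sub>R z) \<in> par_space (P \<inter> U)"
        unfolding par_space_def by (rule span_scale)
      then show "z \<in> par_space (P \<inter> U)" using s by simp
    qed
  qed
  moreover have "M \<subseteq> int_vecs" "finite M" using H(2) fin by (auto simp: M_def T_def)
  ultimately show ?thesis using that near by simp
qed

lemma dim_par_space:
  assumes "aff_dim \<sigma> = int d" "\<sigma> \<noteq> {}"
  shows "dim (par_space \<sigma>) = d"
proof -
  obtain a where a: "a \<in> \<sigma>" using assms by blast
  have "span {y - x | x y. x \<in> \<sigma> \<and> y \<in> \<sigma>} = span ((\<lambda>x. - a + x) ` \<sigma>)"
  proof (rule span_eq[THEN iffD2], intro conjI subsetI)
    fix z assume "z \<in> {y - x | x y. x \<in> \<sigma> \<and> y \<in> \<sigma>}"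
    then obtain x y where xy: "x \<in> \<sigma>" "y \<in> \<sigma>" "z = (- a + y) - (- a + x)" by auto
    show "z \<in> span ((\<lambda>x. - a + x) ` \<sigma>)"
      unfolding xy(3) using xy by (intro span_diff span_base) auto
  next
    fix z assume "z \<in> (\<lambda>x. - a + x) ` \<sigma>"
    then obtain y where "y \<in> \<sigma>" "z = y - a" by auto
    then show "z \<in> span {y - x | x y. x \<in> \<sigma> \<and> y \<in> \<sigma>}" using a by (intro span_base) auto
  qed
  moreover have "aff_dim \<sigma> = int (dim ((\<lambda>x. - a + x) ` \<sigma>))"
    using a by (intro aff_dim_eq_dim hull_inc)
  ultimately show ?thesis using assms(1) unfolding par_space_def by (metis dim_span of_nat_eq_iff)
qed

section \<open>Integration over cones\<close>

lemma emeasure_lborel_affine_vimage: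
  fixes l t :: real
  assumes "0 < l" "A \<in> sets borel"
  shows "ennreal l * emeasure lborel ((\<lambda>x. t + l * x) -` A) = emeasure lborel A"
proof -
  have "emeasure lborel A = emeasure (density (distr lborel borel (\<lambda>x. t + l * x)) (\<lambda>_. ennreal \<bar>l\<bar>)) A"
    using lborel_real_affine[of l t] assms(1) by simp
  also have "\<dots> = ennreal l * emeasure lborel ((\<lambda>x. t + l * x) -` A)"
    using assms by (subst emeasure_density_const) (simp_all add: emeasure_distr)
  finally show ?thesis ..
qed

text \<open>The restriction to \<open>{..<k}\<close> keeps the result in the product space, whose
  points are undefined outside the index set.\<close>

definition affine_PiM :: "nat \<Rightarrow> real \<Rightarrow> (nat \<Rightarrow> real) \<Rightarrow> (nat \<Rightarrow> real) \<Rightarrow> nat \<Rightarrow> real" where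
  "affine_PiM k l t y = (\<lambda>i\<in>{..<k}. t i + l * y i)"

interpretation lborel_product: product_sigma_finite "\<lambda>_::nat. lborel :: real measure" ..

lemma measurable_affine_PiM [measurable]:
  "affine_PiM k l t \<in> PiM {..<k} (\<lambda>_. lborel) \<rightarrow>\<^sub>M PiM {..<k} (\<lambda>_. lborel)"
  unfolding affine_PiM_def by (intro measurable_restrict) measurable

text \<open>Values on boxes determine the product measure, and each of the \<open>k\<close> sides of
  a box contributes one factor \<open>l\<close>.\<close>

lemma PiM_lborel_affine:
  assumes l: "0 < l"
  shows "PiM {..<k} (\<lambda>_. lborel) =
    density (distr (PiM {..<k} (\<lambda>_. lborel)) (PiM {..<k} (\<lambda>_. lborel)) (affine_PiM k l t))
      (\<lambda>_. ennreal (l ^ k))" (is "?M = ?D")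
proof (rule sym, rule lborel_product.PiM_eqI)
  fix A :: "nat \<Rightarrow> real set" assume A: "\<And>i. i \<in> {..<k} \<Longrightarrow> A i \<in> sets lborel"
  have box: "Pi\<^sub>E {..<k} A \<in> sets ?M" using A by (intro sets_PiM_I_finite) auto
  have vim: "affine_PiM k l t -` Pi\<^sub>E {..<k} A \<inter> space ?M =
      Pi\<^sub>E {..<k} (\<lambda>i. (\<lambda>x. t i + l * x) -` A i)"
    by (auto simp: affine_PiM_def space_PiM PiE_iff)
  have meas: "(\<lambda>x. t i + l * x) -` A i \<in> sets lborel" if "i < k" for i
  proof -
    have "(\<lambda>x. t i + l * x) \<in> borel_measurable borel" by measurable
    then have "(\<lambda>x. t i + l * x) -` A i \<inter> space borel \<in> sets borel"
      using A that by (intro measurable_sets[of _ borel borel]) auto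
    then show ?thesis by simp
  qed
  have "emeasure ?D (Pi\<^sub>E {..<k} A) = ennreal (l ^ k) * emeasure ?M (affine_PiM k l t -` Pi\<^sub>E {..<k} A \<inter> space ?M)"
    using box by (subst emeasure_density_const) (simp_all add: emeasure_distr)
  also have "\<dots> = ennreal (l ^ k) * (\<Prod>i<k. emeasure lborel ((\<lambda>x. t i + l * x) -` A i))"
    unfolding vim using meas by (subst lborel_product.emeasure_PiM) auto
  also have "\<dots> = (\<Prod>i<k. ennreal l * emeasure lborel ((\<lambda>x. t i + l * x) -` A i))"
    using l by (simp add: prod.distrib ennreal_power)
  also have "\<dots> = (\<Prod>i<k. emeasure lborel (A i))"
    using A by (intro prod.cong refl emeasure_lborel_affine_vimage l) auto
  finally show "emeasure ?D (Pi\<^sub>E {..<k} A) = (\<Prod>i\<in>{..<k}. emeasure lborel (A i))" .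
qed auto

lemma integral_PiM_lborel_affine:
  fixes G :: "(nat \<Rightarrow> real) \<Rightarrow> real"
  assumes l: "0 < l" and G[measurable]: "G \<in> borel_measurable (PiM {..<k} (\<lambda>_. lborel))"
  shows "integral\<^sup>L (PiM {..<k} (\<lambda>_. lborel)) G =
    l ^ k * integral\<^sup>L (PiM {..<k} (\<lambda>_. lborel)) (\<lambda>y. G (affine_PiM k l t y))"
proof -
  let ?M = "PiM {..<k} (\<lambda>_::nat. lborel :: real measure)"
  have "integral\<^sup>L ?M G = integral\<^sup>L (density (distr ?M ?M (affine_PiM k l t)) (\<lambda>_. ennreal (l ^ k))) G"
    by (rule arg_cong[where f = "\<lambda>N. integral\<^sup>L N G", OF PiM_lborel_affine[OF l]])
  also have "\<dots> = integral\<^sup>L (distr ?M ?M (affine_PiM k l t)) (\<lambda>y. l ^ k *\<^sub>R G y)"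
    using l by (intro integral_density) auto
  also have "\<dots> = integral\<^sup>L ?M (\<lambda>y. l ^ k *\<^sub>R G (affine_PiM k l t y))"
    by (rule integral_distr) measurable
  finally show ?thesis by simp
qed

text \<open>A face near the maximum \<open>w\<close>, seen through an affine chart with origin
  \<open>c\<close> in which \<open>w\<close> has the coordinates \<open>y0\<close>. Being a cone
  with apex \<open>w\<close> is demanded only up to radius \<open>R\<close>, since a face is a
  polyhedron only within \<open>U\<close>.\<close>

locale cone_chart =
  fixes k :: nat and v :: "nat \<Rightarrow> 'a::euclidean_space" and c :: 'a and y0 :: "nat \<Rightarrow> real"
    and \<sigma> :: "'a set" and w :: 'a and R :: real
  assumes inj: "inj_on v {..<k}" and indep: "independent (v ` {..<k})"
    and apex: "w = c + (\<Sum>j<k. y0 j *\<^sub>R v j)" and apex_mem: "w \<in> \<sigma>"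
    and R: "0 < R" and closed_cap: "closed (\<sigma> \<inter> cball w R)"
    and cone: "x \<in> \<sigma> \<Longrightarrow> norm (x - w) \<le> R \<Longrightarrow> 0 < t \<Longrightarrow> t * norm (x - w) \<le> R \<Longrightarrow> w + t *\<^sub>R (x - w) \<in> \<sigma>"
begin

definition chart :: "(nat \<Rightarrow> real) \<Rightarrow> 'a" where
  "chart y = c + (\<Sum>j<k. y j *\<^sub>R v j)"

abbreviation "chart_measure \<equiv> PiM {..<k} (\<lambda>_::nat. lborel :: real measure)"

definition cap :: "'a set" where "cap = \<sigma> \<inter> cball w R"

definition cap_integral :: "('a \<Rightarrow> real) \<Rightarrow> real" where
  "cap_integral G = (\<integral>y. indicator cap (chart y) * G (chart y) \<partial>chart_measure)"

lemma measurable_chart [measurable]: "chart \<in> chart_measure \<rightarrow>\<^sub>M borel"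
  unfolding chart_def by (intro borel_measurable_add borel_measurable_sum borel_measurable_scaleR)
    (auto intro: measurable_component_singleton[of _ "{..<k}" "\<lambda>_. lborel", simplified])

lemma chart_diff: "chart y - chart z = (\<Sum>j<k. (y j - z j) *\<^sub>R v j)"
  by (simp add: chart_def scaleR_diff_left sum_subtractf)

lemma chart_y0: "chart y0 = w"
  by (simp add: chart_def apex)

text \<open>The coordinates are values of linear functionals dual to the \<open>v j\<close>, hence
  bounded by the distance in the ambient space. So the part of the chart that maps into the cap fits
  into a box of finite measure.\<close>

lemma coordinate_bound: "\<exists>C. \<forall>i<k. \<forall>y. \<bar>y i - y0 i\<bar> \<le> C * norm (chart y - w)"
proof -
  have "\<exists>C>0. \<forall>y. \<bar>y i - y0 i\<bar> \<le> C * norm (chart y - w)" if i: "i < k" for i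
  proof -
    obtain g :: "'a \<Rightarrow> real" where g: "linear g" "\<forall>x\<in>v ` {..<k}. g x = (if x = v i then 1 else 0)"
      using linear_independent_extend[OF indep, of "\<lambda>x. if x = v i then 1 else 0"] by blast
    have gv: "g (v j) = (if j = i then 1 else 0)" if "j < k" for j
      using g(2) inj i that by (auto simp: inj_on_def)
    have gc: "g (chart y - w) = y i - y0 i" for y
    proof -
      have "g (chart y - w) = (\<Sum>j<k. (y j - y0 j) * g (v j))"
        unfolding chart_y0[symmetric] chart_diff using g(1)
        by (simp add: linear_sum linear_cmul)
      also have "\<dots> = (\<Sum>j<k. if j = i then y i - y0 i else 0)"
        by (intro sum.cong) (auto simp: gv)
      finally show ?thesis using i by simp
    qed
    obtain C where C: "C > 0" "\<And>x. norm (g x) \<le> C * norm x"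
      using linear_bounded_pos[OF g(1)] by blast
    have "\<bar>y i - y0 i\<bar> \<le> C * norm (chart y - w)" for y
      using C(2)[of "chart y - w"] by (simp add: gc)
    with C(1) show ?thesis by blast
  qed
  then have "\<forall>i. \<exists>C. i < k \<longrightarrow> C > 0 \<and> (\<forall>y. \<bar>y i - y0 i\<bar> \<le> C * norm (chart y - w))"
    by blast
  from choice[OF this] obtain C where
    C: "\<And>i. i < k \<Longrightarrow> C i > 0 \<and> (\<forall>y. \<bar>y i - y0 i\<bar> \<le> C i * norm (chart y - w))"
    by blast
  have "\<bar>y i - y0 i\<bar> \<le> (\<Sum>i<k. C i) * norm (chart y - w)" if i: "i < k" for i y
  proof -
    have "C i \<le> (\<Sum>i<k. C i)" using i C by (intro member_le_sum) (auto intro: less_imp_le)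
    then have "C i * norm (chart y - w) \<le> (\<Sum>i<k. C i) * norm (chart y - w)"
      by (rule mult_right_mono) simp
    then show ?thesis using C[OF i] by (meson order.trans)
  qed
  then show ?thesis by blast
qed

lemma compact_cap: "compact cap"
  using closed_cap by (auto simp: cap_def compact_eq_bounded_closed intro: bounded_Int)

lemma borel_cap [measurable]: "cap \<in> sets borel"
  using compact_cap by (simp add: borel_closed compact_imp_closed)

lemma measurable_cap_integrand:
  fixes G :: "'a \<Rightarrow> real"
  assumes "continuous_on cap G"
  shows "(\<lambda>y. indicator cap (chart y) * G (chart y)) \<in> borel_measurable chart_measure"
proof -
  have "(\<lambda>x. indicator cap x *\<^sub>R G x) \<in> borel_measurable borel"
    by (rule borel_measurable_continuous_on_indicator[OF borel_cap assms])
  from measurable_compose[OF measurable_chart this] show ?thesis by simp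
qed

lemma integrable_cap:
  fixes G :: "'a \<Rightarrow> real"
  assumes "continuous_on cap G"
  shows "integrable chart_measure (\<lambda>y. indicator cap (chart y) * G (chart y))"
proof -
  obtain C where C: "\<And>i y. i < k \<Longrightarrow> \<bar>y i - y0 i\<bar> \<le> C * norm (chart y - w)"
    using coordinate_bound by blast
  let ?B = "Pi\<^sub>E {..<k} (\<lambda>i. {y0 i - \<bar>C\<bar> * R .. y0 i + \<bar>C\<bar> * R})"
  obtain D where D: "\<And>x. x \<in> cap \<Longrightarrow> norm (G x) \<le> D"
    using compact_imp_bounded[OF compact_continuous_image[OF assms compact_cap]]
    by (auto simp: bounded_iff)
  have inB: "y \<in> ?B" if y: "y \<in> space chart_measure" "chart y \<in> cap" for y
  proof -
    have "\<bar>y i - y0 i\<bar> \<le> \<bar>C\<bar> * R" if "i < k" for i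
    proof -
      have "C * norm (chart y - w) \<le> \<bar>C\<bar> * R"
        using y(2) by (intro mult_mono) (auto simp: cap_def dist_norm norm_minus_commute)
      then show ?thesis using C[OF that, of y] by linarith
    qed
    then show ?thesis using y(1) by (force simp: space_PiM PiE_iff abs_le_iff)
  qed
  have "emeasure chart_measure ?B = (\<Prod>i<k. emeasure lborel {y0 i - \<bar>C\<bar> * R .. y0 i + \<bar>C\<bar> * R})"
    by (rule lborel_product.emeasure_PiM) auto
  also have "\<dots> < \<infinity>" using R by (simp add: ennreal_power)
  finally have fin: "emeasure chart_measure ?B < \<infinity>" .
  show ?thesis
  proof (rule integrableI_bounded_set[of ?B _ _ "\<bar>D\<bar>", OF _ measurable_cap_integrand[OF assms] fin])
    show "?B \<in> sets chart_measure" by (intro sets_PiM_I_finite) auto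
    show "AE y in chart_measure. y \<in> ?B \<longrightarrow> norm (indicator cap (chart y) * G (chart y)) \<le> \<bar>D\<bar>"
      using D by (intro AE_I2) (force simp: indicator_def)
    show "AE y in chart_measure. y \<notin> ?B \<longrightarrow> indicator cap (chart y) * G (chart y) = 0"
      using inB by (intro AE_I2) (auto simp: indicator_def)
  qed
qed

lemma cap_integral_add:
  "continuous_on cap G \<Longrightarrow> continuous_on cap G' \<Longrightarrow>
    cap_integral (\<lambda>x. G x + G' x) = cap_integral G + cap_integral G'"
  unfolding cap_integral_def using Bochner_Integration.integral_add[OF integrable_cap integrable_cap]
  by (simp add: distrib_left)

lemma cap_integral_cmult: "cap_integral (\<lambda>x. r * G x) = r * cap_integral G"
  unfolding cap_integral_def by (simp add: mult.left_commute)

lemma cap_integral_mono: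
  "continuous_on cap G \<Longrightarrow> continuous_on cap G' \<Longrightarrow> (\<And>x. x \<in> cap \<Longrightarrow> G x \<le> G' x) \<Longrightarrow>
    cap_integral G \<le> cap_integral G'"
  unfolding cap_integral_def
  by (intro integral_mono integrable_cap) (auto simp: indicator_def)

text \<open>Change of variables along the dilation with centre \<open>w\<close>. The cone property
  for the factors \<open>l\<close> and \<open>1 / l\<close> makes membership in the face invariant,
  and \<open>G\<close> vanishes at points that the dilation carries out of the ball.\<close>

lemma cap_integral_scale:
  assumes l: "1 \<le> l" and cont: "continuous_on cap G"
    and G0: "\<And>x. R < norm (x - w) \<Longrightarrow> G x = 0"
  shows "cap_integral (\<lambda>x. l ^ k * G (w + l *\<^sub>R (x - w))) = cap_integral G"
proof -
  \<comment> \<open>The translation part is chosen so that \<open>?T\<close> fixes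
    \<open>y0\<close>, the coordinates of the apex.\<close>
  let ?T = "affine_PiM k l (\<lambda>i. (1 - l) * y0 i)"
  have chart_T: "chart (?T y) = w + l *\<^sub>R (chart y - w)" for y
  proof -
    have "chart (?T y) - w = (\<Sum>j<k. (?T y j - y0 j) *\<^sub>R v j)"
      unfolding chart_y0[symmetric] chart_diff ..
    also have "\<dots> = (\<Sum>j<k. l *\<^sub>R ((y j - y0 j) *\<^sub>R v j))"
      by (intro sum.cong refl) (simp add: affine_PiM_def algebra_simps flip: scaleR_add_left scaleR_diff_left)
    also have "\<dots> = l *\<^sub>R (chart y - w)"
      unfolding chart_y0[symmetric] chart_diff by (simp add: scaleR_right.sum)
    finally show ?thesis by (simp add: algebra_simps)
  qed
  have eq: "indicator cap (w + l *\<^sub>R (x - w)) * G (w + l *\<^sub>R (x - w)) =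
      indicator cap x * G (w + l *\<^sub>R (x - w))" for x
  proof (cases "l * norm (x - w) \<le> R")
    case True
    have "norm (x - w) \<le> l * norm (x - w)" using l by (simp add: mult_le_cancel_right1)
    then have le: "norm (x - w) \<le> R" using True by simp
    have "x \<in> \<sigma>" if "w + l *\<^sub>R (x - w) \<in> \<sigma>"
      using cone[OF that, of "1 / l"] l True le by simp
    moreover have "w + l *\<^sub>R (x - w) \<in> \<sigma>" if "x \<in> \<sigma>"
      using cone[OF that le, of l] l True by simp
    ultimately show ?thesis
      using True le l by (auto simp: cap_def indicator_def dist_norm norm_minus_commute)
  next
    case False
    then show ?thesis using G0[of "w + l *\<^sub>R (x - w)"] l by simp
  qed
  have "cap_integral G = l ^ k * (\<integral>y. indicator cap (chart (?T y)) * G (chart (?T y)) \<partial>chart_measure)"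
    unfolding cap_integral_def
    using integral_PiM_lborel_affine[OF _ measurable_cap_integrand[OF cont], of l "\<lambda>i. (1 - l) * y0 i"] l
    by simp
  also have "\<dots> = cap_integral (\<lambda>x. l ^ k * G (w + l *\<^sub>R (x - w)))"
    unfolding chart_T eq cap_integral_cmult by (simp add: cap_integral_def)
  finally show ?thesis ..
qed

text \<open>If \<open>G x0\<close> were positive, \<open>G\<close> would be positive on a relatively
  open piece of the face near \<open>x0\<close>, and this piece contains the image of a box of
  positive measure. The piece is centred at \<open>x1\<close> because \<open>x0\<close> itself may
  lie on the relative boundary.\<close>

lemma cap_integral_eq_0D:
  assumes cont: "continuous_on cap G" and nonneg: "\<And>x. x \<in> cap \<Longrightarrow> 0 \<le> G x"
    and zero: "cap_integral G = 0"
    and x0: "x0 \<in> \<sigma>" "norm (x0 - w) < R"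
    and near: "\<And>\<rho>. 0 < \<rho> \<Longrightarrow> \<exists>x1. \<exists>\<epsilon>>0. \<forall>z\<in>span (v ` {..<k}). norm z < \<epsilon> \<longrightarrow>
       x1 + z \<in> \<sigma> \<and> dist (x1 + z) x0 < \<rho>"
    and sub: "\<And>x. x \<in> \<sigma> \<Longrightarrow> x - w \<in> span (v ` {..<k})"
  shows "G x0 = 0"
proof (rule ccontr)
  assume "G x0 \<noteq> 0"
  have x0cap: "x0 \<in> cap" using x0 by (auto simp: cap_def dist_norm norm_minus_commute)
  then have pos: "0 < G x0" using nonneg \<open>G x0 \<noteq> 0\<close> by force
  obtain \<delta> where \<delta>: "\<delta> > 0" "\<And>x. x \<in> cap \<Longrightarrow> dist x x0 < \<delta> \<Longrightarrow> dist (G x) (G x0) < G x0"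
    using cont x0cap pos unfolding continuous_on_iff by meson
  \<comment> \<open>Within distance \<open>\<rho>\<close> of \<open>x0\<close>, points of the face
    stay in the cap and \<open>G\<close> stays positive.\<close>
  define \<rho> where "\<rho> = min \<delta> (R - norm (x0 - w))"
  have \<rho>: "\<rho> > 0" using \<delta>(1) x0(2) by (simp add: \<rho>_def)
  from near[OF this] obtain x1 \<epsilon> where \<epsilon>: "\<epsilon> > 0"
    and x1: "\<And>z. z \<in> span (v ` {..<k}) \<Longrightarrow> norm z < \<epsilon> \<Longrightarrow> x1 + z \<in> \<sigma> \<and> dist (x1 + z) x0 < \<rho>"
    by blast
  have Gpos: "x1 + z \<in> cap \<and> 0 < G (x1 + z)" if z: "z \<in> span (v ` {..<k})" "norm z < \<epsilon>" for z
  proof -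
    note d = x1[OF z]
    have "dist (x1 + z) w \<le> dist (x1 + z) x0 + dist x0 w" by (rule dist_triangle)
    also have "\<dots> < R" using d by (simp add: \<rho>_def dist_norm)
    finally have "x1 + z \<in> cap" using d by (auto simp: cap_def dist_commute)
    moreover from this have "dist (G (x1 + z)) (G x0) < G x0"
      using d by (intro \<delta>(2)) (auto simp: \<rho>_def)
    ultimately show ?thesis by (auto simp: dist_real_def)
  qed
  have "x1 \<in> \<sigma>" using x1[of 0] \<epsilon> by (simp add: span_zero)
  then have "x1 - w \<in> span (v ` {..<k})" by (rule sub)
  then obtain u where "x1 - w = (\<Sum>x\<in>v ` {..<k}. u x *\<^sub>R x)"
    by (auto simp: span_finite)
  then have u: "x1 - w = (\<Sum>j<k. u (v j) *\<^sub>R v j)"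
    using inj by (simp add: sum.reindex)
  define y1 where "y1 j = y0 j + u (v j)" for j
  have chart1: "chart y1 = x1"
  proof -
    have "chart y1 - chart y0 = x1 - w"
      unfolding u chart_diff by (simp add: y1_def)
    then show ?thesis by (simp add: chart_y0)
  qed
  \<comment> \<open>Changing each coordinate by at most \<open>e\<close> moves the chart point by
    less than \<open>\<epsilon>\<close>; the 1 guards against a zero denominator for
    \<open>k = 0\<close>.\<close>
  define e where "e = \<epsilon> / ((\<Sum>j<k. norm (v j)) + 1)"
  have snn: "0 \<le> (\<Sum>j<k. norm (v j))" by (intro sum_nonneg) simp
  then have e: "e > 0" using \<epsilon> by (simp add: e_def add_nonneg_pos)
  let ?B = "Pi\<^sub>E {..<k} (\<lambda>i. {y1 i - e .. y1 i + e})"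
  have inB: "chart y \<in> cap \<and> 0 < G (chart y)" if y: "y \<in> ?B" for y
  proof -
    have "norm (\<Sum>j<k. (y j - y1 j) *\<^sub>R v j) \<le> (\<Sum>j<k. e * norm (v j))"
    proof (rule sum_norm_le)
      fix j assume "j \<in> {..<k}"
      then have "y1 j - e \<le> y j \<and> y j \<le> y1 j + e" using y by (auto simp: PiE_iff)
      then have "\<bar>y j - y1 j\<bar> \<le> e" by linarith
      then show "norm ((y j - y1 j) *\<^sub>R v j) \<le> e * norm (v j)" by (simp add: mult_right_mono)
    qed
    also have "\<dots> = e * (\<Sum>j<k. norm (v j))" by (simp add: sum_distrib_left)
    also have "\<dots> < e * ((\<Sum>j<k. norm (v j)) + 1)" using e by simp
    also have "\<dots> = \<epsilon>" using snn by (simp add: e_def)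
    finally have n: "norm (chart y - x1) < \<epsilon>" unfolding chart1[symmetric] chart_diff .
    have "chart y - x1 \<in> span (v ` {..<k})"
      unfolding chart1[symmetric] chart_diff by (intro span_sum span_scale span_base) auto
    from Gpos[OF this n] show ?thesis by simp
  qed
  have "AE y in chart_measure. indicator cap (chart y) * G (chart y) = 0"
    using zero nonneg unfolding cap_integral_def
    by (subst (asm) integral_nonneg_eq_0_iff_AE[OF integrable_cap[OF cont]]) (auto simp: indicator_def)
  then have ae: "AE y in chart_measure. y \<notin> ?B"
  proof eventually_elim
    case (elim y)
    show ?case
    proof
      assume "y \<in> ?B"
      from inB[OF this] elim show False by simp
    qed
  qed
  have Bs: "?B \<in> sets chart_measure" by (intro sets_PiM_I_finite) auto
  have "{y \<in> space chart_measure. \<not> y \<notin> ?B} = ?B"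
    using sets.sets_into_space[OF Bs] by blast
  from AE_iff_measurable[OF Bs this] ae have "emeasure chart_measure ?B = 0"
    by (rule iffD1)
  moreover have "emeasure chart_measure ?B = (\<Prod>i<k. emeasure lborel {y1 i - e .. y1 i + e})"
    by (rule lborel_product.emeasure_PiM) auto
  ultimately show False using e by simp
qed

text \<open>Rescaling shows that constants \<open>q\<close> do not contribute.\<close>
lemma cap_integral_estimate:
  assumes g: "continuous_on cap g" and \<phi>: "continuous_on UNIV \<phi>" "\<And>t. 0 \<le> \<phi> t"
    and \<phi>0: "\<And>t. b \<le> t \<Longrightarrow> \<phi> t = 0" and b: "b < R\<^sup>2" and l: "1 \<le> l"
    and small: "\<And>x. x \<in> cap \<Longrightarrow> l\<^sup>2 * (norm (x - w))\<^sup>2 < b \<Longrightarrow> - \<epsilon> \<le> g x"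
  shows "cap_integral (\<lambda>x. (g x + q) * (\<phi> ((norm (x - w))\<^sup>2) - l ^ k * \<phi> (l\<^sup>2 * (norm (x - w))\<^sup>2)))
    \<le> cap_integral (\<lambda>x. g x * \<phi> ((norm (x - w))\<^sup>2)) + \<epsilon> * cap_integral (\<lambda>x. \<phi> ((norm (x - w))\<^sup>2))"
proof -
  let ?u = "\<lambda>x. \<phi> ((norm (x - w))\<^sup>2)" and ?u' = "\<lambda>x. l ^ k * \<phi> (l\<^sup>2 * (norm (x - w))\<^sup>2)"
  have u: "continuous_on cap ?u"
    by (rule continuous_on_compose2[OF \<phi>(1)]) (auto intro!: continuous_intros)
  have u': "continuous_on cap ?u'"
    by (intro continuous_on_mult continuous_on_const, rule continuous_on_compose2[OF \<phi>(1)])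
      (auto intro!: continuous_intros)
  have "cap_integral (\<lambda>x. l ^ k * ?u (w + l *\<^sub>R (x - w))) = cap_integral ?u"
  proof (rule cap_integral_scale[OF l u])
    fix x assume "R < norm (x - w)"
    then have "R\<^sup>2 \<le> (norm (x - w))\<^sup>2" using R by (intro power_mono) auto
    with b show "?u x = 0" by (intro \<phi>0) simp
  qed
  then have eq: "cap_integral ?u' = cap_integral ?u"
    by (simp add: power_mult_distrib)
  \<comment> \<open>\<open>?u'\<close> vanishes outside the small region where
    \<open>- \<epsilon> \<le> g x\<close>, so the bound holds on the whole cap.\<close>
  have "cap_integral (\<lambda>x. (- \<epsilon>) * ?u' x) \<le> cap_integral (\<lambda>x. g x * ?u' x)"
  proof (rule cap_integral_mono)
    show "- \<epsilon> * ?u' x \<le> g x * ?u' x" if "x \<in> cap" for x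
    proof (cases "l\<^sup>2 * (norm (x - w))\<^sup>2 < b")
      case True
      then show ?thesis using small[OF that] l \<phi>(2) by (intro mult_right_mono) auto
    next
      case False
      then show ?thesis using \<phi>0[of "l\<^sup>2 * (norm (x - w))\<^sup>2"] by simp
    qed
  qed (intro continuous_on_mult continuous_on_const g u')+
  then have A2: "- \<epsilon> * cap_integral ?u \<le> cap_integral (\<lambda>x. g x * ?u' x)"
    unfolding cap_integral_cmult[of "- \<epsilon>" ?u'] eq .
  \<comment> \<open>After expansion the two terms with \<open>q\<close> cancel, because
    \<open>?u\<close> and \<open>?u'\<close> have equal integrals.\<close>
  have "cap_integral (\<lambda>x. (g x + q) * (?u x - ?u' x)) =
    cap_integral (\<lambda>x. (g x * ?u x + (- 1) * (g x * ?u' x)) + (q * ?u x + (- q) * ?u' x))"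
    by (rule arg_cong[where f = cap_integral]) (simp add: fun_eq_iff algebra_simps)
  also have "\<dots> = (cap_integral (\<lambda>x. g x * ?u x) + cap_integral (\<lambda>x. (- 1) * (g x * ?u' x))) +
      (cap_integral (\<lambda>x. q * ?u x) + cap_integral (\<lambda>x. (- q) * ?u' x))"
    by (simp only: cap_integral_add continuous_on_add continuous_on_mult continuous_on_const g u u')
  also have "\<dots> = cap_integral (\<lambda>x. g x * ?u x) - cap_integral (\<lambda>x. g x * ?u' x)"
    unfolding cap_integral_cmult[of "- 1" "\<lambda>x. g x * ?u' x"] cap_integral_cmult[of q ?u]
      cap_integral_cmult[of "- q" ?u'] eq by simp
  finally show ?thesis using A2 by simp
qed

end

section \<open>The maximum principle\<close>

lemma span_lattice_basis:
  assumes "lattice_basis \<sigma> v"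
  shows "span (v ` {..<dim (par_space \<sigma>)}) = par_space \<sigma>"
proof -
  let ?k = "dim (par_space \<sigma>)"
  have sub: "v j \<in> par_space \<sigma>" if "j < ?k" for j
  proof -
    have "v j = (\<Sum>i<?k. of_int (if i = j then 1 else 0) *\<^sub>R v i)"
      using that by (simp add: if_distrib[of "\<lambda>x. of_int x *\<^sub>R _"] cong: if_cong)
    then have "v j \<in> {\<Sum>j<?k. of_int (c j) *\<^sub>R v j | c. True}"
      by (intro CollectI exI conjI TrueI)
    then have "v j \<in> par_lattice \<sigma>" using assms by (simp add: lattice_basis_def)
    then show ?thesis by (simp add: par_lattice_def)
  qed
  have "card (v ` {..<?k}) = ?k" using assms by (simp add: lattice_basis_def card_image)
  then have "par_space \<sigma> \<subseteq> span (v ` {..<?k})"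
    using assms sub card_eq_dim[of "v ` {..<?k}" "par_space \<sigma>"] by (auto simp: lattice_basis_def)
  moreover have "span (v ` {..<?k}) \<subseteq> par_space \<sigma>"
    using sub by (intro span_minimal) (auto simp: par_space_def)
  ultimately show ?thesis by blast
qed

text \<open>One number covers faces that miss \<open>w\<close> and faces through \<open>w\<close>,
  so the minimum over finitely many faces works for all. Membership in \<open>U\<close> is required
  since a face is only the trace of a polyhedron.\<close>

definition conic_radius :: "'n::finite rvec set \<Rightarrow> 'n rvec \<Rightarrow> 'n rvec set \<Rightarrow> real \<Rightarrow> bool" where
  "conic_radius U w \<sigma> r \<longleftrightarrow> (w \<notin> \<sigma> \<longrightarrow> ball w r \<inter> \<sigma> = {}) \<and>
     (w \<in> \<sigma> \<longrightarrow> (\<forall>x\<in>\<sigma>. \<forall>t>0. t * norm (x - w) < r \<longrightarrow> w + t *\<^sub>R (x - w) \<in> U \<longrightarrow>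
        w + t *\<^sub>R (x - w) \<in> \<sigma>))"

lemma conic_radius_mono: "conic_radius U w \<sigma> r \<Longrightarrow> s \<le> r \<Longrightarrow> conic_radius U w \<sigma> s"
  using subset_ball[of s r w] unfolding conic_radius_def by (meson disjoint_iff order.strict_trans2 subsetD)

lemma ex_conic_radius:
  assumes P: "ZR_polyhedron P" and w: "w \<in> U"
  shows "\<exists>r>0. conic_radius U w (P \<inter> U) r"
proof (cases "w \<in> P")
  case True
  then obtain r where "r > 0" "\<forall>x\<in>P. \<forall>t>0. t * norm (x - w) < r \<longrightarrow> w + t *\<^sub>R (x - w) \<in> P"
    using ZR_polyhedron_cone[OF P] by blast
  then show ?thesis using True w by (auto simp: conic_radius_def)
next
  case False
  have "open (- P)" using closed_ZR_polyhedron[OF P] by (simp add: open_Compl)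
  then obtain r where "r > 0" "ball w r \<subseteq> - P" using False by (auto elim: openE)
  then show ?thesis using False by (auto simp: conic_radius_def)
qed

lemma uniform_conic_radius:
  assumes "finite S" "\<And>\<sigma>. \<sigma> \<in> S \<Longrightarrow> \<exists>r>0. conic_radius U w \<sigma> r"
  shows "\<exists>r>0. \<forall>\<sigma>\<in>S. conic_radius U w \<sigma> r"
  using assms
proof (induction S rule: finite_induct)
  case empty
  then show ?case by (intro exI[of _ 1]) simp
next
  case (insert \<sigma> S)
  then obtain r where "r > 0" "\<forall>\<sigma>\<in>S. conic_radius U w \<sigma> r" by auto
  moreover obtain s where "s > 0" "conic_radius U w \<sigma> s" using insert.prems by auto
  ultimately show ?case by (intro exI[of _ "min r s"]) (auto intro: conic_radius_mono)
qed

lemma face_cone_chart: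
  fixes U P :: "'n::finite rvec set"
  assumes P: "ZR_polyhedron P" and \<sigma>: "\<sigma> = P \<inter> U" and U: "open U" and d: "aff_dim \<sigma> = int k"
    and w: "w \<in> \<sigma>" and R: "0 < R" "cball w R \<subseteq> U" "R < r" "conic_radius U w \<sigma> r"
  shows "\<exists>y0. cone_chart k (face_basis \<sigma>) (SOME x. x \<in> \<sigma>) y0 \<sigma> w R"
    and "span (face_basis \<sigma> ` {..<k}) = par_space \<sigma>" "dim (par_space \<sigma>) = k"
    and "inj_on (face_basis \<sigma>) {..<k}" "independent (face_basis \<sigma> ` {..<k})"
    and "\<And>x \<rho>. x \<in> \<sigma> \<Longrightarrow> 0 < \<rho> \<Longrightarrow> \<exists>x1. \<exists>\<epsilon>>0. \<forall>z\<in>par_space \<sigma>. norm z < \<epsilon> \<longrightarrow>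
       x1 + z \<in> \<sigma> \<and> dist (x1 + z) x < \<rho>"
proof -
  have ne: "P \<inter> U \<noteq> {}" using w \<sigma> by auto
  obtain M where M: "finite M" "M \<subseteq> int_vecs" "par_space (P \<inter> U) = {z. \<forall>m\<in>M. m \<bullet> z = 0}"
    and near: "\<And>x \<rho>. x \<in> P \<inter> U \<Longrightarrow> 0 < \<rho> \<Longrightarrow> \<exists>x1. \<exists>\<epsilon>>0. \<forall>z\<in>par_space (P \<inter> U). norm z < \<epsilon> \<longrightarrow>
       x1 + z \<in> P \<inter> U \<and> dist (x1 + z) x < \<rho>"
    using ZR_polyhedron_par_space[OF P U ne] by blast
  show "\<And>x \<rho>. x \<in> \<sigma> \<Longrightarrow> 0 < \<rho> \<Longrightarrow> \<exists>x1. \<exists>\<epsilon>>0. \<forall>z\<in>par_space \<sigma>. norm z < \<epsilon> \<longrightarrow>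
       x1 + z \<in> \<sigma> \<and> dist (x1 + z) x < \<rho>"
    unfolding \<sigma> by (rule near)
  have lb: "lattice_basis \<sigma> (face_basis \<sigma>)"
    unfolding face_basis_def
    using ex_lattice_basis[OF M(1,2), of \<sigma>] M(3) by (simp add: \<sigma> someI_ex)
  show dim: "dim (par_space \<sigma>) = k" using d w by (intro dim_par_space) auto
  show inj: "inj_on (face_basis \<sigma>) {..<k}" and ind: "independent (face_basis \<sigma> ` {..<k})"
    using lb by (simp_all add: lattice_basis_def dim)
  show span: "span (face_basis \<sigma> ` {..<k}) = par_space \<sigma>"
    using span_lattice_basis[OF lb] by (simp add: dim)
  let ?c = "SOME x. x \<in> \<sigma>"
  have c: "?c \<in> \<sigma>" using w by (rule someI)
  have "w - ?c \<in> par_space \<sigma>" unfolding par_space_def using w c by (intro span_base) blast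
  then have "w - ?c \<in> span (face_basis \<sigma> ` {..<k})" by (simp add: span)
  then obtain u where "w - ?c = (\<Sum>x\<in>face_basis \<sigma> ` {..<k}. u x *\<^sub>R x)"
    by (auto simp: span_finite)
  then have u: "w - ?c = (\<Sum>j<k. u (face_basis \<sigma> j) *\<^sub>R face_basis \<sigma> j)"
    using inj by (simp add: sum.reindex)
  have "cone_chart k (face_basis \<sigma>) ?c (u \<circ> face_basis \<sigma>) \<sigma> w R"
  proof
    show "w = ?c + (\<Sum>j<k. (u \<circ> face_basis \<sigma>) j *\<^sub>R face_basis \<sigma> j)"
      using u by (simp add: algebra_simps)
    \<comment> \<open>The ball lies in \<open>U\<close>, so inside it the face agrees with its
      polyhedron, which is closed.\<close>
    have "\<sigma> \<inter> cball w R = P \<inter> cball w R" using R \<sigma> by auto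
    then show "closed (\<sigma> \<inter> cball w R)" using closed_ZR_polyhedron[OF P] by auto
    fix x t assume x: "x \<in> \<sigma>" "0 < t" "t * norm (x - w) \<le> R"
    then have "w + t *\<^sub>R (x - w) \<in> cball w R" by (simp add: dist_norm)
    then have "w + t *\<^sub>R (x - w) \<in> U" using R(2) by blast
    moreover have "t * norm (x - w) < r" using x R(3) by simp
    ultimately show "w + t *\<^sub>R (x - w) \<in> \<sigma>"
      using R(4) x w unfolding conic_radius_def by blast
  qed (use inj ind w R in auto)
  then show "\<exists>y0. cone_chart k (face_basis \<sigma>) ?c y0 \<sigma> w R" by blast
qed

lemma top_coeff_scale: "top_coeff k (\<lambda>I J. r * a I J) = r * top_coeff k a"
  by (simp add: top_coeff_def)

lemma lext_pullback_zero: "lext_pullback k v (\<lambda>I J. 0) = (\<lambda>K L. 0)"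
  by (simp add: lext_pullback_def fun_eq_iff)

abbreviation face_cap_integral ::
  "nat \<Rightarrow> 'n::finite rvec \<Rightarrow> real \<Rightarrow> 'n rvec set \<Rightarrow> ('n rvec \<Rightarrow> real) \<Rightarrow> real" where
  "face_cap_integral k w R \<sigma> \<equiv>
     cone_chart.cap_integral k (face_basis \<sigma>) (SOME x. x \<in> \<sigma>) \<sigma> w R"

lemma face_integral_eq_cap_integral:
  assumes cc: "cone_chart k (face_basis \<sigma>) (SOME x. x \<in> \<sigma>) y0 \<sigma> w R"
    and k: "dim (par_space \<sigma>) = k"
    and G: "\<And>x. x \<in> \<sigma> \<Longrightarrow> top_coeff k (\<theta> x) = G x"
    and G0: "\<And>x. x \<in> \<sigma> \<Longrightarrow> x \<notin> cball w R \<Longrightarrow> G x = 0"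
  shows "face_integral \<sigma> \<theta> = face_cap_integral k w R \<sigma> G"
proof -
  interpret cone_chart k "face_basis \<sigma>" "SOME x. x \<in> \<sigma>" y0 \<sigma> w R by (rule cc)
  have ch: "face_chart \<sigma> = chart"
    by (simp add: fun_eq_iff face_chart_def chart_def k)
  show ?thesis
    unfolding face_integral_def cap_integral_def Let_def k ch set_lebesgue_integral_def
    by (intro Bochner_Integration.integral_cong refl)
      (auto simp: indicator_def cap_def G G0)
qed

lemma face_integral_zero:
  assumes "\<And>x. x \<in> \<sigma> \<Longrightarrow> top_coeff (dim (par_space \<sigma>)) (\<theta> x) = 0"
  shows "face_integral \<sigma> \<theta> = 0"
proof -
  let ?M = "PiM {..<dim (par_space \<sigma>)} (\<lambda>_::nat. lborel :: real measure)"
  have "face_integral \<sigma> \<theta> = integral\<^sup>L ?M (\<lambda>_. 0)"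
    unfolding face_integral_def Let_def set_lebesgue_integral_def
    by (intro Bochner_Integration.integral_cong refl) (auto simp: indicator_def assms)
  then show ?thesis by simp
qed

text \<open>The psh inequality for the radial test form, rewritten in terms of cone integrals. Faces
  not through \<open>w\<close> miss the ball outside which \<open>h\<close> vanishes, so a finite
  sum over the faces through \<open>w\<close> remains. The factor \<open>face_density\<close> is
  constant on each face and leaves the integral.\<close>

lemma weakly_psh_radial_test:
  fixes U :: "'n::{finite,linorder} rvec set"
  assumes psh: "weakly_tropically_psh U (Suc p) \<C> m f"
    and sub: "\<Union>\<C> \<subseteq> U" and U: "open U" and R: "0 < R"
    and closed: "closed (\<Union>\<C> \<inter> cball w R)"
    and away: "\<And>\<sigma>. \<sigma> \<in> \<C> \<Longrightarrow> w \<notin> \<sigma> \<Longrightarrow> \<sigma> \<inter> cball w R = {}"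
    and fin: "finite {\<sigma> \<in> faces_of_dim (Suc p) \<C>. w \<in> \<sigma>}"
    and cc: "\<And>\<sigma>. \<sigma> \<in> faces_of_dim (Suc p) \<C> \<Longrightarrow> w \<in> \<sigma> \<Longrightarrow>
      \<exists>y0. cone_chart (Suc p) (face_basis \<sigma>) (SOME x. x \<in> \<sigma>) y0 \<sigma> w R"
    and span: "\<And>\<sigma>. \<sigma> \<in> faces_of_dim (Suc p) \<C> \<Longrightarrow> w \<in> \<sigma> \<Longrightarrow>
      span (face_basis \<sigma> ` {..<Suc p}) = par_space \<sigma>"
    and ab: "0 < a" "a < b" "b < R\<^sup>2" and l: "1 < l"
  defines "\<phi> \<equiv> radial_weight (real (Suc p)) a b"
  shows "0 \<le> (\<Sum>\<sigma> | \<sigma> \<in> faces_of_dim (Suc p) \<C> \<and> w \<in> \<sigma>.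
    m \<sigma> * face_density (Suc p) (face_basis \<sigma>) * face_cap_integral (Suc p) w R \<sigma>
      (\<lambda>x. f x * (\<phi> ((norm (x - w))\<^sup>2) - l ^ Suc p * \<phi> (l\<^sup>2 * (norm (x - w))\<^sup>2))))"
proof -
  let ?k = "Suc p"
  let ?u = "\<lambda>x. (norm (x - w))\<^sup>2"
  let ?W = "\<lambda>x. \<phi> (?u x) - l ^ Suc p * \<phi> (l\<^sup>2 * ?u x)"
  let ?F = "{\<sigma> \<in> faces_of_dim ?k \<C>. w \<in> \<sigma>}"
  have dim: "dim (par_space \<sigma>) = ?k" if "\<sigma> \<in> faces_of_dim ?k \<C>" for \<sigma>
  proof -
    have "aff_dim \<sigma> = int ?k" using that by (simp add: faces_of_dim_def)
    moreover have "\<sigma> \<noteq> {}" using calculation by auto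
    ultimately show ?thesis by (rule dim_par_space)
  qed
  obtain H F F' where H: "\<And>t. (H has_real_derivative F t) (at t)"
    "\<And>t. (F has_real_derivative F' t) (at t)" "\<And>t. 0 \<le> H t"
    and Hb: "\<And>t. b \<le> t \<Longrightarrow> H t = 0 \<and> F t = 0 \<and> F' t = 0"
    and lap: "\<And>t. 0 \<le> t \<Longrightarrow> 2 * real ?k * F t + 4 * t * F' t =
       radial_weight (real ?k) a b t - l powr real ?k * radial_weight (real ?k) a b (l\<^sup>2 * t)"
    and smooth: "smooth_on UNIV (\<lambda>x. H (?u x))"
    using radial_profile[OF ab(1,2) l, of "real ?k" w] by blast
  define h where "h = (\<lambda>x. H (?u x))"
  define \<omega> where "\<omega> = (\<lambda>z (I :: 'n set) J. h z * base_form p I J)"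
  define \<eta> where "\<eta> = (\<lambda>\<sigma> x. restrict_to_face \<sigma> (\<omega> x))"
  define \<zeta> where "\<zeta> = (\<lambda>\<sigma> x. restrict_to_face \<sigma> (diff' (diff'' \<omega>) x))"
  have sh: "smooth_on UNIV h" using smooth by (simp add: h_def)
  have hess: "partial_deriv j (partial_deriv i h) x =
      2 * F (?u x) * (if i = j then 1 else 0) + 4 * F' (?u x) * ((x - w) $ i * (x - w) $ j)" for i j x
    unfolding h_def by (rule partial_deriv_radial(2)[OF H(1,2)])
  have h1: "h differentiable (at x)" "partial_deriv i h differentiable (at x)" for i x
    using smooth_onD[OF sh] smooth_onD[OF smooth_on_partial_deriv[OF sh]] by auto
  have far: "b \<le> ?u x" if "x \<notin> cball w R" for x
  proof -
    have "R < norm (x - w)" using that by (simp add: dist_norm norm_minus_commute)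
    then have "R\<^sup>2 \<le> ?u x" using R by (intro power_mono) auto
    then show ?thesis using ab(3) by simp
  qed
  have lf: "lagerberg_form p p U \<omega>"
    unfolding lagerberg_form_def
  proof (intro conjI allI ballI impI)
    show "smooth_on U (\<lambda>x. \<omega> x I J)" for I J
      unfolding \<omega>_def using smooth_on_subset[OF sh] U
      by (intro smooth_on_mult smooth_on_const) auto
  qed (auto simp: \<omega>_def base_form_def split: if_splits)
  have form: "form_on_complex U \<C> p p \<eta>"
    unfolding form_on_complex_def using sub U lf
    by (intro ballI exI[of _ U] exI[of _ \<omega>]) (auto simp: restricts_to_def \<eta>_def)
  have ddc: "is_ddc U \<C> p p \<eta> \<zeta>"
    unfolding is_ddc_def using sub U lf
    by (intro ballI exI[of _ U] exI[of _ \<omega>]) (auto simp: restricts_to_def \<eta>_def \<zeta>_def)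
  have pos: "positive_form ?k \<C> p \<eta>"
    unfolding positive_form_def \<eta>_def \<omega>_def restrict_to_face_def
    using H(3) by (auto simp: dim h_def intro!: positive_base_form)
  have compact: "compact (form_support \<C> \<eta>)"
  proof -
    let ?Y = "{y. \<exists>\<sigma>\<in>\<C>. y \<in> \<sigma> \<and> \<eta> \<sigma> y \<noteq> (\<lambda>I J. 0)}"
    have "y \<in> cball w R" if "y \<in> ?Y" for y
    proof (rule ccontr)
      assume "y \<notin> cball w R"
      from far[OF this] have "h y = 0" using Hb by (simp add: h_def)
      then show False using that by (auto simp: \<eta>_def \<omega>_def restrict_to_face_def lext_pullback_zero)
    qed
    then have "?Y \<subseteq> \<Union>\<C> \<inter> cball w R" by blast
    \<comment> \<open>The part of the complex inside the ball is closed, so taking the closure does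
      not leave the complex and the support is compact.\<close>
    then have "closure ?Y \<subseteq> \<Union>\<C> \<inter> cball w R" by (rule closure_minimal[OF _ closed])
    then have "form_support \<C> \<eta> = closure ?Y" "bounded (closure ?Y)"
      by (auto simp: form_support_def intro: bounded_subset[OF bounded_cball])
    then show ?thesis by (simp add: compact_eq_bounded_closed)
  qed
  have "0 \<le> tropical_current ?k \<C> m f \<zeta>"
    using psh form compact pos ddc unfolding weakly_tropically_psh_def by blast
  also have "tropical_current ?k \<C> m f \<zeta> =
      (\<Sum>\<^sub>\<infinity>\<sigma>\<in>?F. m \<sigma> * face_integral \<sigma> (\<lambda>x I J. f x * \<zeta> \<sigma> x I J))"
    unfolding tropical_current_def
  proof (rule infsum_cong_neutral)
    fix \<sigma> assume s: "\<sigma> \<in> faces_of_dim ?k \<C> - ?F"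
    have "face_integral \<sigma> (\<lambda>x I J. f x * \<zeta> \<sigma> x I J) = 0"
    proof (rule face_integral_zero)
      fix x assume x: "x \<in> \<sigma>"
      have "x \<notin> cball w R" using away[of \<sigma>] s x by (auto simp: faces_of_dim_def)
      from far[OF this] have "F (?u x) = 0" "F' (?u x) = 0" using Hb by auto
      \<comment> \<open>Off the ball the Hessian vanishes, so the Laplacian formula applies with
        both coefficients 0 and with the vector 0.\<close>
      then have "top_coeff ?k (lext_pullback ?k (face_basis \<sigma>)
          (diff' (diff'' (\<lambda>z I J. h z * base_form p I J)) x)) =
          face_density ?k (face_basis \<sigma>) * (real ?k * 0 + 0 * (norm (0 :: 'n rvec))\<^sup>2)"
        using hess by (intro top_coeff_ddc_base_form h1) (auto simp: span_zero)
      then show "top_coeff (dim (par_space \<sigma>)) (\<lambda>I J. f x * \<zeta> \<sigma> x I J) = 0"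
        using s by (simp add: top_coeff_scale \<zeta>_def \<omega>_def restrict_to_face_def dim)
    qed
    then show "m \<sigma> * face_integral \<sigma> (\<lambda>x I J. f x * \<zeta> \<sigma> x I J) = 0" by simp
  qed auto
  also have "\<dots> = (\<Sum>\<sigma>\<in>?F. m \<sigma> * face_integral \<sigma> (\<lambda>x I J. f x * \<zeta> \<sigma> x I J))"
    using fin by (rule infsum_finite)
  also have "\<dots> = (\<Sum>\<sigma>\<in>?F. m \<sigma> * face_density ?k (face_basis \<sigma>) *
      face_cap_integral ?k w R \<sigma> (\<lambda>x. f x * ?W x))"
  proof (rule sum.cong[OF refl])
    fix \<sigma> assume s: "\<sigma> \<in> ?F"
    then have s': "\<sigma> \<in> faces_of_dim ?k \<C>" "w \<in> \<sigma>" by auto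
    from cc[OF this] obtain y0 where
      y0: "cone_chart ?k (face_basis \<sigma>) (SOME x. x \<in> \<sigma>) y0 \<sigma> w R" by blast
    let ?D = "face_density ?k (face_basis \<sigma>)"
    have top: "top_coeff ?k (\<zeta> \<sigma> x) = ?D * ?W x" if x: "x \<in> \<sigma>" for x
    proof -
      have "x - w \<in> par_space \<sigma>" unfolding par_space_def using x s' by (intro span_base) blast
      then have "x - w \<in> span (face_basis \<sigma> ` {..<?k})" by (simp add: span[OF s'])
      then have "top_coeff ?k (lext_pullback ?k (face_basis \<sigma>)
          (diff' (diff'' (\<lambda>z I J. h z * base_form p I J)) x)) =
          ?D * (real ?k * (2 * F (?u x)) + 4 * F' (?u x) * (norm (x - w))\<^sup>2)"
        by (intro top_coeff_ddc_base_form h1 hess)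
      also have "\<dots> = ?D * (2 * real ?k * F (?u x) + 4 * ?u x * F' (?u x))"
        by (simp add: mult_ac)
      also have "\<dots> = ?D * ?W x"
        using l by (subst lap) (simp_all add: \<phi>_def powr_realpow del: of_nat_Suc power_Suc)
      finally show ?thesis by (simp add: \<zeta>_def \<omega>_def restrict_to_face_def dim[OF s'(1)])
    qed
    have "?W x = 0" if "x \<notin> cball w R" for x
    proof -
      \<comment> \<open>As \<open>l > 1\<close>, the second argument of \<open>\<phi>\<close> lies
        beyond \<open>b\<close> whenever the first one does.\<close>
      have "?u x \<le> l\<^sup>2 * ?u x" using l by (simp add: mult_le_cancel_right1 one_le_power)
      then show ?thesis using far[OF that] by (simp add: \<phi>_def radial_weight_zero)
    qed
    then have "face_integral \<sigma> (\<lambda>x I J. f x * \<zeta> \<sigma> x I J) =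
        face_cap_integral ?k w R \<sigma> (\<lambda>x. ?D * (f x * ?W x))"
      by (intro face_integral_eq_cap_integral[OF y0 dim[OF s'(1)]]) (auto simp: top_coeff_scale top)
    then show "m \<sigma> * face_integral \<sigma> (\<lambda>x I J. f x * \<zeta> \<sigma> x I J) =
        m \<sigma> * ?D * face_cap_integral ?k w R \<sigma> (\<lambda>x. f x * ?W x)"
      by (simp add: cone_chart.cap_integral_cmult[OF y0] mult.assoc)
  qed
  finally show ?thesis .
qed

theorem proposition7p4:
  fixes U :: "('n::{finite,linorder} rvec) set" and d :: nat
    and \<C> :: "'n rvec set set" and m :: "'n rvec set \<Rightarrow> real"
    and f :: "'n rvec \<Rightarrow> real" and \<omega> :: "'n rvec"
  assumes "open U"
    and "tropical_variety U d \<C> m"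
    and "piecewise_smooth U d \<C> m f"
    and "weakly_tropically_psh U d \<C> m f"
    and "\<omega> \<in> \<Union>\<C>"
    and "\<exists>W. open W \<and> \<omega> \<in> W \<and> (\<forall>x\<in>\<Union>\<C> \<inter> W. f x \<le> f \<omega>)"
  shows "\<exists>W. open W \<and> \<omega> \<in> W \<and> (\<forall>x\<in>\<Union>\<C> \<inter> W. f x = f \<omega>)"
proof -
  have complex: "polyhedral_complex_in U \<C>" and pure: "pure_dim d \<C>"
    and mpos: "\<And>\<sigma>. \<sigma> \<in> faces_of_dim d \<C> \<Longrightarrow> 0 < m \<sigma>"
    using assms(2) by (auto simp: tropical_variety_def)
  have poly: "\<exists>P. ZR_polyhedron P \<and> \<sigma> = P \<inter> U" if "\<sigma> \<in> \<C>" for \<sigma>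
    using complex that by (auto simp: polyhedral_complex_in_def)
  have sub: "\<Union>\<C> \<subseteq> U" using poly by blast
  have wU: "\<omega> \<in> U" using sub assms(5) by blast
  have cont: "continuous_on (\<Union>\<C>) f" using assms(3) by (simp add: piecewise_smooth_def)
  obtain W0 where W0: "open W0" "\<omega> \<in> W0" "finite {\<sigma>\<in>\<C>. \<sigma> \<inter> W0 \<noteq> {}}"
    using complex wU unfolding polyhedral_complex_in_def by blast
  obtain W1 where W1: "open W1" "\<omega> \<in> W1" "\<forall>x\<in>\<Union>\<C> \<inter> W1. f x \<le> f \<omega>" using assms(6) by blast
  let ?N = "{\<sigma>\<in>\<C>. \<sigma> \<inter> W0 \<noteq> {}}"
  have "\<exists>r>0. conic_radius U \<omega> \<sigma> r" if "\<sigma> \<in> \<C>" for \<sigma>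
    using poly[OF that] ex_conic_radius[OF _ wU] by blast
  then have "\<exists>r>0. \<forall>\<sigma>\<in>?N. conic_radius U \<omega> \<sigma> r"
    by (intro uniform_conic_radius W0) auto
  then obtain r where r: "r > 0" "\<And>\<sigma>. \<sigma> \<in> ?N \<Longrightarrow> conic_radius U \<omega> \<sigma> r" by blast
  have "open (W0 \<inter> W1 \<inter> U)" "\<omega> \<in> W0 \<inter> W1 \<inter> U" using W0 W1 wU assms(1) by auto
  then obtain e where e: "e > 0" "cball \<omega> e \<subseteq> W0 \<inter> W1 \<inter> U"
    using open_contains_cball by blast
  \<comment> \<open>Strictly below \<open>r\<close>, so that the closed ball of radius
    \<open>R\<close> lies in the open ball where faces are conic or absent.\<close>
  define R where "R = min e (r / 2)"
  have R: "0 < R" "R < r" using e r by (auto simp: R_def)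
  have ball: "cball \<omega> R \<subseteq> W0 \<inter> W1 \<inter> U" using e by (auto simp: R_def)
  have away: "\<sigma> \<inter> cball \<omega> R = {}" if "\<sigma> \<in> \<C>" "\<omega> \<notin> \<sigma>" for \<sigma>
  proof (rule ccontr)
    assume "\<sigma> \<inter> cball \<omega> R \<noteq> {}"
    then have "\<sigma> \<in> ?N" using that ball by auto
    then have "ball \<omega> r \<inter> \<sigma> = {}" using r(2) that by (auto simp: conic_radius_def)
    moreover have "cball \<omega> R \<subseteq> ball \<omega> r" using R by auto
    ultimately show False using \<open>\<sigma> \<inter> cball \<omega> R \<noteq> {}\<close> by blast
  qed
  \<comment> \<open>Every point near \<open>\<omega>\<close> lies on a \<open>d\<close>-dimensional
    face by purity, and such a face meets the ball only if it contains
    \<open>\<omega>\<close>.\<close>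
  have top_face: "\<exists>\<sigma>\<in>faces_of_dim d \<C>. x \<in> \<sigma> \<and> \<omega> \<in> \<sigma>" if x: "x \<in> \<Union>\<C> \<inter> ball \<omega> R" for x
  proof -
    obtain \<tau> where "\<tau> \<in> \<C>" "x \<in> \<tau>" using x by blast
    then obtain \<sigma> where s: "\<sigma> \<in> faces_of_dim d \<C>" "x \<in> \<sigma>" using pure unfolding pure_dim_def by blast
    then have "\<sigma> \<inter> cball \<omega> R \<noteq> {}" using x by auto
    then have "\<omega> \<in> \<sigma>" using away[of \<sigma>] s by (auto simp: faces_of_dim_def)
    with s show ?thesis by blast
  qed
  have "f x0 = f \<omega>" if x0: "x0 \<in> \<Union>\<C> \<inter> ball \<omega> R" for x0
  proof (cases d)
    case 0
    obtain \<sigma> where s: "\<sigma> \<in> faces_of_dim d \<C>" "x0 \<in> \<sigma>" "\<omega> \<in> \<sigma>" using top_face[OF x0] by blast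
    \<comment> \<open>For \<open>d = 0\<close> there are no test forms, but a face containing both
      \<open>x0\<close> and \<open>\<omega>\<close> is a single point.\<close>
    then have "aff_dim \<sigma> = 0" using 0 by (simp add: faces_of_dim_def)
    then obtain a where "\<sigma> = {a}" using aff_dim_eq_0 by blast
    then show ?thesis using s by simp
  next
    case (Suc p)
    show ?thesis
    proof (cases "x0 = \<omega>")
      case False
      let ?k = "Suc p"
      let ?F = "{\<sigma> \<in> faces_of_dim ?k \<C>. \<omega> \<in> \<sigma>}"
      let ?u = "\<lambda>x. (norm (x - \<omega>))\<^sup>2"
      have Fin: "finite ?F"
        using W0 by (intro finite_subset[OF _ W0(3)]) (auto simp: faces_of_dim_def)
      have chart: "\<exists>y0. cone_chart ?k (face_basis \<sigma>) (SOME x. x \<in> \<sigma>) y0 \<sigma> \<omega> R"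
        "span (face_basis \<sigma> ` {..<?k}) = par_space \<sigma>"
        "0 < face_density ?k (face_basis \<sigma>)"
        "\<And>x \<rho>. x \<in> \<sigma> \<Longrightarrow> 0 < \<rho> \<Longrightarrow> \<exists>x1. \<exists>\<epsilon>>0. \<forall>z\<in>par_space \<sigma>. norm z < \<epsilon> \<longrightarrow>
           x1 + z \<in> \<sigma> \<and> dist (x1 + z) x < \<rho>"
        if s: "\<sigma> \<in> ?F" for \<sigma>
      proof -
        have s': "\<sigma> \<in> \<C>" "aff_dim \<sigma> = int ?k" "\<omega> \<in> \<sigma>" using s by (auto simp: faces_of_dim_def)
        obtain P where P: "ZR_polyhedron P" "\<sigma> = P \<inter> U" using poly[OF s'(1)] by blast
        have "conic_radius U \<omega> \<sigma> r" using s' W0 by (intro r(2)) auto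
        note fc = face_cone_chart[OF P assms(1) s'(2,3) R(1) _ R(2) this]
        have cU: "cball \<omega> R \<subseteq> U" using ball by blast
        show "\<exists>y0. cone_chart ?k (face_basis \<sigma>) (SOME x. x \<in> \<sigma>) y0 \<sigma> \<omega> R"
          "span (face_basis \<sigma> ` {..<?k}) = par_space \<sigma>"
          using fc(1,2)[OF cU] by blast+
        show "0 < face_density ?k (face_basis \<sigma>)"
          using fc(4,5)[OF cU] by (rule face_density_pos)
        show "\<exists>x1. \<exists>\<epsilon>>0. \<forall>z\<in>par_space \<sigma>. norm z < \<epsilon> \<longrightarrow>
           x1 + z \<in> \<sigma> \<and> dist (x1 + z) x < \<rho>" if "x \<in> \<sigma>" "0 < \<rho>" for x \<rho>
          by (rule fc(6)[OF cU that])
      qed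
      have clo: "closed (\<Union>\<C> \<inter> cball \<omega> R)"
      proof -
        have "\<Union>\<C> \<inter> cball \<omega> R = (\<Union>\<sigma>\<in>?N. \<sigma> \<inter> cball \<omega> R)" using ball by auto
        moreover have cl: "closed (\<sigma> \<inter> cball \<omega> R)" if s: "\<sigma> \<in> \<C>" for \<sigma>
        proof -
          obtain P where P: "ZR_polyhedron P" "\<sigma> = P \<inter> U" using poly[OF s] by blast
          then have "\<sigma> \<inter> cball \<omega> R = P \<inter> cball \<omega> R" using ball by auto
          then show ?thesis using closed_ZR_polyhedron[OF P(1)] by auto
        qed
        moreover have "closed (\<Union>\<sigma>\<in>?N. \<sigma> \<inter> cball \<omega> R)"
          using cl by (intro closed_UN W0(3)) auto
        ultimately show ?thesis by metis
      qed
      \<comment> \<open>The bump interval contains the squared distance of \<open>x0\<close>,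
        excludes a neighbourhood of 0, and ends before \<open>R\<^sup>2\<close>.\<close>
      define a where "a = ?u x0 / 2"
      define b where "b = (?u x0 + R\<^sup>2) / 2"
      have "norm (x0 - \<omega>) < R" using x0 by (simp add: dist_norm norm_minus_commute)
      then have "?u x0 < R\<^sup>2" using R by (intro power_strict_mono) auto
      moreover have "0 < ?u x0" using False by simp
      ultimately have ab: "0 < a" "a < ?u x0" "?u x0 < b" "b < R\<^sup>2" "a < b"
        by (auto simp: a_def b_def)
      define \<phi> where "\<phi> = radial_weight (real ?k) a b"
      have \<phi>: "continuous_on UNIV \<phi>" "\<And>t. 0 \<le> \<phi> t" "\<And>t. b \<le> t \<Longrightarrow> \<phi> t = 0"
        using ab by (auto simp: \<phi>_def continuous_on_radial_weight radial_weight_nonneg radial_weight_zero)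
      define g where "g x = f x - f \<omega>" for x
      let ?cap = "\<lambda>\<sigma>. \<sigma> \<inter> cball \<omega> R"
      have gle: "g x \<le> 0" if "x \<in> ?cap \<sigma>" "\<sigma> \<in> ?F" for x \<sigma>
      proof -
        have "x \<in> W1" "x \<in> \<Union>\<C>" using that ball by (auto simp: faces_of_dim_def)
        then show ?thesis using W1(3) by (simp add: g_def)
      qed
      have gc: "continuous_on (?cap \<sigma>) g" if "\<sigma> \<in> ?F" for \<sigma>
        unfolding g_def using that
        by (intro continuous_intros continuous_on_subset[OF cont]) (auto simp: faces_of_dim_def)
      let ?c = "\<lambda>\<sigma>. m \<sigma> * face_density ?k (face_basis \<sigma>)"
      have c: "0 < ?c \<sigma>" if "\<sigma> \<in> ?F" for \<sigma> using chart(3)[OF that] mpos that Suc by simp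
      let ?A = "\<lambda>\<sigma>. face_cap_integral ?k \<omega> R \<sigma> (\<lambda>x. g x * \<phi> (?u x))"
      let ?B = "\<lambda>\<sigma>. face_cap_integral ?k \<omega> R \<sigma> (\<lambda>x. \<phi> (?u x))"
      have cont\<phi>: "continuous_on X (\<lambda>x. \<phi> (?u x))" for X
        by (rule continuous_on_compose2[OF \<phi>(1)]) (auto intro!: continuous_intros)
      have zero: "face_cap_integral ?k \<omega> R \<sigma> (\<lambda>x. 0) = 0" if "\<sigma> \<in> ?F" for \<sigma>
        using chart(1)[OF that] cone_chart.cap_integral_cmult[of ?k "face_basis \<sigma>" _ _ \<sigma> \<omega> R 0 "\<lambda>_. 0"] by auto
      have Aneg: "?A \<sigma> \<le> 0" and Bpos: "0 \<le> ?B \<sigma>" if s: "\<sigma> \<in> ?F" for \<sigma>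
      proof -
        obtain y0 where y0: "cone_chart ?k (face_basis \<sigma>) (SOME x. x \<in> \<sigma>) y0 \<sigma> \<omega> R"
          using chart(1)[OF s] by blast
        note mono = cone_chart.cap_integral_mono[OF y0, unfolded cone_chart.cap_def[OF y0]]
        have "?A \<sigma> \<le> face_cap_integral ?k \<omega> R \<sigma> (\<lambda>x. 0)"
          using gle[OF _ s] \<phi>(2)
          by (intro mono continuous_on_mult gc[OF s] cont\<phi> continuous_on_const) (auto simp: mult_nonpos_nonneg)
        then show "?A \<sigma> \<le> 0" by (simp add: zero[OF s])
        have "face_cap_integral ?k \<omega> R \<sigma> (\<lambda>x. 0) \<le> ?B \<sigma>"
          using \<phi>(2) by (intro mono cont\<phi> continuous_on_const) auto
        then show "0 \<le> ?B \<sigma>" by (simp add: zero[OF s])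
      qed
      \<comment> \<open>The scale \<open>l\<close> is chosen in terms of \<open>\<epsilon>\<close>,
        but the resulting inequality is free of \<open>l\<close>; this replaces the passage to the
        limit.\<close>
      have key: "0 \<le> (\<Sum>\<sigma>\<in>?F. ?c \<sigma> * ?A \<sigma>) + \<epsilon> * (\<Sum>\<sigma>\<in>?F. ?c \<sigma> * ?B \<sigma>)" if \<epsilon>: "0 < \<epsilon>" for \<epsilon>
      proof -
        obtain \<delta> where \<delta>: "\<delta> > 0" "\<And>x. x \<in> \<Union>\<C> \<Longrightarrow> dist x \<omega> < \<delta> \<Longrightarrow> dist (f x) (f \<omega>) < \<epsilon>"
          using cont assms(5) \<epsilon> unfolding continuous_on_iff by meson
        \<comment> \<open>Chosen so that \<open>b < l\<^sup>2 * \<delta>\<^sup>2\<close>: the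
          concentrated weight lives within distance \<open>\<delta>\<close> of
          \<open>\<omega>\<close>, where \<open>g\<close> is above
          \<open>- \<epsilon>\<close>.\<close>
        define l where "l = 1 + b / \<delta>\<^sup>2"
        have l: "1 < l" using ab \<delta>(1) by (simp add: l_def)
        have small: "- \<epsilon> \<le> g x" if "x \<in> ?cap \<sigma>" "l\<^sup>2 * ?u x < b" "\<sigma> \<in> ?F" for x \<sigma>
        proof -
          have "l \<le> l\<^sup>2" using l by (simp add: power2_eq_square)
          then have "l * \<delta>\<^sup>2 \<le> l\<^sup>2 * \<delta>\<^sup>2" by (intro mult_right_mono) auto
          moreover have "l * \<delta>\<^sup>2 = \<delta>\<^sup>2 + b" using \<delta>(1) by (simp add: l_def distrib_right)
          moreover have "0 < \<delta>\<^sup>2" using \<delta>(1) by simp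
          ultimately have "b < l\<^sup>2 * \<delta>\<^sup>2" by linarith
          then have "l\<^sup>2 * ?u x < l\<^sup>2 * \<delta>\<^sup>2" using that by linarith
          then have "?u x < \<delta>\<^sup>2" using l by simp
          then have "norm (x - \<omega>) < \<delta>" using \<delta>(1) power_less_imp_less_base by fastforce
          then have "dist (f x) (f \<omega>) < \<epsilon>"
            using that by (intro \<delta>(2)) (auto simp: dist_norm faces_of_dim_def)
          then show ?thesis by (simp add: g_def dist_real_def)
        qed
        have est: "face_cap_integral ?k \<omega> R \<sigma>
            (\<lambda>x. f x * (\<phi> (?u x) - l ^ ?k * \<phi> (l\<^sup>2 * ?u x))) \<le> ?A \<sigma> + \<epsilon> * ?B \<sigma>"
          if s: "\<sigma> \<in> ?F" for \<sigma>
        proof -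
          obtain y0 where y0: "cone_chart ?k (face_basis \<sigma>) (SOME x. x \<in> \<sigma>) y0 \<sigma> \<omega> R"
            using chart(1)[OF s] by blast
          have "face_cap_integral ?k \<omega> R \<sigma>
            (\<lambda>x. (g x + f \<omega>) * (\<phi> (?u x) - l ^ ?k * \<phi> (l\<^sup>2 * ?u x))) \<le> ?A \<sigma> + \<epsilon> * ?B \<sigma>"
            by (rule cone_chart.cap_integral_estimate[OF y0, unfolded cone_chart.cap_def[OF y0],
                  OF gc[OF s] \<phi> ab(4) less_imp_le[OF l] small[OF _ _ s]])
          then show ?thesis by (simp add: g_def)
        qed
        have "0 \<le> (\<Sum>\<sigma>\<in>?F. ?c \<sigma> * face_cap_integral ?k \<omega> R \<sigma>
            (\<lambda>x. f x * (\<phi> (?u x) - l ^ ?k * \<phi> (l\<^sup>2 * ?u x))))"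
          unfolding \<phi>_def using chart(1,2) away assms(4) Suc
          by (intro weakly_psh_radial_test[OF _ sub assms(1) R(1) clo _ Fin _ _ ab(1,5,4) l]) auto
        also have "\<dots> \<le> (\<Sum>\<sigma>\<in>?F. ?c \<sigma> * (?A \<sigma> + \<epsilon> * ?B \<sigma>))"
          using est c by (intro sum_mono mult_left_mono) (auto intro: less_imp_le)
        also have "\<dots> = (\<Sum>\<sigma>\<in>?F. ?c \<sigma> * ?A \<sigma>) + \<epsilon> * (\<Sum>\<sigma>\<in>?F. ?c \<sigma> * ?B \<sigma>)"
          by (simp add: distrib_left sum.distrib sum_distrib_left mult_ac)
        finally show ?thesis .
      qed
      define SA where "SA = (\<Sum>\<sigma>\<in>?F. ?c \<sigma> * ?A \<sigma>)"
      define SB where "SB = (\<Sum>\<sigma>\<in>?F. ?c \<sigma> * ?B \<sigma>)"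
      have SB: "0 \<le> SB" unfolding SB_def using c Bpos by (intro sum_nonneg) (auto intro: less_imp_le mult_nonneg_nonneg)
      have SA: "0 \<le> SA"
      proof (rule ccontr)
        assume "\<not> 0 \<le> SA"
        then have neg: "SA < 0" by simp
        \<comment> \<open>This \<open>\<epsilon>\<close> turns the right-hand side of
          \<open>key\<close> into \<open>SA / (SB + 1)\<close>, which is negative; the 1 covers the
          possibility \<open>SB = 0\<close>.\<close>
        have "0 < - SA / (SB + 1)" using neg SB by (intro divide_pos_pos) auto
        from key[OF this] have "0 \<le> SA + - SA / (SB + 1) * SB" by (simp add: SA_def SB_def)
        also have "\<dots> = SA / (SB + 1)" using SB by (simp add: field_simps)
        also have "\<dots> < 0" using neg SB by (intro divide_neg_pos) auto
        finally show False by simp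
      qed
      have neg: "?c \<sigma> * ?A \<sigma> \<le> 0" if "\<sigma> \<in> ?F" for \<sigma>
        using c[OF that] Aneg[OF that] by (simp add: mult_nonneg_nonpos)
      obtain \<sigma> where s: "\<sigma> \<in> ?F" "x0 \<in> \<sigma>" using top_face[OF x0] Suc by blast
      \<comment> \<open>All summands are nonpositive and their sum is nonnegative, so the summand of
        the face through \<open>x0\<close> is 0.\<close>
      have "SA = ?c \<sigma> * ?A \<sigma> + (\<Sum>\<sigma>\<in>?F - {\<sigma>}. ?c \<sigma> * ?A \<sigma>)"
        unfolding SA_def by (rule sum.remove[OF Fin s(1)])
      moreover have "(\<Sum>\<sigma>\<in>?F - {\<sigma>}. ?c \<sigma> * ?A \<sigma>) \<le> 0"
        by (intro sum_nonpos neg) blast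
      ultimately have "?c \<sigma> * ?A \<sigma> = 0"
        using SA neg[OF s(1)] by linarith
      then have A0: "?A \<sigma> = 0" using c[OF s(1)] by auto
      obtain y0 where y0: "cone_chart ?k (face_basis \<sigma>) (SOME x. x \<in> \<sigma>) y0 \<sigma> \<omega> R"
        using chart(1)[OF s(1)] by blast
      \<comment> \<open>The vanishing criterion is for nonnegative integrands, hence the factor
        \<open>- 1\<close>.\<close>
      have "(- 1) * (g x0 * \<phi> (?u x0)) = 0"
      proof (rule cone_chart.cap_integral_eq_0D[OF y0, unfolded cone_chart.cap_def[OF y0],
            where G = "\<lambda>x. (- 1) * (g x * \<phi> (?u x))"])
        show "continuous_on (?cap \<sigma>) (\<lambda>x. (- 1) * (g x * \<phi> (?u x)))"
          by (intro continuous_on_mult continuous_on_const gc[OF s(1)] cont\<phi>)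
        show "0 \<le> (- 1) * (g x * \<phi> (?u x))" if "x \<in> ?cap \<sigma>" for x
          using gle[OF that s(1)] \<phi>(2)[of "?u x"] by (simp add: mult_nonpos_nonneg)
        show "face_cap_integral ?k \<omega> R \<sigma> (\<lambda>x. (- 1) * (g x * \<phi> (?u x))) = 0"
          unfolding cone_chart.cap_integral_cmult[OF y0] A0 by simp
        show "x0 \<in> \<sigma>" "norm (x0 - \<omega>) < R" by fact+
        show "\<exists>x1. \<exists>\<epsilon>>0. \<forall>z\<in>span (face_basis \<sigma> ` {..<?k}). norm z < \<epsilon> \<longrightarrow>
           x1 + z \<in> \<sigma> \<and> dist (x1 + z) x0 < \<rho>" if "0 < \<rho>" for \<rho>
          unfolding chart(2)[OF s(1)] by (rule chart(4)[OF s(1,2) that])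
        show "x - \<omega> \<in> span (face_basis \<sigma> ` {..<?k})" if "x \<in> \<sigma>" for x
          unfolding chart(2)[OF s(1)] par_space_def using that s(1) by (intro span_base) blast
      qed
      moreover have "0 < \<phi> (?u x0)" unfolding \<phi>_def using ab by (intro radial_weight_pos)
      ultimately show ?thesis by (simp add: g_def)
    qed simp
  qed
  then show ?thesis using R(1) by (intro exI[of _ "ball \<omega> R"]) auto
qed

end
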